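(* Let $\mathcal A=A(V,R)=T(V)/(R)$ be a quadratic $*$-algebra with characteristic variety $E\subset P(V^* )$, automorphism $\sigma$ of $E$ and antilinear involution $j$, written $j(Z)=\bar Z$. Let $K\subset E$ be a compact $\sigma$-invariant subset and let $Q\in S^2(V)$ be central and strictly positive on $\{(Z,\bar Z);\ Z\in K\}$. Let $\mathcal L$ be the restriction to $K$ of the dual of the tautological line bundle on $P(V^* )$, endowed with the hermitian metric $\langle\ ,\ \rangle_Q$. (i) The equality $\sqrt2\,\theta(Y)=Y\,W+W^*\,\bar Y^*$ $(Y\in V)$ yields a $*$-homomorphism $$\theta:\mathcal A=A(V,R)\to C(K)\times_{\sigma,\mathcal L}\mathbb Z .$$ (ii) For any $Y\in V$ the $C^*$-norm of $\theta(Y)$ fulfills $$\sup_K\|Y\|\le\sqrt2\,\|\theta(Y)\|\le2\sup_K\|Y\| .$$ (iii) If $\sigma^4\neq\mathbb 1$, then $\theta(Q)=1$, where $Q$ is viewed as an element of $T(V)/(R)$.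
   Context: A quadratic $*$-algebra is a quadratic algebra $\mathcal A=T(V)/(R)$ ($V$ finite-dimensional complex, $R\subset V\otimes V$, $(R)$ the two-sided ideal generated by $R$ in the tensor algebra) with an antilinear antimultiplicative involution $x\mapsto x^*$ preserving $V$; $j$ denotes its restriction to $V$, also written $j(Y)=\bar Y$, and also the antilinear involution on $V^*$ (and on $P(V^* )$) determined by $j(L)(Z)=\overline{L(j(Z))}$ for $L\in V$, $Z\in V^*$. Elements of $V\otimes V$ are viewed as bilinear forms on $V^*$, elements of $S^2(V)$ as symmetric bilinear forms. Let $\Gamma\subset P(V^* )\times P(V^* )$ be the set of $(Z,Z')$ with $\omega(Z,Z')=0$ for all $\omega\in R$; it is assumed that both projections of $\Gamma$ equal $E\subset P(V^* )$ (the characteristic variety) and that $\Gamma$ is the graph of an automorphism $\sigma$ of $E$. Then $j(E)=E$ and $\sigma\circ j=j\circ\sigma^{-1}$. $Q$ is central on a set of pairs $(Z,Z')\in E\times E$ if $\omega(Z,Z')\,Q(\sigma(Z'),\sigma^{-1}(Z))+Q(Z,Z')\,\omega(\sigma(Z'),\sigma^{-1}(Z))=0$ for all these pairs and all $\omega\in R$. Strict positivity on $\{(Z,\bar Z);Z\in K\}$ means $Q(Z,\bar Z)>0$ for all $Z\in K$. Each $L\in V$ defines a section of $\mathcal L$. The metric is $\langle fL,gL'\rangle_Q(Z)=f(Z)\overline{g(Z)}\,\dfrac{L(Z)\overline{L'(Z)}}{Q(Z,j(Z))}$ for $L,L'\in V$, $f,g\in C(K)$, $Z\in K$; $\|Y\|$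 is the corresponding pointwise norm of the section $Y$. Twisted crossed product: for a compact space $K$, a homeomorphism $\sigma$ and a hermitian line bundle $\mathcal L$ on $K$, set $\mathcal L_n=\mathcal L\otimes\mathcal L^{\sigma}\otimes\cdots\otimes\mathcal L^{\sigma^{n-1}}$ ($\mathcal L^{\sigma^i}$ the pullback by $\sigma^i$). Consider the $*$-algebra spanned by the monomials $\xi W^n$, $W^{*n}\eta^*$ with $\xi,\eta\in C(K,\mathcal L_n)$, $n\ge0$, with product determined by $(\xi_1W^{n_1})(\xi_2W^{n_2})=(\xi_1\otimes(\xi_2\circ\sigma^{n_1}))W^{n_1+n_2}$, $(W^{*k}\eta^* )(\xi W^k)=(\eta^*\xi)\circ\sigma^{-k}$, $(\xi W^k)(W^{*k}\eta^* )=\xi\eta^*$, where $\eta^*\xi=\xi\eta^*=\langle\xi,\eta\rangle$ is the function given by the hermitian metric. $C(K)\times_{\sigma,\mathcal L}\mathbb Z$ is its completion for the supremum of the norms in its involutive Hilbert space representations.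
   Formalization: The upper bound in (ii) is proved for j(K)=K; (iii) is proved when K∪j(K) lies in some F⊂E such that Q is central on the pairs (Z,σ(Z)), Z∈F, and the points of F with σ⁴(Z)≠Z are dense in F. Without such conditions both claims fail. *)

theory Defs
  imports "HOL-Analysis.Analysis" "HOL-Algebra.QuotRing" "HOL-Algebra.Module"
begin

section \<open>The spaces \<open>V\<close>, \<open>V*\<close>, \<open>V \<otimes> V\<close> and \<open>P(V*)\<close>\<close>

text \<open>
  \<open>V\<close> is \<open>complex ^ 'n\<close>, its dual \<open>V*\<close> is \<open>complex ^ 'n\<close> in the dual basis, and an element of
  \<open>V \<otimes> V\<close> is its matrix of coefficients, viewed as a bilinear form on \<open>V*\<close>.
\<close>

definition pairing :: "complex^'n \<Rightarrow> complex^'n \<Rightarrow> complex" where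
  "pairing L Z = (\<Sum>i\<in>UNIV. L $ i * Z $ i)"

definition bform :: "complex^'n^'n \<Rightarrow> complex^'n \<Rightarrow> complex^'n \<Rightarrow> complex" where
  "bform w Z Z' = (\<Sum>i\<in>UNIV. \<Sum>k\<in>UNIV. w $ i $ k * Z $ i * Z' $ k)"

text \<open>The points of \<open>P(V*)\<close> are the complex lines in \<open>V*\<close>, so that \<open>line Z\<close> is the fibre at \<open>Z\<close> of
  the tautological line bundle; the topology is the quotient topology from \<open>V* - {0}\<close>.\<close>

typedef (overloaded) 'n proj = "{range (\<lambda>c::complex. c *s z) |z :: complex^('n::finite). z \<noteq> 0}"
  morphisms line Abs_proj
proof -
  have "(vec 1 :: complex^'n) \<noteq> 0" by (simp add: vec_eq_iff)
  then show ?thesis by blast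
qed

definition point :: "complex^'n \<Rightarrow> 'n::finite proj" where
  "point z = Abs_proj (range (\<lambda>c. c *s z))"

instantiation proj :: (finite) topological_space
begin

definition open_proj :: "'a proj set \<Rightarrow> bool" where
  "open_proj U \<longleftrightarrow> open {z :: complex^'a. z \<noteq> 0 \<and> point z \<in> U}"

instance
proof
  have "{z :: complex^'a. z \<noteq> 0 \<and> point z \<in> UNIV} = - {0}" by auto
  then show "open (UNIV :: 'a proj set)" unfolding open_proj_def by (simp add: open_Compl)
next
  fix S T :: "'a proj set"
  assume "open S" "open T"
  then have "open ({z :: complex^'a. z \<noteq> 0 \<and> point z \<in> S} \<inter> {z. z \<noteq> 0 \<and> point z \<in> T})"
    unfolding open_proj_def by (rule open_Int)
  also have "{z :: complex^'a. z \<noteq> 0 \<and> point z \<in> S} \<inter> {z. z \<noteq> 0 \<and> point z \<in> T}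
      = {z. z \<noteq> 0 \<and> point z \<in> S \<inter> T}" by auto
  finally show "open (S \<inter> T)" unfolding open_proj_def .
next
  fix \<K> :: "'a proj set set"
  assume "\<forall>S\<in>\<K>. open S"
  then have "open (\<Union>S\<in>\<K>. {z :: complex^'a. z \<noteq> 0 \<and> point z \<in> S})"
    unfolding open_proj_def by blast
  also have "(\<Union>S\<in>\<K>. {z :: complex^'a. z \<noteq> 0 \<and> point z \<in> S}) = {z. z \<noteq> 0 \<and> point z \<in> \<Union>\<K>}"
    by auto
  finally show "open (\<Union>\<K>)" unfolding open_proj_def .
qed

end

text \<open>The antilinear involution of \<open>V*\<close> (and of \<open>P(V*)\<close>) determined by that of \<open>V\<close> through
  \<open>j(L)(Z) = cnj (L(j(Z)))\<close>.\<close>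

definition dual_conj :: "(complex^'n \<Rightarrow> complex^'n) \<Rightarrow> complex^'n \<Rightarrow> complex^'n" where
  "dual_conj j Z = (THE W. \<forall>L. pairing (j L) Z = cnj (pairing L W))"

definition proj_conj :: "(complex^'n \<Rightarrow> complex^'n) \<Rightarrow> 'n::finite proj \<Rightarrow> 'n proj" where
  "proj_conj j Z = Abs_proj (dual_conj j ` line Z)"


section \<open>Complex *-algebras\<close>

text \<open>Complex algebras are HOL-Algebra rings with a scalar multiplication.\<close>

record 'a star_algebra = "(complex, 'a) module" +
  star :: "'a \<Rightarrow> 'a"

record 'a normed_star_algebra = "'a star_algebra" +
  alg_norm :: "'a \<Rightarrow> real"

definition star_involution :: "(complex, 'a, 'm) module_scheme \<Rightarrow> ('a \<Rightarrow> 'a) \<Rightarrow> bool" where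
  "star_involution A st \<longleftrightarrow>
     st \<in> carrier A \<rightarrow> carrier A \<and>
     (\<forall>x\<in>carrier A. \<forall>y\<in>carrier A. st (x \<oplus>\<^bsub>A\<^esub> y) = st x \<oplus>\<^bsub>A\<^esub> st y) \<and>
     (\<forall>c. \<forall>x\<in>carrier A. st (c \<odot>\<^bsub>A\<^esub> x) = cnj c \<odot>\<^bsub>A\<^esub> st x) \<and>
     (\<forall>x\<in>carrier A. \<forall>y\<in>carrier A. st (x \<otimes>\<^bsub>A\<^esub> y) = st y \<otimes>\<^bsub>A\<^esub> st x) \<and>
     (\<forall>x\<in>carrier A. st (st x) = x)"

definition star_hom ::
  "('a, 'm) star_algebra_scheme \<Rightarrow> ('b, 'k) star_algebra_scheme \<Rightarrow> ('a \<Rightarrow> 'b) set" where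
  "star_hom A B = {h \<in> ring_hom A B.
     (\<forall>c. \<forall>x\<in>carrier A. h (c \<odot>\<^bsub>A\<^esub> x) = c \<odot>\<^bsub>B\<^esub> h x) \<and>
     (\<forall>x\<in>carrier A. h (star A x) = star B (h x))}"

definition quot_algebra ::
  "(complex, 'a, 'm) module_scheme \<Rightarrow> 'a set \<Rightarrow> (complex, 'a set) module" where
  "quot_algebra A I =
     \<lparr>carrier = carrier (A Quot I), mult = mult (A Quot I), one = one (A Quot I),
      zero = zero (A Quot I), add = add (A Quot I),
      smult = (\<lambda>c X. \<Union>x\<in>X. I +>\<^bsub>A\<^esub> (c \<odot>\<^bsub>A\<^esub> x))\<rparr>"


section \<open>Quadratic *-algebras\<close>

text \<open>The tensor algebra \<open>T(V)\<close>: the word \<open>[i\<^sub>1, \<dots>, i\<^sub>k]\<close> stands for the basis tensor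
  \<open>e\<^bsub>i\<^sub>1\<^esub> \<otimes> \<dots> \<otimes> e\<^bsub>i\<^sub>k\<^esub>\<close>.\<close>

definition tensor_algebra :: "(complex, 'n list \<Rightarrow> complex) module" where
  "tensor_algebra =
     \<lparr>carrier = {f. finite {w. f w \<noteq> 0}},
      mult = (\<lambda>f g w. \<Sum>k\<le>length w. f (take k w) * g (drop k w)),
      one = (\<lambda>w. if w = [] then 1 else 0),
      zero = (\<lambda>w. 0),
      add = (\<lambda>f g w. f w + g w),
      smult = (\<lambda>c f w. c * f w)\<rparr>"

definition tensor1 :: "complex^'n \<Rightarrow> 'n list \<Rightarrow> complex" where
  "tensor1 v w = (case w of [i] \<Rightarrow> v $ i | _ \<Rightarrow> 0)"

definition tensor2 :: "complex^'n^'n \<Rightarrow> 'n list \<Rightarrow> complex" where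
  "tensor2 t w = (case w of [i, k] \<Rightarrow> t $ i $ k | _ \<Rightarrow> 0)"

text \<open>\<open>(R)\<close>; ideals of HOL-Algebra are two-sided.\<close>

definition relation_ideal :: "(complex^'n^'n) set \<Rightarrow> ('n list \<Rightarrow> complex) set" where
  "relation_ideal R = Idl\<^bsub>tensor_algebra\<^esub> (tensor2 ` R)"

definition quadratic_algebra ::
  "(complex^'n^'n) set \<Rightarrow> (complex, ('n list \<Rightarrow> complex) set) module" where
  "quadratic_algebra R = quot_algebra tensor_algebra (relation_ideal R)"

definition cls :: "(complex^'n^'n) set \<Rightarrow> ('n list \<Rightarrow> complex) \<Rightarrow> ('n list \<Rightarrow> complex) set" where
  "cls R x = relation_ideal R +>\<^bsub>tensor_algebra\<^esub> x"

text \<open>\<open>st\<close> is an antilinear antimultiplicative involution of \<open>T(V)/(R)\<close> that preserves \<open>V\<close>, with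
  restriction \<open>j\<close> to \<open>V\<close>. As \<open>V\<close> embeds in \<open>T(V)/(R)\<close>, this makes \<open>j\<close> an antilinear involution.\<close>

definition quadratic_star ::
  "(complex^'n^'n) set \<Rightarrow> (('n list \<Rightarrow> complex) set \<Rightarrow> ('n list \<Rightarrow> complex) set) \<Rightarrow>
   (complex^'n \<Rightarrow> complex^'n) \<Rightarrow> bool" where
  "quadratic_star R st j \<longleftrightarrow>
     star_involution (quadratic_algebra R) st \<and>
     (\<forall>v. st (cls R (tensor1 v)) = cls R (tensor1 (j v)))"

definition quadratic_star_algebra ::
  "(complex^'n^'n) set \<Rightarrow> (('n list \<Rightarrow> complex) set \<Rightarrow> ('n list \<Rightarrow> complex) set) \<Rightarrow>
   ('n list \<Rightarrow> complex) set star_algebra" where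
  "quadratic_star_algebra R st =
     (let A = quadratic_algebra R in
      \<lparr>carrier = carrier A, mult = mult A, one = one A, zero = zero A, add = add A,
       smult = smult A, star = st\<rparr>)"

definition char_relation :: "(complex^'n^'n) set \<Rightarrow> ('n::finite proj \<times> 'n proj) set" where
  "char_relation R = {(Z, Z'). \<forall>w\<in>R. \<forall>z\<in>line Z. \<forall>z'\<in>line Z'. bform w z z' = 0}"

text \<open>\<open>E\<close> is the characteristic variety and \<open>\<sigma>\<close> its automorphism. Only the bijectivity of \<open>\<sigma>\<close> on
  \<open>E\<close> is required; its continuity follows from the closedness of its graph.\<close>

definition characteristic_data ::
  "(complex^'n^'n) set \<Rightarrow> 'n::finite proj set \<Rightarrow> ('n proj \<Rightarrow> 'n proj) \<Rightarrow> bool" where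
  "characteristic_data R E \<sigma> \<longleftrightarrow>
     fst ` char_relation R = E \<and> snd ` char_relation R = E \<and>
     bij_betw \<sigma> E E \<and> char_relation R = (\<lambda>Z. (Z, \<sigma> Z)) ` E"

text \<open>The equation below is homogeneous, so it may be imposed on arbitrary representatives.\<close>

definition central_on ::
  "(complex^'n^'n) set \<Rightarrow> 'n::finite proj set \<Rightarrow> ('n proj \<Rightarrow> 'n proj) \<Rightarrow> complex^'n^'n \<Rightarrow>
   ('n proj \<times> 'n proj) set \<Rightarrow> bool" where
  "central_on R E \<sigma> Q C \<longleftrightarrow>
     (\<forall>(Z, Z')\<in>C. \<forall>w\<in>R. \<forall>z\<in>line Z. \<forall>z'\<in>line Z'. \<forall>u\<in>line (\<sigma> Z'). \<forall>u'\<in>line (inv_into E \<sigma> Z).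
        bform w z z' * bform Q u u' + bform Q z z' * bform w u u' = 0)"

definition strictly_positive_on ::
  "(complex^'n \<Rightarrow> complex^'n) \<Rightarrow> complex^'n^'n \<Rightarrow> 'n::finite proj set \<Rightarrow> bool" where
  "strictly_positive_on j Q K \<longleftrightarrow>
     (\<forall>Z\<in>K. \<forall>z\<in>line Z. z \<noteq> 0 \<longrightarrow> (\<exists>r>0. bform Q z (dual_conj j z) = complex_of_real r))"


section \<open>The universal C*-completion of a *-algebra\<close>

record 'h inner_space = "(complex, 'h) module" +
  hinner :: "'h \<Rightarrow> 'h \<Rightarrow> complex"

definition hnorm :: "('h, 'm) inner_space_scheme \<Rightarrow> 'h \<Rightarrow> real" where
  "hnorm H x = sqrt (Re (hinner H x x))"

definition cauchy_in :: "('a, 'm) ring_scheme \<Rightarrow> ('a \<Rightarrow> real) \<Rightarrow> (nat \<Rightarrow> 'a) \<Rightarrow> bool" where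
  "cauchy_in A p s \<longleftrightarrow>
     (\<forall>k. s k \<in> carrier A) \<and> (\<forall>e>0. \<exists>N. \<forall>k\<ge>N. \<forall>l\<ge>N. p (s k \<ominus>\<^bsub>A\<^esub> s l) < e)"

text \<open>The multiplication and the unit of the record are not used for a Hilbert space (as is usual
  for modules in HOL-Algebra). The inner product is linear in its first argument.\<close>

definition hilbert_space :: "('h, 'm) inner_space_scheme \<Rightarrow> bool" where
  "hilbert_space H \<longleftrightarrow>
     abelian_group H \<and>
     (\<forall>c. \<forall>x\<in>carrier H. c \<odot>\<^bsub>H\<^esub> x \<in> carrier H) \<and>
     (\<forall>c d. \<forall>x\<in>carrier H. (c + d) \<odot>\<^bsub>H\<^esub> x = c \<odot>\<^bsub>H\<^esub> x \<oplus>\<^bsub>H\<^esub> d \<odot>\<^bsub>H\<^esub> x) \<and>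
     (\<forall>c. \<forall>x\<in>carrier H. \<forall>y\<in>carrier H. c \<odot>\<^bsub>H\<^esub> (x \<oplus>\<^bsub>H\<^esub> y) = c \<odot>\<^bsub>H\<^esub> x \<oplus>\<^bsub>H\<^esub> c \<odot>\<^bsub>H\<^esub> y) \<and>
     (\<forall>c d. \<forall>x\<in>carrier H. (c * d) \<odot>\<^bsub>H\<^esub> x = c \<odot>\<^bsub>H\<^esub> (d \<odot>\<^bsub>H\<^esub> x)) \<and>
     (\<forall>x\<in>carrier H. 1 \<odot>\<^bsub>H\<^esub> x = x) \<and>
     (\<forall>x\<in>carrier H. \<forall>y\<in>carrier H. \<forall>z\<in>carrier H.
        hinner H (x \<oplus>\<^bsub>H\<^esub> y) z = hinner H x z + hinner H y z) \<and>
     (\<forall>c. \<forall>x\<in>carrier H. \<forall>y\<in>carrier H. hinner H (c \<odot>\<^bsub>H\<^esub> x) y = c * hinner H x y) \<and>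
     (\<forall>x\<in>carrier H. \<forall>y\<in>carrier H. hinner H y x = cnj (hinner H x y)) \<and>
     (\<forall>x\<in>carrier H. x \<noteq> \<zero>\<^bsub>H\<^esub> \<longrightarrow> Re (hinner H x x) > 0) \<and>
     (\<forall>s. cauchy_in H (hnorm H) s \<longrightarrow>
        (\<exists>x\<in>carrier H. (\<lambda>k. hnorm H (s k \<ominus>\<^bsub>H\<^esub> x)) \<longlonglongrightarrow> 0))"

definition bounded_operator :: "('h, 'm) inner_space_scheme \<Rightarrow> ('h \<Rightarrow> 'h) \<Rightarrow> bool" where
  "bounded_operator H T \<longleftrightarrow>
     T \<in> carrier H \<rightarrow> carrier H \<and>
     (\<forall>x\<in>carrier H. \<forall>y\<in>carrier H. T (x \<oplus>\<^bsub>H\<^esub> y) = T x \<oplus>\<^bsub>H\<^esub> T y) \<and>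
     (\<forall>c. \<forall>x\<in>carrier H. T (c \<odot>\<^bsub>H\<^esub> x) = c \<odot>\<^bsub>H\<^esub> T x) \<and>
     (\<exists>M. \<forall>x\<in>carrier H. hnorm H (T x) \<le> M * hnorm H x)"

definition op_norm :: "('h, 'm) inner_space_scheme \<Rightarrow> ('h \<Rightarrow> 'h) \<Rightarrow> real" where
  "op_norm H T = Sup {hnorm H (T x) |x. x \<in> carrier H \<and> hnorm H x \<le> 1}"

definition hilbert_representation ::
  "('a, 'k) star_algebra_scheme \<Rightarrow> ('h, 'm) inner_space_scheme \<Rightarrow> ('a \<Rightarrow> 'h \<Rightarrow> 'h) \<Rightarrow> bool" where
  "hilbert_representation B H \<pi> \<longleftrightarrow>
     hilbert_space H \<and>
     (\<forall>a\<in>carrier B. bounded_operator H (\<pi> a)) \<and>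
     (\<forall>a\<in>carrier B. \<forall>b\<in>carrier B. \<forall>x\<in>carrier H. \<pi> (a \<oplus>\<^bsub>B\<^esub> b) x = \<pi> a x \<oplus>\<^bsub>H\<^esub> \<pi> b x) \<and>
     (\<forall>c. \<forall>a\<in>carrier B. \<forall>x\<in>carrier H. \<pi> (c \<odot>\<^bsub>B\<^esub> a) x = c \<odot>\<^bsub>H\<^esub> \<pi> a x) \<and>
     (\<forall>a\<in>carrier B. \<forall>b\<in>carrier B. \<forall>x\<in>carrier H. \<pi> (a \<otimes>\<^bsub>B\<^esub> b) x = \<pi> a (\<pi> b x)) \<and>
     (\<forall>a\<in>carrier B. \<forall>x\<in>carrier H. \<forall>y\<in>carrier H.
        hinner H (\<pi> (star B a) x) y = hinner H x (\<pi> a y))"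

text \<open>
  The supremum of the norms in all involutive Hilbert space representations. HOL cannot quantify
  over all types inside a term, so the underlying sets of the Hilbert spaces are subsets of
  \<open>'a \<Rightarrow> complex\<close>. This loses nothing: the norm of \<open>\<pi> a\<close> is the supremum of its norms in the cyclic
  subrepresentations, and if \<open>\<xi>\<close> is a cyclic vector of \<open>H\<close> then \<open>x \<mapsto> (b \<mapsto> \<langle>x, \<pi>(b)\<xi>\<rangle>)\<close> embeds \<open>H\<close>
  in \<open>'a \<Rightarrow> complex\<close> and one can transport the structure of \<open>H\<close>.
\<close>

definition universal_norm :: "'a star_algebra \<Rightarrow> 'a \<Rightarrow> real" where
  "universal_norm B a =
     Sup {op_norm H (\<pi> a) |(H :: ('a \<Rightarrow> complex) inner_space) \<pi>. hilbert_representation B H \<pi>}"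

definition cauchy_algebra :: "'a star_algebra \<Rightarrow> ('a \<Rightarrow> real) \<Rightarrow> (complex, nat \<Rightarrow> 'a) module" where
  "cauchy_algebra B p =
     \<lparr>carrier = {s. cauchy_in B p s},
      mult = (\<lambda>s t k. s k \<otimes>\<^bsub>B\<^esub> t k),
      one = (\<lambda>k. \<one>\<^bsub>B\<^esub>),
      zero = (\<lambda>k. \<zero>\<^bsub>B\<^esub>),
      add = (\<lambda>s t k. s k \<oplus>\<^bsub>B\<^esub> t k),
      smult = (\<lambda>c s k. c \<odot>\<^bsub>B\<^esub> s k)\<rparr>"

definition null_ideal :: "'a star_algebra \<Rightarrow> ('a \<Rightarrow> real) \<Rightarrow> (nat \<Rightarrow> 'a) set" where
  "null_ideal B p = {s. cauchy_in B p s \<and> (\<lambda>k. p (s k)) \<longlonglongrightarrow> 0}"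

definition completion_embed :: "'a star_algebra \<Rightarrow> ('a \<Rightarrow> real) \<Rightarrow> 'a \<Rightarrow> (nat \<Rightarrow> 'a) set" where
  "completion_embed B p b = null_ideal B p +>\<^bsub>cauchy_algebra B p\<^esub> (\<lambda>k. b)"

definition star_completion ::
  "'a star_algebra \<Rightarrow> ('a \<Rightarrow> real) \<Rightarrow> (nat \<Rightarrow> 'a) set normed_star_algebra" where
  "star_completion B p =
     (let S = cauchy_algebra B p; I = null_ideal B p; C = quot_algebra S I in
      \<lparr>carrier = carrier C, mult = mult C, one = one C, zero = zero C, add = add C,
       smult = smult C,
       star = (\<lambda>X. \<Union>s\<in>X. I +>\<^bsub>S\<^esub> (\<lambda>k. star B (s k))),
       alg_norm = (\<lambda>X. THE r. \<exists>s\<in>X. (\<lambda>k. p (s k)) \<longlonglongrightarrow> r)\<rparr>)"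


section \<open>The twisted crossed product\<close>

text \<open>
  \<open>K\<close> is a compact set of points of \<open>P(V*)\<close>, \<open>\<sigma>\<close> a homeomorphism of \<open>K\<close> and \<open>\<L>\<close> the restriction to
  \<open>K\<close> of the dual of the tautological bundle. Its hermitian metric is given by a function \<open>h\<close> on
  \<open>V*\<close> with \<open>h (c z) = |c|\<^sup>2 h z\<close>, as \<open>\<langle>L, L'\<rangle>(Z) = L(z) cnj(L'(z)) / h(z)\<close> for \<open>0 \<noteq> z \<in> line Z\<close>.

  The fibre of \<open>\<L>\<^sub>m\<close> at \<open>Z\<close> consists of the multilinear forms on
  \<open>line Z \<times> line (\<sigma> Z) \<times> \<dots> \<times> line (\<sigma>\<^bsup>m-1\<^esup> Z)\<close>; a section is a function of \<open>Z\<close> and of the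
  list of arguments, extended by \<open>0\<close> outside the domain.
\<close>

type_synonym 'n sect = "'n proj \<Rightarrow> (complex^'n) list \<Rightarrow> complex"

definition fibre_args ::
  "('n::finite proj \<Rightarrow> 'n proj) \<Rightarrow> nat \<Rightarrow> 'n proj \<Rightarrow> (complex^'n) list set" where
  "fibre_args \<sigma> m Z = {zs. length zs = m \<and> (\<forall>i<m. zs ! i \<in> line ((\<sigma> ^^ i) Z))}"

text \<open>\<open>C(K, \<L>\<^sub>m)\<close>: over the open set where \<open>v\<^sub>0 \<otimes> (v\<^sub>1 \<circ> \<sigma>) \<otimes> \<dots> \<otimes> (v\<^bsub>m-1\<^esub> \<circ> \<sigma>\<^bsup>m-1\<^esup>)\<close> is a
  frame of \<open>\<L>\<^sub>m\<close>, a continuous section is a continuous multiple of that frame. These sets cover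
  \<open>K\<close>, so the values of a section are multilinear.\<close>

definition sections ::
  "'n::finite proj set \<Rightarrow> ('n proj \<Rightarrow> 'n proj) \<Rightarrow> nat \<Rightarrow> 'n sect set" where
  "sections K \<sigma> m = {\<xi>.
     (\<forall>Z zs. \<not> (Z \<in> K \<and> zs \<in> fibre_args \<sigma> m Z) \<longrightarrow> \<xi> Z zs = 0) \<and>
     (\<forall>vs. length vs = m \<longrightarrow>
        (let U = {Z \<in> K. \<forall>i<m. \<exists>z\<in>line ((\<sigma> ^^ i) Z). pairing (vs ! i) z \<noteq> 0} in
         \<exists>f. continuous_on U f \<and>
           (\<forall>Z\<in>U. \<forall>zs\<in>fibre_args \<sigma> m Z. \<xi> Z zs = f Z * (\<Prod>i<m. pairing (vs ! i) (zs ! i)))))}"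

definition lin_section :: "'n::finite proj set \<Rightarrow> complex^'n \<Rightarrow> 'n sect" where
  "lin_section K L Z zs = (case zs of [z] \<Rightarrow> if Z \<in> K \<and> z \<in> line Z then pairing L z else 0 | _ \<Rightarrow> 0)"

text \<open>Arbitrary nonzero representatives of \<open>Z, \<sigma> Z, \<dots>, \<sigma>\<^bsup>m-1\<^esup> Z\<close>; the expressions below do not
  depend on their choice.\<close>

definition rep :: "'n::finite proj \<Rightarrow> complex^'n" where
  "rep Z = (SOME z. z \<in> line Z \<and> z \<noteq> 0)"

definition lift :: "('n::finite proj \<Rightarrow> 'n proj) \<Rightarrow> nat \<Rightarrow> 'n proj \<Rightarrow> (complex^'n) list" where
  "lift \<sigma> m Z = map (\<lambda>i. rep ((\<sigma> ^^ i) Z)) [0..<m]"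

definition herm ::
  "('n::finite proj \<Rightarrow> 'n proj) \<Rightarrow> (complex^'n \<Rightarrow> complex) \<Rightarrow> nat \<Rightarrow> 'n sect \<Rightarrow> 'n sect \<Rightarrow>
   'n proj \<Rightarrow> complex" where
  "herm \<sigma> h m \<xi> \<eta> Z = \<xi> Z (lift \<sigma> m Z) * cnj (\<eta> Z (lift \<sigma> m Z)) / (\<Prod>z\<leftarrow>lift \<sigma> m Z. h z)"

text \<open>\<open>\<xi> \<otimes> (\<eta> \<circ> \<sigma>\<^sup>m)\<close>, for \<open>\<xi>\<close> of degree \<open>m\<close>:\<close>

definition sect_tensor ::
  "('n::finite proj \<Rightarrow> 'n proj) \<Rightarrow> nat \<Rightarrow> 'n sect \<Rightarrow> 'n sect \<Rightarrow> 'n sect" where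
  "sect_tensor \<sigma> m \<xi> \<eta> Z zs = \<xi> Z (take m zs) * \<eta> ((\<sigma> ^^ m) Z) (drop m zs)"

text \<open>\<open>contract_right\<close> is the section \<open>\<zeta>\<close> of \<open>\<L>\<^sub>p\<close> with \<open>(\<xi> W\<^bsup>p+q\<^esup>) (W*\<^sup>q \<eta>*) = \<zeta> W\<^sup>p\<close>: if
  \<open>\<xi> = \<alpha> \<otimes> (\<beta> \<circ> \<sigma>\<^sup>p)\<close> then \<open>\<zeta> = \<alpha> \<cdot> (\<langle>\<beta>, \<eta>\<rangle> \<circ> \<sigma>\<^sup>p)\<close>.\<close>

definition contract_right ::
  "('n::finite proj \<Rightarrow> 'n proj) \<Rightarrow> (complex^'n \<Rightarrow> complex) \<Rightarrow> nat \<Rightarrow> nat \<Rightarrow> 'n sect \<Rightarrow> 'n sect \<Rightarrow>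
   'n sect" where
  "contract_right \<sigma> h p q \<xi> \<eta> Z zs =
     herm \<sigma> h q (\<lambda>Y ys. \<xi> Z (zs @ ys)) \<eta> ((\<sigma> ^^ p) Z)"

text \<open>\<open>contract_left\<close> is the section \<open>\<zeta>\<close> of \<open>\<L>\<^sub>p\<close> with \<open>(W*\<^sup>q \<eta>*) (\<xi> W\<^bsup>q+p\<^esup>) = \<zeta> W\<^sup>p\<close>: if
  \<open>\<xi> = \<alpha> \<otimes> (\<beta> \<circ> \<sigma>\<^sup>q)\<close> then \<open>\<zeta> = (\<langle>\<alpha>, \<eta>\<rangle> \<circ> \<sigma>\<^bsup>-q\<^esup>) \<cdot> \<beta>\<close>.\<close>

definition contract_left ::
  "'n::finite proj set \<Rightarrow> ('n proj \<Rightarrow> 'n proj) \<Rightarrow> (complex^'n \<Rightarrow> complex) \<Rightarrow> nat \<Rightarrow> 'n sect \<Rightarrow>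
   'n sect \<Rightarrow> 'n sect" where
  "contract_left K \<sigma> h q \<eta> \<xi> Z zs =
     (if Z \<in> K then herm \<sigma> h q (\<lambda>Y ys. \<xi> Y (ys @ zs)) \<eta> ((inv_into K \<sigma> ^^ q) Z) else 0)"

text \<open>
  An element of the *-algebra spanned by the monomials is a finitely supported family
  \<open>a :: int \<Rightarrow> 'n sect\<close>, standing for \<open>\<Sum>\<^bsub>m\<ge>0\<^esub> a(m) W\<^sup>m + \<Sum>\<^bsub>k>0\<^esub> W*\<^sup>k a(-k)*\<close>. So the components of
  negative degree are conjugate linear coordinates. The following is the section of degree
  \<open>m + k\<close> which represents the product of the monomials given by \<open>\<xi>\<close> in degree \<open>m\<close> and
  \<open>\<eta>\<close> in degree \<open>k\<close>; the cases without a comment above are obtained by passing to adjoints.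
\<close>

definition mono_mult ::
  "'n::finite proj set \<Rightarrow> ('n proj \<Rightarrow> 'n proj) \<Rightarrow> (complex^'n \<Rightarrow> complex) \<Rightarrow> int \<Rightarrow> 'n sect \<Rightarrow>
   int \<Rightarrow> 'n sect \<Rightarrow> 'n sect" where
  "mono_mult K \<sigma> h m \<xi> k \<eta> =
     (if 0 \<le> m \<and> 0 \<le> k then sect_tensor \<sigma> (nat m) \<xi> \<eta>
      else if m < 0 \<and> k < 0 then sect_tensor \<sigma> (nat (- k)) \<eta> \<xi>
      else if 0 \<le> m then
        (if - k \<le> m then contract_right \<sigma> h (nat (m + k)) (nat (- k)) \<xi> \<eta>
         else contract_right \<sigma> h (nat (- (m + k))) (nat m) \<eta> \<xi>)
      else
        (if - m \<le> k then contract_left K \<sigma> h (nat (- m)) \<xi> \<eta>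
         else contract_left K \<sigma> h (nat k) \<eta> \<xi>))"

definition monomial :: "int \<Rightarrow> 'n sect \<Rightarrow> int \<Rightarrow> 'n::finite sect" where
  "monomial m \<xi> = (\<lambda>k. if k = m then \<xi> else (\<lambda>Z zs. 0))"

definition monomial_algebra ::
  "'n::finite proj set \<Rightarrow> ('n proj \<Rightarrow> 'n proj) \<Rightarrow> (complex^'n \<Rightarrow> complex) \<Rightarrow>
   (int \<Rightarrow> 'n sect) star_algebra" where
  "monomial_algebra K \<sigma> h =
     \<lparr>carrier = {a. finite {m. a m \<noteq> (\<lambda>Z zs. 0)} \<and> (\<forall>m. a m \<in> sections K \<sigma> (nat \<bar>m\<bar>))},
      mult = (\<lambda>a b k Z zs.
        \<Sum>m | a m \<noteq> (\<lambda>Z zs. 0). mono_mult K \<sigma> h m (a m) (k - m) (b (k - m)) Z zs),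
      one = monomial 0 (\<lambda>Z zs. if Z \<in> K \<and> zs = [] then 1 else 0),
      zero = (\<lambda>m Z zs. 0),
      add = (\<lambda>a b m Z zs. a m Z zs + b m Z zs),
      smult = (\<lambda>c a m Z zs. (if 0 \<le> m then c else cnj c) * a m Z zs),
      star = (\<lambda>a m Z zs. if m = 0 then cnj (a 0 Z zs) else a (- m) Z zs)\<rparr>"

text \<open>\<open>C(K) \<times>\<^bsub>\<sigma>,\<L>\<^esub> \<int>\<close>\<close>

definition crossed_product ::
  "'n::finite proj set \<Rightarrow> ('n proj \<Rightarrow> 'n proj) \<Rightarrow> (complex^'n \<Rightarrow> complex) \<Rightarrow>
   (nat \<Rightarrow> int \<Rightarrow> 'n sect) set normed_star_algebra" where
  "crossed_product K \<sigma> h =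
     star_completion (monomial_algebra K \<sigma> h) (universal_norm (monomial_algebra K \<sigma> h))"

definition crossed_embed ::
  "'n::finite proj set \<Rightarrow> ('n proj \<Rightarrow> 'n proj) \<Rightarrow> (complex^'n \<Rightarrow> complex) \<Rightarrow>
   (int \<Rightarrow> 'n sect) \<Rightarrow> (nat \<Rightarrow> int \<Rightarrow> 'n sect) set" where
  "crossed_embed K \<sigma> h =
     completion_embed (monomial_algebra K \<sigma> h) (universal_norm (monomial_algebra K \<sigma> h))"

text \<open>The metric \<open>\<langle> , \<rangle>\<^sub>Q\<close> is the one given by \<open>h = metric_fun j Q\<close>.\<close>

definition metric_fun :: "(complex^'n \<Rightarrow> complex^'n) \<Rightarrow> complex^'n^'n \<Rightarrow> complex^'n \<Rightarrow> complex" where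
  "metric_fun j Q z = bform Q z (dual_conj j z)"

text \<open>\<open>sup\<^sub>K \<parallel>Y\<parallel>\<close>; inserting \<open>0\<close> only matters if \<open>K\<close> is empty.\<close>

definition sup_norm ::
  "'n::finite proj set \<Rightarrow> ('n proj \<Rightarrow> 'n proj) \<Rightarrow> (complex^'n \<Rightarrow> complex) \<Rightarrow> complex^'n \<Rightarrow> real" where
  "sup_norm K \<sigma> h Y =
     Sup (insert 0 ((\<lambda>Z. sqrt (Re (herm \<sigma> h 1 (lin_section K Y) (lin_section K Y) Z))) ` K))"

end

theory Submission
  imports Defs "HOL-Computational_Algebra.Formal_Power_Series"
begin

text \<open>
  At a point \<open>Z \<in> K\<close> with representative \<open>z\<close>, the unit vectors \<open>a(Z) = z / Q(z, j z)\<^bsup>1/2\<^esup>\<close> turn an element of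
  degree \<open>m\<close> of the algebra of monomials into a function on \<open>K\<close>, and the product into the convolution of
  the groupoid of the arrows \<open>Z \<rightarrow> \<sigma>\<^sup>m Z\<close>. The functions depend on the choice of the representatives
  through phases only. In these coordinates \<open>2 \<theta>(\<omega>)\<close>, for \<open>\<omega> \<in> V \<otimes> V\<close>, has the
  component \<open>\<omega>(a(Z), a(\<sigma> Z))\<close> in degree \<open>2\<close>, the component \<open>\<omega>(j a(\<sigma>\<^bsup>-1\<^esup> Z), j a(\<sigma>\<^bsup>-2\<^esup> Z))\<close> in degree \<open>-2\<close> and
  \<open>\<omega>(a(Z), j a(Z)) + \<omega>(j a(\<sigma>\<^bsup>-1\<^esup> Z), a(\<sigma>\<^bsup>-1\<^esup> Z))\<close> in degree \<open>0\<close>. For \<open>\<omega> \<in> R\<close> the first two vanish since \<open>\<Gamma>\<close> is the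
  graph of \<open>\<sigma>\<close> and \<open>\<sigma> j = j \<sigma>\<^bsup>-1\<^esup>\<close>, and the third one since \<open>Q\<close> is central. For \<open>\<omega> = Q\<close> the third one is \<open>2\<close>;
  centrality on the graph of \<open>\<sigma>\<close> makes \<open>Q(Z, \<sigma> Z)\<close> vanish wherever \<open>\<sigma>\<^sup>4 Z \<noteq> Z\<close>, hence on the closure.

  The groupoid acts on \<open>\<ell>\<^sup>2\<close>, which bounds the norm from below by the modulus of each coefficient. It is
  bounded from above since a homogeneous element \<open>b\<close> with \<open>|b| \<le> M\<close> satisfies \<open>b* b + g* g = M\<^sup>2\<close> for a
  function \<open>g\<close>.
\<close>

text \<open>The representatives \<open>rep Z\<close> are arbitrary choices, so the coefficient
  function of a continuous section need not be continuous. Continuity is therefore always stated for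
  products in which the phases cancel, namely after testing against evaluations
  \<open>phi vs\<close> along the same piece of an orbit. A factor |phi vs|^2 inserted for this
  purpose is divided out locally, since at each point some \<open>vs\<close> makes it nonzero. The
  factor sqrt 2 in \<theta> is what normalises \<theta>(Q): a path of degree 0 goes forward and back
  or back and forward, and each of the two contributes a value Q(a, j a) = 1. The exponent 4 arises
  as follows. The involution is given on the quotient algebra only. That it reverses \<sigma> is
  obtained by applying it to a relation and reading off the part of degree 2 as a bilinear
  form.\<close>

section \<open>Lines, representatives and the topology of the projective space\<close>

lemma scale_vec_range:
  assumes "z = c *s (r::complex^'n)" "c \<noteq> 0"
  shows "range (\<lambda>c. c *s z) = range (\<lambda>c. c *s r)"
proof (intro equalityI subsetI; clarify)
  fix d :: complex
  show "d *s z \<in> range (\<lambda>c. c *s r)" using assms by (auto simp: vector_smult_assoc)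
next
  fix d :: complex
  have "d *s r = (d / c) *s z" using assms by (simp add: vector_smult_assoc)
  then show "d *s r \<in> range (\<lambda>c. c *s z)" by blast
qed

lemma line_point: "z \<noteq> 0 \<Longrightarrow> line (point z) = range (\<lambda>c. c *s z)"
  unfolding point_def by (rule Abs_proj_inverse) auto

lemma rep_in_line: "rep Z \<in> line Z" and rep_nonzero: "rep Z \<noteq> 0"
proof -
  obtain z where z: "line Z = range (\<lambda>c. c *s z)" "z \<noteq> 0" using line[of Z] by auto
  then have "z \<in> line Z" by (metis rangeI vector_smult_lid)
  then have "\<exists>z. z \<in> line Z \<and> z \<noteq> 0" using z by auto
  from someI_ex[OF this] show "rep Z \<in> line Z" "rep Z \<noteq> 0" by (auto simp: rep_def)
qed

lemma line_eq_range: "z \<in> line Z \<Longrightarrow> z \<noteq> 0 \<Longrightarrow> line Z = range (\<lambda>c. c *s z)"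
proof -
  assume a: "z \<in> line Z" "z \<noteq> 0"
  obtain r where r: "line Z = range (\<lambda>c. c *s r)" "r \<noteq> 0" using line[of Z] by auto
  then obtain c where "z = c *s r" using a by auto
  with a show ?thesis using r scale_vec_range[of z c r] by (cases "c = 0") auto
qed

lemma line_rep: "line Z = range (\<lambda>c. c *s rep Z)"
  using line_eq_range rep_in_line rep_nonzero by blast

lemma scale_in_line: "z \<in> line Z \<Longrightarrow> c *s z \<in> line Z"
  by (auto simp: line_rep vector_smult_assoc)

lemma point_eqI: "z \<in> line Z \<Longrightarrow> z \<noteq> 0 \<Longrightarrow> point z = Z"
  using line_eq_range[of z Z] line_point[of z] by (simp add: line_inject[symmetric])

lemma point_rep [simp]: "point (rep Z) = Z"
  by (simp add: point_eqI rep_in_line rep_nonzero)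

lemma in_line_point: "z \<noteq> 0 \<Longrightarrow> z \<in> line (point z)"
  by (metis line_point rangeI vector_smult_lid)

lemma openin_proj: "open U \<longleftrightarrow> open {z :: complex^'n::finite. z \<noteq> 0 \<and> point z \<in> U}"
  by (simp add: open_proj_def)

text \<open>In the quotient topology a preimage is open as soon as its cone in the punctured vector
  space is. Homogeneous expressions can thus be treated by ordinary calculus on vectors.\<close>

lemma continuous_on_proj:
  fixes f :: "'n::finite proj \<Rightarrow> 'b::topological_space"
  assumes "continuous_on (- {0}) (\<lambda>z. f (point z))"
  shows "continuous_on A f"
proof -
  have "continuous_on UNIV f"
  proof (subst continuous_on_open_vimage, simp, intro allI impI)
    fix B :: "'b set" assume "open B"
    have "open ((\<lambda>z. f (point z)) -` B \<inter> - {0})"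
      using assms \<open>open B\<close> continuous_on_open_vimage[of "-{0}" "\<lambda>z. f (point z)"] by (simp add: open_Compl)
    moreover have "(\<lambda>z. f (point z)) -` B \<inter> - {0} = {z. z \<noteq> 0 \<and> point z \<in> f -` B}" by auto
    ultimately show "open (f -` B \<inter> UNIV)" by (simp add: openin_proj)
  qed
  then show ?thesis using continuous_on_subset by blast
qed

lemma norm_cscale: "norm (c *s (z::complex^'n)) = norm c * norm z"
proof -
  have "norm (c *s z) = L2_set (\<lambda>i. norm c * norm (z $ i)) UNIV"
    by (simp add: norm_vec_def norm_mult)
  also have "\<dots> = norm c * L2_set (\<lambda>i. norm (z $ i)) UNIV"
    by (simp add: L2_set_right_distrib)
  finally show ?thesis by (simp add: norm_vec_def)
qed

lemma cscale_of_real: "of_real r *s (z::complex^'n) = r *\<^sub>R z"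
  by (simp add: vec_eq_iff) (simp add: scaleR_conv_of_real)

text \<open>Projecting along a compact factor is a closed map. Compactness is taken from unit
  spheres: since \<open>S\<close> is homogeneous in each argument separately, pairs of lines can be
  replaced by pairs of unit vectors. This yields the continuity of \<sigma> and of its inverse from
  their closed graphs, and the closedness of the locus where \<open>Q\<close> vanishes on the
  graph.\<close>

lemma closed_proj_projection:
  fixes S :: "((complex^'n::finite) \<times> (complex^'n)) set" and C :: "'n proj set"
  assumes S: "closed S" and C: "closed C"
    and hom: "\<And>z z' c c'. (z, z') \<in> S \<Longrightarrow> (c *s z, c' *s z') \<in> S"
  shows "closed {Z. \<exists>Z'\<in>C. (rep Z, rep Z') \<in> S}" (is "closed ?A")
proof -
  let ?sp = "sphere (0::complex^'n) 1"
  have hom': "(rep Z, rep Z') \<in> S"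
    if *: "(z, z') \<in> S" "z \<in> line Z" "z' \<in> line Z'" "z \<noteq> 0" "z' \<noteq> 0" for z z' Z Z'
  proof -
    obtain c where c: "rep Z = c *s z" using rep_in_line[of Z] line_eq_range[OF *(2,4)] by blast
    obtain c' where "rep Z' = c' *s z'" using rep_in_line[of Z'] line_eq_range[OF *(3,5)] by blast
    with c show ?thesis using hom[OF *(1)] by simp
  qed
  have sphere_nz: "z \<noteq> 0" if "z \<in> ?sp" for z using that by auto
  \<comment> \<open>Unit pairs in \<open>S\<close> whose second line belongs to \<open>C\<close>.
    This set is compact, hence so is its first projection, and the set of the claim is the set of
    lines whose unit vectors lie there.\<close>
  define T where "T = (?sp \<times> {z'\<in>?sp. point z' \<in> C}) \<inter> S"
  have "open {z. z \<noteq> 0 \<and> point z \<in> - C}" using openin_proj[of "- C"] C by (simp add: open_Compl)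
  then have "closed (?sp - {z. z \<noteq> 0 \<and> point z \<in> - C})" by (intro closed_Diff) auto
  moreover have "?sp - {z. z \<noteq> 0 \<and> point z \<in> - C} = {z'\<in>?sp. point z' \<in> C}" by auto
  ultimately have "closed {z'\<in>?sp. point z' \<in> C}" by simp
  then have "compact {z'\<in>?sp. point z' \<in> C}"
    by (simp add: compact_eq_bounded_closed bounded_subset[OF bounded_sphere[of 0 1]] subset_eq)
  then have "compact T" unfolding T_def using S by (intro compact_Int_closed compact_Times) auto
  then have "compact (fst ` T)" by (intro compact_continuous_image) (auto intro: continuous_intros)
  then have cl: "closed (fst ` T)" by (rule compact_imp_closed)
  have unit: "(inverse (norm z)) *\<^sub>R z \<in> ?sp" if "z \<noteq> 0" for z :: "complex^'n" using that by simp
  have unit_line: "(inverse (norm z)) *\<^sub>R z \<in> line Z" if "z \<in> line Z" for z :: "complex^'n" and Z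
    using scale_in_line[OF that, of "of_real (inverse (norm z))"] by (simp only: cscale_of_real)
  have eq: "point z \<in> ?A \<longleftrightarrow> (inverse (norm z)) *\<^sub>R z \<in> fst ` T" if z: "z \<noteq> 0" for z
  proof
    assume "point z \<in> ?A"
    then obtain Z' where Z': "Z' \<in> C" "(rep (point z), rep Z') \<in> S" by blast
    let ?w = "inverse (norm (rep Z')) *\<^sub>R rep Z'"
    obtain c where c: "inverse (norm z) *\<^sub>R z = c *s rep (point z)"
      using unit_line[OF in_line_point[OF z]] line_rep by (metis (no_types, lifting) rangeE)
    have "(c *s rep (point z), of_real (inverse (norm (rep Z'))) *s rep Z') \<in> S" using hom Z' by blast
    then have "(inverse (norm z) *\<^sub>R z, ?w) \<in> S" by (simp only: cscale_of_real c)
    moreover have "point ?w = Z'"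
      using unit_line[OF rep_in_line[of Z']] rep_nonzero[of Z'] by (intro point_eqI) auto
    ultimately have "(inverse (norm z) *\<^sub>R z, ?w) \<in> T"
      unfolding T_def using unit[OF z] unit[OF rep_nonzero[of Z']] Z'(1)
      by (simp del: mem_sphere)
    from imageI[OF this, of fst] show "(inverse (norm z)) *\<^sub>R z \<in> fst ` T" by simp
  next
    assume "(inverse (norm z)) *\<^sub>R z \<in> fst ` T"
    then obtain z' where z': "(inverse (norm z) *\<^sub>R z, z') \<in> S" "z' \<in> ?sp" "point z' \<in> C"
      unfolding T_def by (elim imageE) (auto simp del: mem_sphere)
    have "(rep (point z), rep (point z')) \<in> S"
      using z'(2) unit_line[OF in_line_point[OF z]] in_line_point[of z'] sphere_nz[of z'] z
      by (intro hom'[OF z'(1)]) simp_all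
    then show "point z \<in> ?A" using z' by blast
  qed
  have "{z. z \<noteq> 0 \<and> point z \<in> - ?A} = (\<lambda>z. inverse (norm z) *\<^sub>R z) -` (- (fst ` T)) \<inter> (- {0})"
    using eq by auto
  moreover have "open ((\<lambda>z. inverse (norm z) *\<^sub>R z) -` (- (fst ` T)) \<inter> (- {0}))"
  proof -
    have "continuous_on (- {0}) (\<lambda>z::complex^'n. inverse (norm z) *\<^sub>R z)"
      by (intro continuous_intros) auto
    from continuous_on_open_vimage[THEN iffD1, rule_format, OF _ this, of "- (fst ` T)"] cl
    show ?thesis by (simp add: open_Compl)
  qed
  ultimately have "open {z. z \<noteq> 0 \<and> point z \<in> - ?A}" by (simp only:)
  with openin_proj[of "- ?A"] show ?thesis unfolding closed_def by (rule iffD2)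
qed

section \<open>The antilinear involution\<close>

lemma pairing_scale_left: "pairing (c *s L) Z = c * pairing L Z"
  and pairing_scale_right: "pairing L (c *s Z) = c * pairing L Z"
  and pairing_zero_right [simp]: "pairing L 0 = 0"
  by (simp_all add: pairing_def algebra_simps sum.distrib sum_distrib_left)

lemma pairing_axis: "pairing (axis i 1) Z = Z $ i"
  unfolding pairing_def axis_def by (simp add: if_distrib[of "\<lambda>x. x * _"] cong: if_cong)

lemma continuous_pairing: "continuous_on A (pairing L)"
  unfolding pairing_def by (intro continuous_intros)

lemma bform_scale: "bform w (c *s z) (d *s z') = c * d * bform w z z'"
  by (simp add: bform_def sum_distrib_left mult_ac)

lemma bform_transpose: "bform (transpose w) z z' = bform w z' z"
  unfolding bform_def transpose_def by (subst sum.swap) (simp add: mult_ac)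

lemma continuous_bform: "continuous_on A f \<Longrightarrow> continuous_on A g \<Longrightarrow> continuous_on A (\<lambda>x. bform w (f x) (g x))"
  unfolding bform_def by (intro continuous_intros)

locale antilinear_involution =
  fixes j :: "complex^'n::finite \<Rightarrow> complex^'n"
  assumes j_add: "j (v + w) = j v + j w"
    and j_scale: "j (c *s v) = cnj c *s j v"
    and j_j: "j (j v) = v"
begin

abbreviation jd where "jd \<equiv> dual_conj j"

lemma j_expand: "j L = (\<Sum>i\<in>UNIV. cnj (L $ i) *s j (axis i 1))"
proof -
  have z: "j 0 = 0" using j_scale[of 0 0] by simp
  have s: "j (\<Sum>i\<in>F. f i) = (\<Sum>i\<in>F. j (f i))" if "finite F" for F and f :: "'n \<Rightarrow> complex^'n"
    using that by (induction F rule: finite_induct) (auto simp: z j_add)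
  have "L = (\<Sum>i\<in>UNIV. L $ i *s axis i 1)" by (simp add: basis_expansion)
  then have "j L = j (\<Sum>i\<in>UNIV. L $ i *s axis i 1)" by simp
  then show ?thesis by (simp add: s j_scale)
qed

lemma pairing_sum_left: "pairing (\<Sum>i\<in>UNIV. f i) Z = (\<Sum>i\<in>UNIV. pairing (f i) Z)"
  unfolding pairing_def by (subst sum.swap) (simp add: sum_distrib_right)

text \<open>Testing on basis vectors fixes \<open>W\<close> coordinate by coordinate, which gives
  uniqueness; the antilinear expansion of \<open>j L\<close> extends the equation from the basis to
  every \<open>L\<close>, which gives existence.\<close>

lemma dual_conj_nth: "jd Z $ i = cnj (pairing (j (axis i 1)) Z)"
  and pairing_j: "pairing (j L) Z = cnj (pairing L (jd Z))"
proof -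
  let ?W = "\<chi> i. cnj (pairing (j (axis i 1)) Z)"
  have ex: "pairing (j L) Z = cnj (pairing L ?W)" for L
    by (subst j_expand) (simp add: pairing_sum_left pairing_scale_left, simp add: pairing_def)
  have "jd Z = ?W"
    unfolding dual_conj_def
  proof (rule the_equality, intro allI ex)
    fix W assume W: "\<forall>L. pairing (j L) Z = cnj (pairing L W)"
    have "cnj (W $ i) = pairing (j (axis i 1)) Z" for i using W by (simp add: pairing_axis)
    then have "W $ i = ?W $ i" for i using complex_cnj_cnj[of "W $ i"] by simp
    then show "W = ?W" by (simp only: vec_eq_iff) simp
  qed
  then show "jd Z $ i = cnj (pairing (j (axis i 1)) Z)" "pairing (j L) Z = cnj (pairing L (jd Z))"
    using ex[of L] by simp_all
qed

lemma dual_conj_scale: "jd (c *s Z) = cnj c *s jd Z"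
  by (simp add: vec_eq_iff dual_conj_nth pairing_scale_right)

lemma dual_conj_dual_conj [simp]: "jd (jd Z) = Z"
proof -
  have "pairing L (jd (jd Z)) = pairing L Z" for L
    using pairing_j[of "j L" Z] pairing_j[of L "jd Z"] by (simp add: j_j)
  from this[of "axis _ 1"] show ?thesis by (simp add: pairing_axis vec_eq_iff)
qed

lemma dual_conj_zero_iff [simp]: "jd Z = 0 \<longleftrightarrow> Z = 0"
proof -
  have "jd 0 = 0" by (simp add: vec_eq_iff dual_conj_nth)
  then show ?thesis by (metis dual_conj_dual_conj)
qed

lemma continuous_dual_conj: "continuous_on A jd"
proof -
  have "jd = (\<lambda>Z. \<chi> i. cnj (pairing (j (axis i 1)) Z))" by (auto simp: fun_eq_iff vec_eq_iff dual_conj_nth)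
  then show ?thesis by (simp, intro continuous_intros continuous_pairing)
qed

text \<open>An antilinear bijection conjugates the scalar, so the image of a line is again a line
  through a nonzero vector. Only this gives the \<open>Abs_proj\<close> in \<open>proj_conj\<close>
  its meaning.\<close>

lemma line_proj_conj: "line (proj_conj j Z) = jd ` line Z"
proof -
  have "jd ` line Z = range (\<lambda>c. c *s jd (rep Z))"
  proof (intro equalityI subsetI)
    fix x assume "x \<in> range (\<lambda>c. c *s jd (rep Z))"
    then obtain c where "x = jd (cnj c *s rep Z)" by (auto simp: dual_conj_scale)
    then show "x \<in> jd ` line Z" using scale_in_line rep_in_line by blast
  next
    fix x assume "x \<in> jd ` line Z"
    then obtain c where "x = jd (c *s rep Z)" using line_rep[of Z] by auto
    then show "x \<in> range (\<lambda>c. c *s jd (rep Z))" by (auto simp: dual_conj_scale)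
  qed
  moreover have "jd (rep Z) \<noteq> 0" by (simp add: rep_nonzero)
  ultimately show ?thesis unfolding proj_conj_def by (subst Abs_proj_inverse) auto
qed

end

section \<open>Quotients of algebras\<close>

text \<open>Common frame of the two quotients that occur: tensors modulo relations, and Cauchy
  sequences modulo null sequences. A ring ideal need not be stable under the scalars of the record,
  so \<open>smult_ideal\<close> is assumed separately.\<close>

locale algebra_ideal = ideal I A for I :: "'a set" and A :: "(complex, 'a, 'm) module_scheme" (structure) +
  assumes smult_closed: "x \<in> carrier A \<Longrightarrow> c \<odot> x \<in> carrier A"
    and smult_add: "x \<in> carrier A \<Longrightarrow> y \<in> carrier A \<Longrightarrow> c \<odot> (x \<oplus> y) = c \<odot> x \<oplus> c \<odot> y"
    and smult_ideal: "x \<in> I \<Longrightarrow> c \<odot> x \<in> I"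
begin

lemma coset_eq_iff: "x \<in> carrier A \<Longrightarrow> y \<in> carrier A \<Longrightarrow> I +> x = I +> y \<longleftrightarrow> x \<ominus> y \<in> I"
  using quotient_eq_iff_same_a_r_cos[OF ideal_axioms] by blast

lemma coset_self: "x \<in> carrier A \<Longrightarrow> x \<in> I +> x"
  by (rule a_rcos_self)

lemma mem_coset: "x \<in> carrier A \<Longrightarrow> y \<in> I +> x \<Longrightarrow> y \<in> carrier A \<and> I +> y = I +> x"
  using a_elemrcos_carrier[of x y] a_repr_independence'[of y x] by simp

lemma quot_carrier: "carrier (quot_algebra A I) = (\<lambda>x. I +> x) ` carrier A"
  by (auto simp: quot_algebra_def FactRing_def A_RCOSETS_def')

lemma quot_mult: "x \<in> carrier A \<Longrightarrow> y \<in> carrier A \<Longrightarrow>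
    (I +> x) \<otimes>\<^bsub>quot_algebra A I\<^esub> (I +> y) = I +> (x \<otimes> y)"
  by (simp add: quot_algebra_def FactRing_def rcoset_mult_add)

lemma quot_add: "x \<in> carrier A \<Longrightarrow> y \<in> carrier A \<Longrightarrow>
    (I +> x) \<oplus>\<^bsub>quot_algebra A I\<^esub> (I +> y) = I +> (x \<oplus> y)"
  by (simp add: quot_algebra_def FactRing_def a_rcos_sum)

lemma quot_one: "\<one>\<^bsub>quot_algebra A I\<^esub> = I +> \<one>"
  by (simp add: quot_algebra_def FactRing_def)

text \<open>Scalar multiplication and star on a quotient are written as unions over a coset. Such a
  union collapses to one value once all members of the coset give the same value.\<close>

lemma coset_union:
  assumes x: "x \<in> carrier A" and f: "\<And>y. y \<in> carrier A \<Longrightarrow> I +> y = I +> x \<Longrightarrow> f y = f x"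
  shows "(\<Union>y\<in>I +> x. f y) = f x"
  using mem_coset[OF x] coset_self[OF x] f by blast

lemma quot_smult:
  assumes x: "x \<in> carrier A"
  shows "c \<odot>\<^bsub>quot_algebra A I\<^esub> (I +> x) = I +> (c \<odot> x)"
proof -
  have "(\<Union>y\<in>I +> x. I +> (c \<odot> y)) = I +> (c \<odot> x)"
  proof (rule coset_union[OF x])
    fix y assume y: "y \<in> carrier A" "I +> y = I +> x"
    then have d: "y \<ominus> x \<in> I" using x coset_eq_iff by blast
    have "y = (y \<ominus> x) \<oplus> x" using x y by (simp add: a_minus_def a_assoc l_neg)
    then have "c \<odot> y = c \<odot> (y \<ominus> x) \<oplus> c \<odot> x" using smult_add[of "y \<ominus> x" x] x y by simp
    then have "c \<odot> y \<ominus> c \<odot> x = c \<odot> (y \<ominus> x)" using x y smult_closed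
      by (simp add: a_minus_def a_assoc r_neg)
    then show "I +> (c \<odot> y) = I +> (c \<odot> x)"
      using coset_eq_iff[of "c \<odot> y" "c \<odot> x"] smult_ideal[OF d] smult_closed x y by simp
  qed
  then show ?thesis by (simp add: quot_algebra_def)
qed

end

section \<open>The tensor algebra\<close>

abbreviation T_add (infixl "\<oplus>\<^sub>T" 65) where "f \<oplus>\<^sub>T g \<equiv> f \<oplus>\<^bsub>tensor_algebra\<^esub> g"
abbreviation T_minus (infixl "\<ominus>\<^sub>T" 65) where "f \<ominus>\<^sub>T g \<equiv> f \<ominus>\<^bsub>tensor_algebra\<^esub> g"
abbreviation T_mult (infixl "\<otimes>\<^sub>T" 70) where "f \<otimes>\<^sub>T g \<equiv> f \<otimes>\<^bsub>tensor_algebra\<^esub> g"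
abbreviation T_smult (infixl "\<odot>\<^sub>T" 70) where "c \<odot>\<^sub>T f \<equiv> c \<odot>\<^bsub>tensor_algebra\<^esub> f"
abbreviation T_zero ("\<zero>\<^sub>T") where "\<zero>\<^sub>T \<equiv> \<zero>\<^bsub>tensor_algebra\<^esub>"
abbreviation T_one ("\<one>\<^sub>T") where "\<one>\<^sub>T \<equiv> \<one>\<^bsub>tensor_algebra\<^esub>"

text \<open>Both sides run over the ways to cut \<open>w\<close> into three consecutive pieces.
  Exchanging the two cuts is the same manipulation of indices as in the product of three formal
  power series.\<close>

lemma tensor_mult_assoc:
  fixes f g h :: "'n list \<Rightarrow> complex"
  shows "(\<Sum>k\<le>length w. (\<Sum>l\<le>length (take k w). f (take l (take k w)) * g (drop l (take k w))) * h (drop k w)) =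
    (\<Sum>l\<le>length w. f (take l w) * (\<Sum>k\<le>length (drop l w). g (take k (drop l w)) * h (drop k (drop l w))))"
proof -
  let ?F = "\<lambda>l k r. f (take l w) * g (take k (drop l w)) * h (drop (l + k) w)"
  have "(\<Sum>k\<le>length w. (\<Sum>l\<le>length (take k w). f (take l (take k w)) * g (drop l (take k w))) * h (drop k w))
     = (\<Sum>k=0..length w. \<Sum>l=0..k. ?F l (k - l) (length w - k))"
    unfolding atMost_atLeast0 sum_distrib_right
    by (intro sum.cong refl) (auto simp: min_def drop_take)
  also have "\<dots> = (\<Sum>k=0..length w. \<Sum>l=0..length w - k. ?F k l (length w - k - l))"
    by (rule fps_mult_assoc_lemma)
  also have "\<dots> = (\<Sum>l\<le>length w. f (take l w) * (\<Sum>k\<le>length (drop l w). g (take k (drop l w)) * h (drop k (drop l w))))"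
    unfolding atMost_atLeast0 sum_distrib_left
    by (intro sum.cong refl) (auto simp: mult.assoc add.commute)
  finally show ?thesis .
qed

lemma finite_support_concat:
  fixes f g :: "'n list \<Rightarrow> complex"
  assumes "finite {w. f w \<noteq> 0}" "finite {w. g w \<noteq> 0}"
  shows "finite {w. (\<Sum>k\<le>length w. f (take k w) * g (drop k w)) \<noteq> 0}"
proof (rule finite_subset)
  show "{w. (\<Sum>k\<le>length w. f (take k w) * g (drop k w)) \<noteq> 0}
      \<subseteq> (\<lambda>(u, v). u @ v) ` ({w. f w \<noteq> 0} \<times> {w. g w \<noteq> 0})"
  proof clarify
    fix w assume "(\<Sum>k\<le>length w. f (take k w) * g (drop k w)) \<noteq> 0"
    then obtain k where "f (take k w) * g (drop k w) \<noteq> 0" by (meson sum.not_neutral_contains_not_neutral)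
    then have "(take k w, drop k w) \<in> {w. f w \<noteq> 0} \<times> {w. g w \<noteq> 0}" by simp
    from imageI[OF this, of "\<lambda>(u, v). u @ v"]
    show "w \<in> (\<lambda>(u, v). u @ v) ` ({w. f w \<noteq> 0} \<times> {w. g w \<noteq> 0})" by simp
  qed
qed (use assms in simp)

lemma finite_support_sum:
  fixes f g :: "'a \<Rightarrow> complex"
  assumes "finite {w. f w \<noteq> 0}" "finite {w. g w \<noteq> 0}"
  shows "finite {w. f w + g w \<noteq> 0}"
  by (rule finite_subset[OF _ finite_UnI[OF assms]]) auto

lemmas tensor_algebra_simps = tensor_algebra_def [THEN arg_cong, of carrier, simplified]
  tensor_algebra_def [THEN arg_cong, of mult, simplified]
  tensor_algebra_def [THEN arg_cong, of one, simplified]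
  tensor_algebra_def [THEN arg_cong, of zero, simplified]
  tensor_algebra_def [THEN arg_cong, of add, simplified]
  tensor_algebra_def [THEN arg_cong, of smult, simplified]

lemma ring_tensor_algebra: "ring (tensor_algebra :: (complex, 'n list \<Rightarrow> complex) module)"
proof (rule ringI)
  show "abelian_group (tensor_algebra :: (complex, 'n list \<Rightarrow> complex) module)"
  proof (rule abelian_groupI)
    fix x :: "'n list \<Rightarrow> complex" assume "x \<in> carrier tensor_algebra"
    then show "\<exists>y\<in>carrier tensor_algebra. y \<oplus>\<^sub>T x = \<zero>\<^sub>T"
      by (intro bexI[of _ "\<lambda>w. - x w"]) (auto simp: tensor_algebra_simps)
  qed (auto simp: tensor_algebra_simps fun_eq_iff finite_support_sum)
  show "Group.monoid (tensor_algebra :: (complex, 'n list \<Rightarrow> complex) module)"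
  proof (rule monoidI)
    fix x y z :: "'n list \<Rightarrow> complex"
    show "x \<otimes>\<^sub>T y \<otimes>\<^sub>T z = x \<otimes>\<^sub>T (y \<otimes>\<^sub>T z)"
      unfolding tensor_algebra_simps by (intro ext tensor_mult_assoc)
  next
    fix x :: "'n list \<Rightarrow> complex"
    have "(\<Sum>k\<le>length w. (if take k w = [] then 1 else 0) * x (drop k w)) = x w" for w
    proof -
      have "(\<Sum>k\<le>length w. (if take k w = [] then 1 else 0) * x (drop k w)) = (\<Sum>k\<le>length w. if k = 0 then x w else 0)"
        by (intro sum.cong refl) auto
      then show ?thesis by simp
    qed
    then show "\<one>\<^sub>T \<otimes>\<^sub>T x = x" by (simp add: tensor_algebra_simps fun_eq_iff)
    have "(\<Sum>k\<le>length w. x (take k w) * (if drop k w = [] then 1 else 0)) = x w" for w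
    proof -
      have "(\<Sum>k\<le>length w. x (take k w) * (if drop k w = [] then 1 else 0)) = (\<Sum>k\<le>length w. if k = length w then x w else 0)"
        by (intro sum.cong refl) auto
      then show ?thesis by simp
    qed
    then show "x \<otimes>\<^sub>T \<one>\<^sub>T = x" by (simp add: tensor_algebra_simps fun_eq_iff)
  qed (auto simp: tensor_algebra_simps finite_support_concat)
qed (auto simp: tensor_algebra_simps fun_eq_iff algebra_simps sum.distrib)

interpretation T: ring tensor_algebra by (rule ring_tensor_algebra)

lemma tensor2_closed: "tensor2 (w :: complex^'n^'n::finite) \<in> carrier tensor_algebra"
proof -
  have "{x. tensor2 w x \<noteq> 0} \<subseteq> (\<lambda>(i, k). [i, k]) ` UNIV"
  proof
    fix x assume "x \<in> {x. tensor2 w x \<noteq> 0}"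
    then obtain i k where "x = [i, k]" by (auto simp: tensor2_def split: list.splits)
    then show "x \<in> (\<lambda>(i, k). [i, k]) ` UNIV" by (auto intro: rev_image_eqI[of "(i, k)"])
  qed
  then show ?thesis by (simp add: tensor_algebra_simps finite_subset[OF _ finite_imageI[of UNIV]])
qed

lemma tensor1_closed: "tensor1 (v :: complex^'n::finite) \<in> carrier tensor_algebra"
proof -
  have "{x. tensor1 v x \<noteq> 0} \<subseteq> (\<lambda>i. [i]) ` UNIV"
  proof
    fix x assume "x \<in> {x. tensor1 v x \<noteq> 0}"
    then show "x \<in> (\<lambda>i. [i]) ` UNIV" by (cases x; cases "tl x") (auto simp: tensor1_def)
  qed
  then show ?thesis by (simp add: tensor_algebra_simps finite_subset[OF _ finite_imageI[of UNIV]])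
qed

text \<open>Scalars are multiples of the unit; this is why every ring ideal of the tensor algebra is
  also a linear subspace.\<close>

lemma tensor_smult_mult: "c \<odot>\<^sub>T f = (c \<odot>\<^sub>T \<one>\<^sub>T) \<otimes>\<^sub>T f"
proof
  fix w :: "'a list"
  have "(\<Sum>k\<le>length w. c * (if take k w = [] then 1 else 0) * f (drop k w)) = (\<Sum>k\<le>length w. if k = 0 then c * f w else 0)"
    by (intro sum.cong refl) auto
  then show "(c \<odot>\<^sub>T f) w = ((c \<odot>\<^sub>T \<one>\<^sub>T) \<otimes>\<^sub>T f) w"
    by (simp add: tensor_algebra_simps)
qed

lemma tensor_smult_closed: "f \<in> carrier tensor_algebra \<Longrightarrow> c \<odot>\<^sub>T f \<in> carrier tensor_algebra"
  by (cases "c = 0") (auto simp: tensor_algebra_simps)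

lemma algebra_ideal_relation_ideal: "algebra_ideal (relation_ideal R) tensor_algebra"
proof -
  have id: "ideal (relation_ideal R) tensor_algebra"
    unfolding relation_ideal_def by (intro T.genideal_ideal) (auto intro: tensor2_closed)
  interpret ideal "relation_ideal R" tensor_algebra by (rule id)
  show ?thesis
  proof
    fix x c assume "x \<in> relation_ideal R"
    then show "c \<odot>\<^sub>T x \<in> relation_ideal R"
      by (subst tensor_smult_mult) (intro I_l_closed tensor_smult_closed T.one_closed)
  qed (auto intro: tensor_smult_closed simp: tensor_algebra_simps algebra_simps)
qed

definition word :: "'n list \<Rightarrow> 'n list \<Rightarrow> complex" where
  "word w = (\<lambda>u. if u = w then 1 else 0)"

lemma word_closed: "word w \<in> carrier tensor_algebra"
  by (simp add: word_def tensor_algebra_simps)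

lemma word_Nil: "word [] = \<one>\<^sub>T"
  by (simp add: word_def tensor_algebra_simps)

lemma word_Cons: "word (i # w) = word [i] \<otimes>\<^sub>T word w"
proof
  fix u
  show "word (i # w) u = (word [i] \<otimes>\<^sub>T word w) u"
  proof (cases u)
    case Nil
    then show ?thesis by (simp add: tensor_algebra_simps word_def)
  next
    case (Cons a v)
    have "(word [i] \<otimes>\<^sub>T word w) u
        = (\<Sum>k\<le>length u. if k = 1 then (if a = i \<and> v = w then 1 else 0) else 0)"
      unfolding tensor_algebra_simps
      by (intro sum.cong refl) (auto simp: Cons word_def take_Cons' split: if_splits)
    also have "\<dots> = (if a = i \<and> v = w then 1 else 0)" by (subst sum.delta) (auto simp: Cons)
    finally show ?thesis by (simp add: Cons word_def)
  qed
qed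

lemma word_singleton: "word [i] = tensor1 (axis i 1)"
  by (auto simp: word_def tensor1_def axis_def fun_eq_iff split: list.splits)

lemma tensor_span_induct [consumes 1, case_names word add smult]:
  fixes f :: "'n list \<Rightarrow> complex"
  assumes f: "f \<in> carrier tensor_algebra"
    and wd: "\<And>w. P (word w)"
    and add: "\<And>x y. x \<in> carrier tensor_algebra \<Longrightarrow> y \<in> carrier tensor_algebra \<Longrightarrow> P x \<Longrightarrow> P y \<Longrightarrow> P (x \<oplus>\<^sub>T y)"
    and smult: "\<And>c x. x \<in> carrier tensor_algebra \<Longrightarrow> P x \<Longrightarrow> P (c \<odot>\<^sub>T x)"
  shows "P f"
proof -
  have "P g" if "finite F" "{w. g w \<noteq> 0} \<subseteq> F" for F and g :: "'n list \<Rightarrow> complex"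
    using that
  proof (induction F arbitrary: g rule: finite_induct)
    case empty
    then have "g = 0 \<odot>\<^sub>T word []" by (auto simp: tensor_algebra_simps)
    then show ?case using smult[OF word_closed wd] by simp
  next
    case (insert w F)
    let ?g = "g(w := 0)"
    have sub: "{u. ?g u \<noteq> 0} \<subseteq> F" using insert.prems by auto
    have "?g \<in> carrier tensor_algebra"
      using finite_subset[OF sub insert.hyps(1)] by (simp only: tensor_algebra_simps mem_Collect_eq)
    then have "P (?g \<oplus>\<^sub>T (g w \<odot>\<^sub>T word w))"
      by (intro add smult tensor_smult_closed word_closed wd insert.IH sub)
    moreover have "?g \<oplus>\<^sub>T (g w \<odot>\<^sub>T word w) = g"
      by (auto simp: tensor_algebra_simps word_def)
    ultimately show ?case by simp
  qed
  then show ?thesis using f by (simp add: tensor_algebra_simps)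
qed

text \<open>Each basis word is a product of basis vectors. This induction serves where only the
  behaviour on V and the algebra laws are available: compatibility of \<theta> with the involution,
  and uniqueness of \<theta>.\<close>

lemma tensor_algebra_induct [consumes 1, case_names one gen add mult smult]:
  fixes f :: "'n::finite list \<Rightarrow> complex"
  assumes f: "f \<in> carrier tensor_algebra"
    and one: "P \<one>\<^sub>T"
    and gen: "\<And>v. P (tensor1 v)"
    and add: "\<And>x y. x \<in> carrier tensor_algebra \<Longrightarrow> y \<in> carrier tensor_algebra \<Longrightarrow> P x \<Longrightarrow> P y \<Longrightarrow> P (x \<oplus>\<^sub>T y)"
    and mult: "\<And>x y. x \<in> carrier tensor_algebra \<Longrightarrow> y \<in> carrier tensor_algebra \<Longrightarrow> P x \<Longrightarrow> P y \<Longrightarrow> P (x \<otimes>\<^sub>T y)"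
    and smult: "\<And>c x. x \<in> carrier tensor_algebra \<Longrightarrow> P x \<Longrightarrow> P (c \<odot>\<^sub>T x)"
  shows "P f"
  using f
proof (induction rule: tensor_span_induct)
  case (word w)
  show ?case
  proof (induction w)
    case Nil
    show ?case using one by (simp only: word_Nil)
  next
    case (Cons i w)
    have "P (word [i])" using gen by (simp only: word_singleton)
    then show ?case using Cons by (subst word_Cons) (intro mult word_closed)
  qed
qed (auto intro: add smult)

section \<open>Quadratic *-algebras\<close>

context
  fixes R :: "(complex^'n^'n::finite) set"
begin

interpretation Q: algebra_ideal "relation_ideal R" tensor_algebra
  by (rule algebra_ideal_relation_ideal)

lemma carrier_quadratic: "carrier (quadratic_algebra R) = cls R ` carrier tensor_algebra"
  unfolding quadratic_algebra_def cls_def[abs_def] by (rule Q.quot_carrier)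

lemma cls_closed: "x \<in> carrier tensor_algebra \<Longrightarrow> cls R x \<in> carrier (quadratic_algebra R)"
  by (simp add: carrier_quadratic)

lemma cls_eq_iff: "x \<in> carrier tensor_algebra \<Longrightarrow> y \<in> carrier tensor_algebra \<Longrightarrow>
    cls R x = cls R y \<longleftrightarrow> x \<ominus>\<^sub>T y \<in> relation_ideal R"
  unfolding cls_def by (rule Q.coset_eq_iff)

lemma cls_self: "x \<in> carrier tensor_algebra \<Longrightarrow> x \<in> cls R x"
  unfolding cls_def by (rule Q.coset_self)

lemma mem_cls: "x \<in> carrier tensor_algebra \<Longrightarrow> y \<in> cls R x \<Longrightarrow> y \<in> carrier tensor_algebra \<and> cls R y = cls R x"
  unfolding cls_def by (rule Q.mem_coset)

lemma cls_mult: "x \<in> carrier tensor_algebra \<Longrightarrow> y \<in> carrier tensor_algebra \<Longrightarrow>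
    cls R x \<otimes>\<^bsub>quadratic_algebra R\<^esub> cls R y = cls R (x \<otimes>\<^sub>T y)"
  unfolding quadratic_algebra_def cls_def by (rule Q.quot_mult)

lemma cls_add: "x \<in> carrier tensor_algebra \<Longrightarrow> y \<in> carrier tensor_algebra \<Longrightarrow>
    cls R x \<oplus>\<^bsub>quadratic_algebra R\<^esub> cls R y = cls R (x \<oplus>\<^sub>T y)"
  unfolding quadratic_algebra_def cls_def by (rule Q.quot_add)

lemma cls_smult: "x \<in> carrier tensor_algebra \<Longrightarrow>
    c \<odot>\<^bsub>quadratic_algebra R\<^esub> cls R x = cls R (c \<odot>\<^sub>T x)"
  unfolding quadratic_algebra_def cls_def by (rule Q.quot_smult)

lemma cls_one: "\<one>\<^bsub>quadratic_algebra R\<^esub> = cls R \<one>\<^sub>T"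
  unfolding quadratic_algebra_def cls_def by (rule Q.quot_one)

end

text \<open>This ideal contains \<open>(R)\<close> when \<open>G\<close> is the characteristic relation. Hence \<open>V\<close> embeds in \<open>T(V)/(R)\<close>, and
  the elements of degree \<open>2\<close> of \<open>(R)\<close> vanish on \<open>G\<close>.\<close>

definition vanishing_ideal :: "('n::finite proj \<times> 'n proj) set \<Rightarrow> ('n list \<Rightarrow> complex) set" where
  "vanishing_ideal G = {f \<in> carrier tensor_algebra. f [] = 0 \<and> (\<forall>i. f [i] = 0) \<and>
     (\<forall>Z Z'. (Z, Z') \<in> G \<longrightarrow> (\<forall>z\<in>line Z. \<forall>z'\<in>line Z'. bform (\<chi> i k. f [i, k]) z z' = 0))}"

lemma bform_add: "bform (\<chi> i k. f i k + g i k) z z' = bform (\<chi> i k. f i k) z z' + bform (\<chi> i k. g i k) z z'"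
  and bform_mult: "bform (\<chi> i k. c * f i k) z z' = c * bform (\<chi> i k. f i k) z z'"
  and bform_uminus: "bform (\<chi> i k. - f i k) z z' = - bform (\<chi> i k. f i k) z z'"
  by (simp_all add: bform_def algebra_simps sum.distrib sum_distrib_left sum_negf)

lemma tensor_mult_low:
  "(f \<otimes>\<^sub>T g) [] = f [] * g []"
  "(f \<otimes>\<^sub>T g) [i] = f [] * g [i] + f [i] * g []"
  "(f \<otimes>\<^sub>T g) [i, k] = f [] * g [i, k] + f [i] * g [k] + f [i, k] * g []"
  by (simp_all add: tensor_algebra_simps numeral_2_eq_2)

text \<open>If \<open>a\<close> has no part in degrees 0 and 1, then multiplication by
  \<open>x\<close> on either side merely rescales its part of degree 2 by \<open>x []\<close>.
  Vanishing of that part on a set of pairs is therefore stable, and the generators satisfy it by the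
  definition of the characteristic relation.\<close>

lemma relation_ideal_subset_vanishing:
  fixes R :: "(complex^'n^'n::finite) set"
  shows "relation_ideal R \<subseteq> vanishing_ideal (char_relation R)"
proof -
  let ?I = "vanishing_ideal (char_relation R)"
  have closed: "f \<in> carrier tensor_algebra" if "f \<in> ?I" for f using that by (simp add: vanishing_ideal_def)
  have minus: "\<ominus>\<^bsub>tensor_algebra\<^esub> f = (\<lambda>w. - f w)" if "f \<in> carrier tensor_algebra" for f :: "'n list \<Rightarrow> complex"
    using that by (intro T.minus_equality) (auto simp: tensor_algebra_simps)
  have "ideal ?I tensor_algebra"
  proof (rule idealI)
    show "ring (tensor_algebra :: (complex, 'n list \<Rightarrow> complex) module)" by (rule ring_tensor_algebra)
    show "subgroup ?I (add_monoid tensor_algebra)"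
    proof
      show "?I \<subseteq> carrier (add_monoid tensor_algebra)" using closed by auto
    next
      fix x y assume "x \<in> ?I" "y \<in> ?I"
      then show "x \<otimes>\<^bsub>add_monoid tensor_algebra\<^esub> y \<in> ?I"
        using T.add.m_closed[of x y]
        by (auto simp: vanishing_ideal_def tensor_algebra_simps bform_add)
    next
      show "\<one>\<^bsub>add_monoid tensor_algebra\<^esub> \<in> ?I"
        using T.zero_closed by (auto simp: vanishing_ideal_def tensor_algebra_simps bform_def)
    next
      fix x assume x: "x \<in> ?I"
      have "(\<lambda>w. - x w) \<in> ?I" using x
        by (auto simp: vanishing_ideal_def tensor_algebra_simps bform_uminus)
      then show "inv\<^bsub>add_monoid tensor_algebra\<^esub> x \<in> ?I"
        using minus[OF closed[OF x]] by (simp add: a_inv_def)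
    qed
  next
    fix a x :: "'n list \<Rightarrow> complex" assume a: "a \<in> ?I" and x: "x \<in> carrier tensor_algebra"
    have "bform (\<chi> i k. x [] * a [i, k]) z z' = 0" "bform (\<chi> i k. a [i, k] * x []) z z' = 0"
      if "(Z, Z') \<in> char_relation R" "z \<in> line Z" "z' \<in> line Z'" for Z Z' z z'
    proof -
      have "bform (\<chi> i k. a [i, k]) z z' = 0" using a that by (auto simp: vanishing_ideal_def)
      then show "bform (\<chi> i k. x [] * a [i, k]) z z' = 0" "bform (\<chi> i k. a [i, k] * x []) z z' = 0"
        using bform_mult[of "x []" "\<lambda>i k. a [i, k]"] by (simp_all add: mult.commute)
    qed
    then show "x \<otimes>\<^sub>T a \<in> ?I" "a \<otimes>\<^sub>T x \<in> ?I"
      using a x T.m_closed[of x a] T.m_closed[of a x] by (auto simp: vanishing_ideal_def tensor_mult_low)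
  qed
  moreover have "tensor2 w \<in> ?I" if "w \<in> R" for w
    using that tensor2_closed[of w] by (auto simp: vanishing_ideal_def tensor2_def char_relation_def)
  ultimately show ?thesis unfolding relation_ideal_def by (intro T.genideal_minimal) auto
qed

lemma tensor1_add: "tensor1 (v + w) = tensor1 v \<oplus>\<^sub>T tensor1 w"
  and tensor1_scale: "tensor1 (c *s v) = c \<odot>\<^sub>T tensor1 v"
  by (auto simp: tensor1_def tensor_algebra_simps fun_eq_iff split: list.splits)

lemma tensor_minus:
  assumes "f \<in> carrier tensor_algebra" "g \<in> carrier tensor_algebra"
  shows "f \<ominus>\<^sub>T g = (\<lambda>w. f w - g w)"
proof -
  have "\<ominus>\<^bsub>tensor_algebra\<^esub> g = (\<lambda>w. - g w)"
    using assms by (intro T.minus_equality) (auto simp: tensor_algebra_simps)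
  then show ?thesis by (simp add: a_minus_def tensor_algebra_simps)
qed

text \<open>The ideal has no part of degree 1. Through this the laws of \<open>st\<close> on the
  quotient become laws of \<open>j\<close> on V.\<close>

lemma cls_tensor1_inject:
  assumes "cls R (tensor1 v) = cls R (tensor1 w)" shows "v = w"
proof -
  have "(\<lambda>u. tensor1 v u - tensor1 w u) \<in> relation_ideal R"
    using assms cls_eq_iff[OF tensor1_closed tensor1_closed, of R v w]
      tensor_minus[OF tensor1_closed tensor1_closed, of v w] by simp
  then have "(\<lambda>u. tensor1 v u - tensor1 w u) \<in> vanishing_ideal (char_relation R)"
    using relation_ideal_subset_vanishing by blast
  then have "tensor1 v [i] - tensor1 w [i] = 0" for i by (simp add: vanishing_ideal_def)
  then show ?thesis by (simp add: tensor1_def vec_eq_iff)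
qed

locale quadratic_star_locale =
  fixes R :: "(complex^'n^'n::finite) set" and st j
  assumes quadratic_star: "quadratic_star R st j"
begin

abbreviation QA where "QA \<equiv> quadratic_algebra R"

lemma st_closed: "x \<in> carrier QA \<Longrightarrow> st x \<in> carrier QA"
  and st_add: "x \<in> carrier QA \<Longrightarrow> y \<in> carrier QA \<Longrightarrow> st (x \<oplus>\<^bsub>QA\<^esub> y) = st x \<oplus>\<^bsub>QA\<^esub> st y"
  and st_smult: "x \<in> carrier QA \<Longrightarrow> st (c \<odot>\<^bsub>QA\<^esub> x) = cnj c \<odot>\<^bsub>QA\<^esub> st x"
  and st_mult: "x \<in> carrier QA \<Longrightarrow> y \<in> carrier QA \<Longrightarrow> st (x \<otimes>\<^bsub>QA\<^esub> y) = st y \<otimes>\<^bsub>QA\<^esub> st x"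
  and st_st: "x \<in> carrier QA \<Longrightarrow> st (st x) = x"
  and st_tensor1: "st (cls R (tensor1 v)) = cls R (tensor1 (j v))"
  using quadratic_star by (auto simp: quadratic_star_def star_involution_def)

text \<open>Applying the antimultiplicative involution to \<open>st 1 \<otimes> 1\<close> returns
  the same product, so \<open>st 1\<close> is fixed; being an involution, \<open>st\<close> maps it
  to 1 as well.\<close>

lemma st_one: "st \<one>\<^bsub>QA\<^esub> = \<one>\<^bsub>QA\<^esub>"
proof -
  have 1: "\<one>\<^bsub>QA\<^esub> \<in> carrier QA" using cls_closed[OF T.one_closed] by (simp add: cls_one)
  have unit: "\<one>\<^bsub>QA\<^esub> \<otimes>\<^bsub>QA\<^esub> x = x" if "x \<in> carrier QA" for x
    using that by (auto simp: cls_one carrier_quadratic cls_mult)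
  have unit': "x \<otimes>\<^bsub>QA\<^esub> \<one>\<^bsub>QA\<^esub> = x" if "x \<in> carrier QA" for x
    using that by (auto simp: cls_one carrier_quadratic cls_mult)
  have "st (st \<one>\<^bsub>QA\<^esub> \<otimes>\<^bsub>QA\<^esub> \<one>\<^bsub>QA\<^esub>) = st \<one>\<^bsub>QA\<^esub> \<otimes>\<^bsub>QA\<^esub> \<one>\<^bsub>QA\<^esub>"
    using st_mult[OF st_closed[OF 1] 1] st_st[OF 1] by simp
  then show ?thesis using unit'[OF st_closed[OF 1]] st_st[OF 1] by simp
qed

sublocale antilinear_involution j
proof
  fix v w c
  note t = tensor1_closed cls_closed[OF tensor1_closed]
  show "j (v + w) = j v + j w"
    by (rule cls_tensor1_inject[of R]) (simp add: tensor1_add st_tensor1[symmetric] cls_add[symmetric] st_add t)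
  show "j (c *s v) = cnj c *s j v"
    by (rule cls_tensor1_inject[of R]) (simp add: tensor1_scale st_tensor1[symmetric] cls_smult[symmetric] st_smult t)
  show "j (j v) = v"
    by (rule cls_tensor1_inject[of R]) (simp add: st_tensor1[symmetric] st_st t)
qed

text \<open>Membership in the carrier is carried along because \<open>cls\<close> respects addition
  only there. The empty sum is settled by writing zero as 0 times the unit, so the zero class is
  fixed by \<open>st\<close>.\<close>

lemma st_sum:
  assumes "finite I" "\<And>i. i \<in> I \<Longrightarrow> F i \<in> carrier tensor_algebra" "\<And>i. i \<in> I \<Longrightarrow> G i \<in> carrier tensor_algebra"
    and "\<And>i. i \<in> I \<Longrightarrow> st (cls R (F i)) = cls R (G i)"
  shows "(\<lambda>w. \<Sum>i\<in>I. F i w) \<in> carrier tensor_algebra \<and> (\<lambda>w. \<Sum>i\<in>I. G i w) \<in> carrier tensor_algebra \<and>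
    st (cls R (\<lambda>w. \<Sum>i\<in>I. F i w)) = cls R (\<lambda>w. \<Sum>i\<in>I. G i w)"
  using assms
proof (induction I rule: finite_induct)
  case empty
  have "0 \<odot>\<^sub>T \<one>\<^sub>T = (\<zero>\<^sub>T :: 'n list \<Rightarrow> complex)"
    by (simp add: tensor_algebra_simps)
  then have "0 \<odot>\<^bsub>QA\<^esub> cls R \<one>\<^sub>T = cls R \<zero>\<^sub>T"
    using cls_smult[OF T.one_closed, of R 0] by simp
  then have "st (cls R \<zero>\<^sub>T) = cls R \<zero>\<^sub>T"
    using st_smult[of "cls R \<one>\<^sub>T" 0] st_one by (simp add: cls_closed cls_one)
  then show ?case using T.zero_closed by (simp add: tensor_algebra_simps)
next
  case (insert i I)
  then have IH: "(\<lambda>w. \<Sum>i\<in>I. F i w) \<in> carrier tensor_algebra" "(\<lambda>w. \<Sum>i\<in>I. G i w) \<in> carrier tensor_algebra"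
    "st (cls R (\<lambda>w. \<Sum>i\<in>I. F i w)) = cls R (\<lambda>w. \<Sum>i\<in>I. G i w)" by auto
  have eq: "(\<lambda>w. \<Sum>i\<in>insert i I. H i w) = H i \<oplus>\<^sub>T (\<lambda>w. \<Sum>i\<in>I. H i w)" for H :: "_ \<Rightarrow> 'n list \<Rightarrow> complex"
    using insert.hyps by (simp add: tensor_algebra_simps)
  show ?case unfolding eq using insert.prems[of i] IH
    by (simp add: cls_add[symmetric] st_add cls_closed)
qed

text \<open>The relation \<open>w\<close> is mapped by the involution to the class of \<open>w' = \<Sum> cnj w\<^sub>i\<^sub>k j(e\<^sub>k) \<otimes> j(e\<^sub>i)\<close>,
  which therefore vanishes on the characteristic relation.\<close>

lemma char_relation_conj:
  assumes ZZ': "(Z, Z') \<in> char_relation R"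
  shows "(proj_conj j Z', proj_conj j Z) \<in> char_relation R"
proof -
  have key: "bform w (jd z') (jd z) = 0" if w: "w \<in> R" and z: "z \<in> line Z" "z' \<in> line Z'" for w z z'
  proof -
    let ?e = "\<lambda>i. axis i 1 :: complex^'n"
    let ?F = "\<lambda>(i, k). (w $ i $ k) \<odot>\<^sub>T (tensor1 (?e i) \<otimes>\<^sub>T tensor1 (?e k))"
    let ?G = "\<lambda>(i, k). cnj (w $ i $ k) \<odot>\<^sub>T (tensor1 (j (?e k)) \<otimes>\<^sub>T tensor1 (j (?e i)))"
    have tt: "tensor1 a \<otimes>\<^sub>T tensor1 b \<in> carrier tensor_algebra" for a b :: "complex^'n"
      by (intro T.m_closed tensor1_closed)
    have S: "(\<lambda>x. \<Sum>p\<in>UNIV. ?G p x) \<in> carrier tensor_algebra \<and>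
      st (cls R (\<lambda>x. \<Sum>p\<in>UNIV. ?F p x)) = cls R (\<lambda>x. \<Sum>p\<in>UNIV. ?G p x)"
    proof -
      have FG: "?F p \<in> carrier tensor_algebra \<and> ?G p \<in> carrier tensor_algebra \<and> st (cls R (?F p)) = cls R (?G p)" for p
      proof (cases p)
        case (Pair i k)
        have "st (cls R (tensor1 (?e i) \<otimes>\<^sub>T tensor1 (?e k)))
            = cls R (tensor1 (j (?e k)) \<otimes>\<^sub>T tensor1 (j (?e i)))"
          by (simp add: cls_mult[symmetric] tensor1_closed cls_closed st_mult st_tensor1)
        then show ?thesis unfolding Pair prod.case using tt
          by (auto simp: tensor_smult_closed cls_smult[symmetric] st_smult cls_closed)
      qed
      show ?thesis
        by (rule conjunct2[OF st_sum[of UNIV ?F ?G, OF finite FG[THEN conjunct1]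
              FG[THEN conjunct2, THEN conjunct1] FG[THEN conjunct2, THEN conjunct2]]])
    qed
    have tt_eval: "(tensor1 a \<otimes>\<^sub>T tensor1 b) x = (case x of [i, k] \<Rightarrow> a $ i * b $ k | _ \<Rightarrow> 0)"
      for a b :: "complex^'n" and x
    proof -
      have "(tensor1 a \<otimes>\<^sub>T tensor1 b) x
          = (\<Sum>l\<le>length x. if l = 1 then tensor1 a (take 1 x) * tensor1 b (drop 1 x) else 0)"
      proof -
        have "tensor1 a u = 0" if "length u \<noteq> 1" for u
          using that by (auto simp: tensor1_def split: list.splits)
        then have "tensor1 a (take l x) = 0" if "l \<le> length x" "l \<noteq> 1" for l using that by simp
        then show ?thesis unfolding tensor_algebra_simps by (intro sum.cong refl) auto
      qed
      also have "\<dots> = (case x of [i, k] \<Rightarrow> a $ i * b $ k | _ \<Rightarrow> 0)"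
        by (subst sum.delta) (auto simp: tensor1_def split: list.splits)
      finally show ?thesis .
    qed
    \<comment> \<open>The relation is decomposed into elementary tensors, the form in which
      \<open>st\<close> can be computed.\<close>
    have F: "(\<lambda>x. \<Sum>p\<in>UNIV. ?F p x) = tensor2 w"
    proof
      fix x
      show "(\<Sum>p\<in>UNIV. ?F p x) = tensor2 w x"
      proof (cases "\<exists>a b. x = [a, b]")
        case True
        then obtain a b where x: "x = [a, b]" by blast
        have "(\<Sum>p\<in>UNIV. ?F p x) = (\<Sum>p\<in>UNIV. if p = (a, b) then w $ a $ b else 0)"
          by (intro sum.cong refl) (auto simp: x tt_eval tensor_algebra_simps(6) axis_def split: if_split_asm)
        then show ?thesis by (simp add: x tensor2_def)
      next
        case False
        then have "(case x of [i, k] \<Rightarrow> f i k | _ \<Rightarrow> 0) = (0::complex)" for f by (auto split: list.splits)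
        then show ?thesis by (simp add: tensor_algebra_simps(6) tt_eval tensor2_def case_prod_beta)
      qed
    qed
    have zero: "st (cls R \<zero>\<^sub>T) = cls R \<zero>\<^sub>T"
      using st_sum[of "{}" ?F ?G] by (simp add: tensor_algebra_simps)
    have "tensor2 w \<in> relation_ideal R" unfolding relation_ideal_def
      using w T.genideal_self[of "tensor2 ` R"] tensor2_closed by blast
    then have "cls R (tensor2 w) = cls R \<zero>\<^sub>T"
      using cls_eq_iff[OF tensor2_closed T.zero_closed, of R w] by (simp add: T.minus_zero a_minus_def tensor2_closed)
    \<comment> \<open>The class of \<open>w\<close> is zero, hence so is its image under
      \<open>st\<close>, which is the class of the conjugated and reversed tensor.\<close>
    then have "cls R (\<lambda>x. \<Sum>p\<in>UNIV. ?G p x) = cls R \<zero>\<^sub>T" using S F zero by simp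
    then have "(\<lambda>x. \<Sum>p\<in>UNIV. ?G p x) \<in> relation_ideal R"
      using cls_eq_iff[OF conjunct1[OF S] T.zero_closed, of R] conjunct1[OF S] by (simp add: a_minus_def)
    then have "(\<lambda>x. \<Sum>p\<in>UNIV. ?G p x) \<in> vanishing_ideal (char_relation R)"
      using relation_ideal_subset_vanishing by blast
    then have v: "bform (\<chi> a b. \<Sum>p\<in>UNIV. ?G p [a, b]) z z' = 0"
      using ZZ' z unfolding vanishing_ideal_def by blast
    have "bform (\<chi> a b. \<Sum>p\<in>UNIV. ?G p [a, b]) z z'
      = (\<Sum>a\<in>UNIV. \<Sum>b\<in>UNIV. \<Sum>p\<in>UNIV. case p of (i, k) \<Rightarrow> cnj (w $ i $ k) * (j (?e k) $ a * z $ a) * (j (?e i) $ b * z' $ b))"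
      unfolding bform_def by (simp add: tensor_algebra_simps(6) tt_eval case_prod_beta sum_distrib_right sum_distrib_left mult_ac)
    also have "\<dots> = (\<Sum>p\<in>UNIV. \<Sum>a\<in>UNIV. \<Sum>b\<in>UNIV. case p of (i, k) \<Rightarrow> cnj (w $ i $ k) * (j (?e k) $ a * z $ a) * (j (?e i) $ b * z' $ b))"
      by (simp only: sum.swap[of _ _ "UNIV :: ('n \<times> 'n) set"])
    also have "\<dots> = (\<Sum>p\<in>UNIV. case p of (i, k) \<Rightarrow> cnj (w $ i $ k) * pairing (j (?e k)) z * pairing (j (?e i)) z')"
      by (intro sum.cong refl) (simp add: pairing_def case_prod_beta sum_distrib_left sum_distrib_right mult_ac)
    also have "\<dots> = (\<Sum>i\<in>UNIV. \<Sum>k\<in>UNIV. cnj (w $ i $ k) * pairing (j (?e k)) z * pairing (j (?e i)) z')"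
      unfolding UNIV_Times_UNIV[symmetric] by (rule sum.cartesian_product[symmetric])
    \<comment> \<open>By \<open>dual_conj_nth\<close> each pairing with \<open>j (axis i 1)\<close>
      is a conjugated coordinate of a conjugate vector. The exchange of \<open>z\<close> and
      \<open>z'\<close> reflects the reversal of the tensor factors by \<open>st\<close>.\<close>
    also have "\<dots> = cnj (bform w (jd z') (jd z))"
      by (simp add: bform_def dual_conj_nth mult_ac)
    finally show ?thesis using v by simp
  qed
  then show ?thesis by (auto simp: char_relation_def line_proj_conj)
qed

end

section \<open>Hilbert space representations\<close>

locale hilbert =
  fixes H :: "('h, 'm) inner_space_scheme" (structure)
  assumes hilbert: "hilbert_space H"
begin

sublocale abelian_group H by (rule hilbert[unfolded hilbert_space_def, THEN conjunct1])

lemma smult_closed: "x \<in> carrier H \<Longrightarrow> c \<odot> x \<in> carrier H"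
  using hilbert[unfolded hilbert_space_def, THEN conjunct2, THEN conjunct1] by blast

lemma smult_l_distr: "x \<in> carrier H \<Longrightarrow> (c + d) \<odot> x = c \<odot> x \<oplus> d \<odot> x"
  using hilbert[unfolded hilbert_space_def, THEN conjunct2, THEN conjunct2, THEN conjunct1] by blast

lemma smult_assoc: "x \<in> carrier H \<Longrightarrow> (c * d) \<odot> x = c \<odot> (d \<odot> x)"
  using hilbert[unfolded hilbert_space_def, THEN conjunct2, THEN conjunct2, THEN conjunct2, THEN conjunct2, THEN conjunct1] by blast

lemma smult_one: "x \<in> carrier H \<Longrightarrow> 1 \<odot> x = x"
  using hilbert[unfolded hilbert_space_def, THEN conjunct2, THEN conjunct2, THEN conjunct2, THEN conjunct2, THEN conjunct2, THEN conjunct1] by blast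

lemma inner_add_left: "x \<in> carrier H \<Longrightarrow> y \<in> carrier H \<Longrightarrow> z \<in> carrier H \<Longrightarrow>
    hinner H (x \<oplus> y) z = hinner H x z + hinner H y z"
  using hilbert[unfolded hilbert_space_def, THEN conjunct2, THEN conjunct2, THEN conjunct2, THEN conjunct2, THEN conjunct2, THEN conjunct2, THEN conjunct1] by blast

lemma inner_smult_left: "x \<in> carrier H \<Longrightarrow> y \<in> carrier H \<Longrightarrow> hinner H (c \<odot> x) y = c * hinner H x y"
  using hilbert[unfolded hilbert_space_def, THEN conjunct2, THEN conjunct2, THEN conjunct2, THEN conjunct2, THEN conjunct2, THEN conjunct2, THEN conjunct2, THEN conjunct1] by blast

lemma inner_cnj: "x \<in> carrier H \<Longrightarrow> y \<in> carrier H \<Longrightarrow> hinner H y x = cnj (hinner H x y)"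
  using hilbert[unfolded hilbert_space_def, THEN conjunct2, THEN conjunct2, THEN conjunct2, THEN conjunct2, THEN conjunct2, THEN conjunct2, THEN conjunct2, THEN conjunct2, THEN conjunct1] by blast

lemma inner_pos: "x \<in> carrier H \<Longrightarrow> x \<noteq> \<zero> \<Longrightarrow> Re (hinner H x x) > 0"
  using hilbert[unfolded hilbert_space_def, THEN conjunct2, THEN conjunct2, THEN conjunct2, THEN conjunct2, THEN conjunct2, THEN conjunct2, THEN conjunct2, THEN conjunct2, THEN conjunct2, THEN conjunct1] by blast

lemma inner_add_right: "x \<in> carrier H \<Longrightarrow> y \<in> carrier H \<Longrightarrow> z \<in> carrier H \<Longrightarrow>
    hinner H z (x \<oplus> y) = hinner H z x + hinner H z y"
  by (simp add: inner_cnj[of _ z] inner_add_left)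

lemma inner_smult_right: "x \<in> carrier H \<Longrightarrow> y \<in> carrier H \<Longrightarrow> hinner H y (c \<odot> x) = cnj c * hinner H y x"
  by (simp add: inner_cnj[of _ y] inner_smult_left smult_closed)

lemma smult_zero_left: "x \<in> carrier H \<Longrightarrow> 0 \<odot> x = \<zero>"
  using smult_l_distr[of x 0 0] smult_closed[of x 0] by (simp add: add.l_cancel_one')

lemma inner_zero_left: "y \<in> carrier H \<Longrightarrow> hinner H \<zero> y = 0"
  using inner_add_left[of \<zero> \<zero> y] by simp

lemma inner_self: "x \<in> carrier H \<Longrightarrow> hinner H x x = of_real ((hnorm H x)\<^sup>2)"
proof -
  assume x: "x \<in> carrier H"
  have "Re (hinner H x x) \<ge> 0" using inner_pos[OF x] inner_zero_left[OF x] by (cases "x = \<zero>") auto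
  moreover have "Im (hinner H x x) = 0" using arg_cong[OF inner_cnj[OF x x], of Im] by simp
  ultimately show ?thesis by (simp add: hnorm_def complex_eq_iff)
qed

lemma hnorm_nonneg: "x \<in> carrier H \<Longrightarrow> 0 \<le> hnorm H x"
  using inner_pos[of x] inner_zero_left[of x] unfolding hnorm_def by (cases "x = \<zero>") auto

lemma hnorm_zero [simp]: "hnorm H \<zero> = 0"
  using inner_zero_left[of \<zero>] by (simp add: hnorm_def)

lemma hnorm_zero_iff: "x \<in> carrier H \<Longrightarrow> hnorm H x = 0 \<longleftrightarrow> x = \<zero>"
  using inner_pos[of x] hnorm_zero by (cases "x = \<zero>") (auto simp: hnorm_def)

lemma hnorm_smult: "x \<in> carrier H \<Longrightarrow> hnorm H (c \<odot> x) = cmod c * hnorm H x"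
proof -
  assume x: "x \<in> carrier H"
  have "hinner H (c \<odot> x) (c \<odot> x) = c * cnj c * hinner H x x"
    using x smult_closed[of x c] by (simp add: inner_smult_left inner_smult_right)
  also have "\<dots> = of_real ((cmod c)\<^sup>2 * (hnorm H x)\<^sup>2)"
    by (simp add: complex_norm_square[symmetric] inner_self[OF x])
  finally have "Re (hinner H (c \<odot> x) (c \<odot> x)) = (cmod c * hnorm H x)\<^sup>2" by (simp add: power_mult_distrib)
  then show ?thesis using hnorm_nonneg[OF x] by (subst hnorm_def) simp
qed

lemma norm_add_square:
  assumes x: "x \<in> carrier H" and y: "y \<in> carrier H"
  shows "(hnorm H (x \<oplus> y))\<^sup>2 = (hnorm H x)\<^sup>2 + 2 * Re (hinner H x y) + (hnorm H y)\<^sup>2"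
proof -
  have "of_real ((hnorm H (x \<oplus> y))\<^sup>2) = hinner H (x \<oplus> y) (x \<oplus> y)" using x y inner_self by simp
  also have "\<dots> = hinner H x x + (hinner H x y + cnj (hinner H x y)) + hinner H y y"
    using x y inner_cnj[OF x y] by (simp add: inner_add_left inner_add_right)
  also have "\<dots> = of_real ((hnorm H x)\<^sup>2 + 2 * Re (hinner H x y) + (hnorm H y)\<^sup>2)"
    using inner_self x y by (simp add: complex_add_cnj)
  finally show ?thesis using of_real_eq_iff by blast
qed

lemma Cauchy_Schwarz:
  assumes x: "x \<in> carrier H" and y: "y \<in> carrier H"
  shows "cmod (hinner H x y) \<le> hnorm H x * hnorm H y"
proof (cases "y = \<zero>")
  case True
  then show ?thesis using x inner_zero_left[OF x] inner_cnj[of x \<zero>] by simp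
next
  case False
  then have n: "hnorm H y > 0" using hnorm_nonneg[OF y] hnorm_zero_iff[OF y] by simp
  let ?i = "hinner H x y" and ?n = "hnorm H y"
  \<comment> \<open>With this scalar \<open>x \<oplus> ?d \<odot> y\<close> is the component of
    \<open>x\<close> orthogonal to \<open>y\<close>.\<close>
  let ?d = "- (?i / of_real (?n\<^sup>2))"
  have c: "?d \<odot> y \<in> carrier H" using y smult_closed by blast
  have "0 \<le> (hnorm H (x \<oplus> ?d \<odot> y))\<^sup>2" by simp
  also have "\<dots> = (hnorm H x)\<^sup>2 + 2 * Re (cnj ?d * ?i) + (cmod ?d * ?n)\<^sup>2"
    using norm_add_square[OF x c] x y by (simp add: inner_smult_right hnorm_smult)
  also have "cnj ?d * ?i = - of_real ((cmod ?i)\<^sup>2 / ?n\<^sup>2)"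
    by (simp add: complex_norm_square[of ?i, simplified] mult_ac)
  also have "cmod ?d * ?n = cmod ?i / ?n" using n by (simp add: norm_divide power2_eq_square norm_mult)
  finally have "0 \<le> (hnorm H x)\<^sup>2 - (cmod ?i / ?n)\<^sup>2" by (simp add: power_divide)
  then have "(cmod ?i / ?n)\<^sup>2 \<le> (hnorm H x)\<^sup>2" by simp
  then have "cmod ?i / ?n \<le> hnorm H x" by (rule power2_le_imp_le) (rule hnorm_nonneg[OF x])
  then show ?thesis using n by (simp add: divide_le_eq)
qed

lemma hnorm_triangle:
  assumes x: "x \<in> carrier H" and y: "y \<in> carrier H"
  shows "hnorm H (x \<oplus> y) \<le> hnorm H x + hnorm H y"
proof (rule power2_le_imp_le)
  have "Re (hinner H x y) \<le> hnorm H x * hnorm H y"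
    using Cauchy_Schwarz[OF x y] complex_Re_le_cmod order_trans by blast
  then show "(hnorm H (x \<oplus> y))\<^sup>2 \<le> (hnorm H x + hnorm H y)\<^sup>2"
    by (simp add: norm_add_square[OF x y] power2_sum)
qed (simp add: hnorm_nonneg x y)

lemma op_norm_bound:
  assumes T: "bounded_operator H T" and x: "x \<in> carrier H"
  shows "hnorm H (T x) \<le> op_norm H T * hnorm H x"
proof -
  obtain M where M: "\<And>x. x \<in> carrier H \<Longrightarrow> hnorm H (T x) \<le> M * hnorm H x"
    using T unfolding bounded_operator_def by blast
  have bdd: "bdd_above {hnorm H (T x) |x. x \<in> carrier H \<and> hnorm H x \<le> 1}"
  proof (rule bdd_aboveI)
    fix r assume "r \<in> {hnorm H (T x) |x. x \<in> carrier H \<and> hnorm H x \<le> 1}"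
    then obtain y where y: "y \<in> carrier H" "hnorm H y \<le> 1" "r = hnorm H (T y)" by blast
    have "M * hnorm H y \<le> \<bar>M\<bar> * 1"
      using y hnorm_nonneg[OF y(1)] by (intro order_trans[OF mult_right_mono mult_left_mono]) auto
    then show "r \<le> \<bar>M\<bar>" using M[OF y(1)] y by simp
  qed
  show ?thesis
  proof (cases "x = \<zero>")
    case True
    then show ?thesis using M[OF x] by simp
  next
    case False
    then have n: "hnorm H x > 0" using hnorm_nonneg[OF x] hnorm_zero_iff[OF x] by simp
    let ?c = "complex_of_real (1 / hnorm H x)"
    have "hnorm H (?c \<odot> x) = 1" using n hnorm_smult[OF x] by (simp add: norm_divide)
    then have "hnorm H (T (?c \<odot> x)) \<le> op_norm H T"
      unfolding op_norm_def using x smult_closed[OF x, of ?c] by (intro cSup_upper bdd) auto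
    moreover have "T (?c \<odot> x) = ?c \<odot> T x" "T x \<in> carrier H"
      using T x by (auto simp: bounded_operator_def)
    ultimately show ?thesis using n by (simp add: hnorm_smult norm_divide divide_le_eq)
  qed
qed

lemma op_norm_le:
  assumes "\<And>x. x \<in> carrier H \<Longrightarrow> hnorm H (T x) \<le> M * hnorm H x" "0 \<le> M"
  shows "op_norm H T \<le> M"
  unfolding op_norm_def
proof (rule cSup_least)
  show "{hnorm H (T x) |x. x \<in> carrier H \<and> hnorm H x \<le> 1} \<noteq> {}"
    using zero_closed by (auto intro!: exI[of _ \<zero>])
  fix r assume "r \<in> {hnorm H (T x) |x. x \<in> carrier H \<and> hnorm H x \<le> 1}"
  then obtain x where x: "x \<in> carrier H" "hnorm H x \<le> 1" "r = hnorm H (T x)" by blast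
  then have "r \<le> M * hnorm H x" using assms by simp
  also have "\<dots> \<le> M" using x(2) assms(2) by (simp add: mult_left_le)
  finally show "r \<le> M" .
qed

lemma op_norm_nonneg: "bounded_operator H T \<Longrightarrow> 0 \<le> op_norm H T"
proof -
  assume T: "bounded_operator H T"
  show ?thesis
  proof (cases "\<exists>x\<in>carrier H. x \<noteq> \<zero>")
    case True
    then obtain x where x: "x \<in> carrier H" "hnorm H x > 0" using hnorm_nonneg hnorm_zero_iff by fastforce
    moreover have "0 \<le> hnorm H (T x)" using T x by (intro hnorm_nonneg) (auto simp: bounded_operator_def)
    ultimately show ?thesis using op_norm_bound[OF T x(1)] by (meson order_trans zero_le_mult_iff not_le)
  next
    \<comment> \<open>On the zero space the supremum is the single number
      \<open>hnorm H (T \<zero>)\<close>.\<close>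
    case False
    have Tz: "T \<zero> \<in> carrier H" using T by (auto simp: bounded_operator_def)
    have "{hnorm H (T x) |x. x \<in> carrier H \<and> hnorm H x \<le> 1} = {hnorm H (T \<zero>)}"
      using False by (auto intro: exI[of _ \<zero>])
    then show ?thesis using hnorm_nonneg[OF Tz] by (simp add: op_norm_def)
  qed
qed

end

section \<open>Complex *-algebras, their representations and the universal norm\<close>

locale complex_algebra = ring A for A :: "(complex, 'a, 'm) module_scheme" (structure) +
  assumes smult_closed: "x \<in> carrier A \<Longrightarrow> c \<odot> x \<in> carrier A"
    and smult_l_distr: "x \<in> carrier A \<Longrightarrow> (c + d) \<odot> x = c \<odot> x \<oplus> d \<odot> x"
    and smult_r_distr: "x \<in> carrier A \<Longrightarrow> y \<in> carrier A \<Longrightarrow> c \<odot> (x \<oplus> y) = c \<odot> x \<oplus> c \<odot> y"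
    and smult_assoc: "x \<in> carrier A \<Longrightarrow> (c * d) \<odot> x = c \<odot> (d \<odot> x)"
    and smult_one: "x \<in> carrier A \<Longrightarrow> 1 \<odot> x = x"
    and smult_mult_left: "x \<in> carrier A \<Longrightarrow> y \<in> carrier A \<Longrightarrow> (c \<odot> x) \<otimes> y = c \<odot> (x \<otimes> y)"
    and smult_mult_right: "x \<in> carrier A \<Longrightarrow> y \<in> carrier A \<Longrightarrow> x \<otimes> (c \<odot> y) = c \<odot> (x \<otimes> y)"
begin

lemma smult_zero_left: "x \<in> carrier A \<Longrightarrow> 0 \<odot> x = \<zero>"
  using smult_l_distr[of x 0 0] smult_closed[of x 0] by (simp add: add.l_cancel_one')

lemma smult_minus_one: "x \<in> carrier A \<Longrightarrow> (-1) \<odot> x = \<ominus> x"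
  using smult_l_distr[of x "-1" 1] smult_zero_left[of x] smult_closed[of x "-1"]
  by (simp add: smult_one minus_equality)

end

locale complex_star_algebra = complex_algebra B for B :: "('a, 'k) star_algebra_scheme" (structure) +
  assumes star_inv: "star_involution B (star B)"
begin

lemma star_closed: "x \<in> carrier B \<Longrightarrow> star B x \<in> carrier B"
  and star_add: "x \<in> carrier B \<Longrightarrow> y \<in> carrier B \<Longrightarrow> star B (x \<oplus> y) = star B x \<oplus> star B y"
  and star_smult: "x \<in> carrier B \<Longrightarrow> star B (c \<odot> x) = cnj c \<odot> star B x"
  and star_mult: "x \<in> carrier B \<Longrightarrow> y \<in> carrier B \<Longrightarrow> star B (x \<otimes> y) = star B y \<otimes> star B x"
  and star_star: "x \<in> carrier B \<Longrightarrow> star B (star B x) = x"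
  using star_inv by (auto simp: star_involution_def)

lemma star_minus: "x \<in> carrier B \<Longrightarrow> star B (\<ominus> x) = \<ominus> star B x"
  using star_smult[of x "-1"] smult_minus_one[of x] smult_minus_one[of "star B x"] star_closed by simp

end

locale star_rep = complex_star_algebra B + H: hilbert H
  for B :: "('a, 'k) star_algebra_scheme" and H :: "('h, 'm) inner_space_scheme" +
  fixes \<pi> assumes rep: "hilbert_representation B H \<pi>"
begin

lemma bounded: "a \<in> carrier B \<Longrightarrow> bounded_operator H (\<pi> a)"
  using rep[unfolded hilbert_representation_def, THEN conjunct2, THEN conjunct1] by blast

lemma rep_add: "a \<in> carrier B \<Longrightarrow> b \<in> carrier B \<Longrightarrow> x \<in> carrier H \<Longrightarrow> \<pi> (a \<oplus>\<^bsub>B\<^esub> b) x = \<pi> a x \<oplus>\<^bsub>H\<^esub> \<pi> b x"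
  using rep[unfolded hilbert_representation_def, THEN conjunct2, THEN conjunct2, THEN conjunct1] by blast

lemma rep_smult: "a \<in> carrier B \<Longrightarrow> x \<in> carrier H \<Longrightarrow> \<pi> (c \<odot>\<^bsub>B\<^esub> a) x = c \<odot>\<^bsub>H\<^esub> \<pi> a x"
  using rep[unfolded hilbert_representation_def, THEN conjunct2, THEN conjunct2, THEN conjunct2, THEN conjunct1] by blast

lemma rep_mult: "a \<in> carrier B \<Longrightarrow> b \<in> carrier B \<Longrightarrow> x \<in> carrier H \<Longrightarrow> \<pi> (a \<otimes>\<^bsub>B\<^esub> b) x = \<pi> a (\<pi> b x)"
  using rep[unfolded hilbert_representation_def, THEN conjunct2, THEN conjunct2, THEN conjunct2, THEN conjunct2, THEN conjunct1] by blast

lemma rep_star: "a \<in> carrier B \<Longrightarrow> x \<in> carrier H \<Longrightarrow> y \<in> carrier H \<Longrightarrow>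
    hinner H (\<pi> (star B a) x) y = hinner H x (\<pi> a y)"
  using rep[unfolded hilbert_representation_def, THEN conjunct2, THEN conjunct2, THEN conjunct2, THEN conjunct2, THEN conjunct2] by blast

lemma rep_closed: "a \<in> carrier B \<Longrightarrow> x \<in> carrier H \<Longrightarrow> \<pi> a x \<in> carrier H"
  using bounded[of a] by (auto simp: bounded_operator_def)

text \<open>The unit acts as an orthogonal projection, not necessarily as the identity.\<close>

lemma hnorm_rep_one: "x \<in> carrier H \<Longrightarrow> hnorm H (\<pi> \<one>\<^bsub>B\<^esub> x) \<le> hnorm H x"
proof -
  assume x: "x \<in> carrier H"
  let ?y = "\<pi> \<one>\<^bsub>B\<^esub> x"
  have y: "?y \<in> carrier H" using rep_closed x by simp
  have "star B \<one>\<^bsub>B\<^esub> = \<one>\<^bsub>B\<^esub>"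
    using star_mult[of "star B \<one>\<^bsub>B\<^esub>" "\<one>\<^bsub>B\<^esub>"] star_closed[of "\<one>\<^bsub>B\<^esub>"] star_star[of "\<one>\<^bsub>B\<^esub>"] by simp
  then have "hinner H ?y ?y = hinner H x (\<pi> \<one>\<^bsub>B\<^esub> ?y)" using rep_star[of "\<one>\<^bsub>B\<^esub>" x ?y] x y by simp
  also have "\<pi> \<one>\<^bsub>B\<^esub> ?y = ?y" using rep_mult[of "\<one>\<^bsub>B\<^esub>" "\<one>\<^bsub>B\<^esub>" x] x by simp
  finally have "(hnorm H ?y)\<^sup>2 = cmod (hinner H x ?y)" using H.inner_self[OF y]
    by (metis abs_power2 norm_of_real)
  then have "hnorm H ?y * hnorm H ?y \<le> hnorm H x * hnorm H ?y"
    using H.Cauchy_Schwarz[OF x y] by (simp add: power2_eq_square)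
  then show ?thesis using H.hnorm_nonneg[OF x] H.hnorm_nonneg[OF y] by (cases "hnorm H ?y = 0") (auto simp: mult_le_cancel_right)
qed

lemma rep_norm_sq: "a \<in> carrier B \<Longrightarrow> x \<in> carrier H \<Longrightarrow>
    of_real ((hnorm H (\<pi> a x))\<^sup>2) = hinner H (\<pi> (star B a \<otimes>\<^bsub>B\<^esub> a) x) x"
proof -
  assume a: "a \<in> carrier B" and x: "x \<in> carrier H"
  have "hinner H (\<pi> (star B a \<otimes>\<^bsub>B\<^esub> a) x) x = hinner H (\<pi> a x) (\<pi> a x)"
    using rep_mult[of "star B a" a x] rep_star[of a "\<pi> a x" x] a x star_closed rep_closed by simp
  then show ?thesis using H.inner_self rep_closed a x by simp
qed

text \<open>Pairing the identity with \<open>x\<close> gives |a x|^2 + |g x|^2 = M^2 <1 x, x>, where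
  1 acts as a contraction. A bound valid in every representation is thus read off from an algebraic
  identity, without spectral theory.\<close>

lemma hnorm_rep_le_of_squares:
  assumes a: "a \<in> carrier B" and g: "g \<in> carrier B" and M: "0 \<le> M"
    and eq: "(star B a \<otimes>\<^bsub>B\<^esub> a) \<oplus>\<^bsub>B\<^esub> (star B g \<otimes>\<^bsub>B\<^esub> g) = of_real (M\<^sup>2) \<odot>\<^bsub>B\<^esub> \<one>\<^bsub>B\<^esub>"
    and x: "x \<in> carrier H"
  shows "hnorm H (\<pi> a x) \<le> M * hnorm H x"
proof -
  have "complex_of_real ((hnorm H (\<pi> a x))\<^sup>2 + (hnorm H (\<pi> g x))\<^sup>2)
      = hinner H (\<pi> ((star B a \<otimes>\<^bsub>B\<^esub> a) \<oplus>\<^bsub>B\<^esub> (star B g \<otimes>\<^bsub>B\<^esub> g)) x) x"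
    using rep_norm_sq[OF a x] rep_norm_sq[OF g x] a g x
    by (simp add: rep_add star_closed H.inner_add_left rep_closed)
  also have "\<dots> = of_real (M\<^sup>2) * hinner H (\<pi> \<one>\<^bsub>B\<^esub> x) x"
    unfolding eq using x by (simp add: rep_smult H.inner_smult_left rep_closed)
  also have "cmod \<dots> \<le> M\<^sup>2 * (hnorm H x * hnorm H x)"
  proof -
    have "cmod (hinner H (\<pi> \<one>\<^bsub>B\<^esub> x) x) \<le> hnorm H x * hnorm H x"
      using H.Cauchy_Schwarz[of "\<pi> \<one>\<^bsub>B\<^esub> x" x] hnorm_rep_one[OF x] x rep_closed[of "\<one>\<^bsub>B\<^esub>" x] H.hnorm_nonneg[OF x]
      by (meson mult_right_mono one_closed order_trans)
    then show ?thesis by (simp add: norm_mult norm_power mult_left_mono)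
  qed
  finally have "(hnorm H (\<pi> a x))\<^sup>2 + (hnorm H (\<pi> g x))\<^sup>2 \<le> (M * hnorm H x)\<^sup>2"
    by (simp add: power2_eq_square norm_mult mult_ac flip: of_real_add of_real_mult)
  then have "(hnorm H (\<pi> a x))\<^sup>2 \<le> (M * hnorm H x)\<^sup>2" by (smt (verit) zero_le_power2)
  then show ?thesis by (rule power2_le_imp_le) (simp add: M H.hnorm_nonneg[OF x])
qed

end

text \<open>The supremum in \<open>universal_norm\<close> is meaningful only over a nonempty bounded
  set. The two assumptions provide this; the bound may depend on \<open>a\<close> but not on the
  representation.\<close>

locale universally_bounded = complex_star_algebra B for B :: "'a star_algebra" (structure) +
  assumes ex_rep: "\<exists>(H :: ('a \<Rightarrow> complex) inner_space) \<pi>. hilbert_representation B H \<pi>"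
    and ex_bound: "a \<in> carrier B \<Longrightarrow> \<exists>M\<ge>0. \<forall>(H :: ('a \<Rightarrow> complex) inner_space) \<pi>.
      hilbert_representation B H \<pi> \<longrightarrow> (\<forall>x\<in>carrier H. hnorm H (\<pi> a x) \<le> M * hnorm H x)"
begin

lemma star_repI: "hilbert_representation B (H :: ('a \<Rightarrow> complex) inner_space) \<pi> \<Longrightarrow> star_rep B H \<pi>"
  by (intro star_rep.intro star_rep_axioms.intro hilbert.intro complex_star_algebra_axioms)
    (rule conjunct1, simp only: hilbert_representation_def)

lemma op_norm_le_universal:
  assumes a: "a \<in> carrier B" and r: "hilbert_representation B (H :: ('a \<Rightarrow> complex) inner_space) \<pi>"
  shows "op_norm H (\<pi> a) \<le> universal_norm B a"
proof -
  obtain M where M: "M \<ge> 0" "\<And>(H :: ('a \<Rightarrow> complex) inner_space) \<pi> x. hilbert_representation B H \<pi> \<Longrightarrow>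
      x \<in> carrier H \<Longrightarrow> hnorm H (\<pi> a x) \<le> M * hnorm H x" using ex_bound[OF a] by blast
  have "bdd_above {op_norm H (\<pi> a) |(H :: ('a \<Rightarrow> complex) inner_space) \<pi>. hilbert_representation B H \<pi>}"
  proof (rule bdd_aboveI)
    fix r assume "r \<in> {op_norm H (\<pi> a) |(H :: ('a \<Rightarrow> complex) inner_space) \<pi>. hilbert_representation B H \<pi>}"
    then obtain H :: "('a \<Rightarrow> complex) inner_space" and \<pi>
      where H: "hilbert_representation B H \<pi>" and req: "r = op_norm H (\<pi> a)" by blast
    interpret star_rep B H \<pi> by (rule star_repI[OF H])
    show "r \<le> M" unfolding req using M H by (intro H.op_norm_le) auto
  qed
  then show ?thesis unfolding universal_norm_def using r by (intro cSup_upper) auto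
qed

lemma universal_bound:
  assumes a: "a \<in> carrier B" and r: "hilbert_representation B (H :: ('a \<Rightarrow> complex) inner_space) \<pi>"
    and x: "x \<in> carrier H"
  shows "hnorm H (\<pi> a x) \<le> universal_norm B a * hnorm H x"
proof -
  interpret star_rep B H \<pi> by (rule star_repI[OF r])
  show ?thesis using H.op_norm_bound[OF bounded[OF a] x] op_norm_le_universal[OF a r] H.hnorm_nonneg[OF x]
    by (meson mult_right_mono order_trans)
qed

lemma universal_norm_le:
  assumes "\<And>(H :: ('a \<Rightarrow> complex) inner_space) \<pi> x. hilbert_representation B H \<pi> \<Longrightarrow>
      x \<in> carrier H \<Longrightarrow> hnorm H (\<pi> a x) \<le> M * hnorm H x" "0 \<le> M"
  shows "universal_norm B a \<le> M"
  unfolding universal_norm_def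
proof (rule cSup_least)
  show "{op_norm H (\<pi> a) |(H :: ('a \<Rightarrow> complex) inner_space) \<pi>. hilbert_representation B H \<pi>} \<noteq> {}"
    using ex_rep by blast
  fix r assume "r \<in> {op_norm H (\<pi> a) |(H :: ('a \<Rightarrow> complex) inner_space) \<pi>. hilbert_representation B H \<pi>}"
  then obtain H :: "('a \<Rightarrow> complex) inner_space" and \<pi>
    where H: "hilbert_representation B H \<pi>" and req: "r = op_norm H (\<pi> a)" by blast
  interpret star_rep B H \<pi> by (rule star_repI[OF H])
  show "r \<le> M" unfolding req using assms H by (intro H.op_norm_le) auto
qed

lemma universal_norm_nonneg: "a \<in> carrier B \<Longrightarrow> 0 \<le> universal_norm B a"
proof -
  assume a: "a \<in> carrier B"
  obtain H :: "('a \<Rightarrow> complex) inner_space" and \<pi> where H: "hilbert_representation B H \<pi>" using ex_rep by blast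
  interpret star_rep B H \<pi> by (rule star_repI[OF H])
  show ?thesis using op_norm_le_universal[OF a H] H.op_norm_nonneg[OF bounded[OF a]] by linarith
qed

lemma universal_norm_add:
  assumes "a \<in> carrier B" "b \<in> carrier B"
  shows "universal_norm B (a \<oplus> b) \<le> universal_norm B a + universal_norm B b"
proof (rule universal_norm_le)
  fix H :: "('a \<Rightarrow> complex) inner_space" and \<pi> x assume H: "hilbert_representation B H \<pi>" and x: "x \<in> carrier H"
  interpret star_rep B H \<pi> by (rule star_repI[OF H])
  show "hnorm H (\<pi> (a \<oplus> b) x) \<le> (universal_norm B a + universal_norm B b) * hnorm H x"
    using H.hnorm_triangle[of "\<pi> a x" "\<pi> b x"] universal_bound[OF assms(1) H x] universal_bound[OF assms(2) H x]
    by (simp add: rep_add assms x rep_closed distrib_right)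
qed (simp add: universal_norm_nonneg assms)

lemma universal_norm_smult:
  assumes "a \<in> carrier B"
  shows "universal_norm B (c \<odot> a) \<le> cmod c * universal_norm B a"
proof (rule universal_norm_le)
  fix H :: "('a \<Rightarrow> complex) inner_space" and \<pi> x assume H: "hilbert_representation B H \<pi>" and x: "x \<in> carrier H"
  interpret star_rep B H \<pi> by (rule star_repI[OF H])
  show "hnorm H (\<pi> (c \<odot> a) x) \<le> (cmod c * universal_norm B a) * hnorm H x"
    using universal_bound[OF assms(1) H x]
    by (simp add: rep_smult assms x rep_closed H.hnorm_smult mult.assoc mult_left_mono)
qed (simp add: universal_norm_nonneg assms)

lemma universal_norm_mult:
  assumes "a \<in> carrier B" "b \<in> carrier B"
  shows "universal_norm B (a \<otimes> b) \<le> universal_norm B a * universal_norm B b"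
proof (rule universal_norm_le)
  fix H :: "('a \<Rightarrow> complex) inner_space" and \<pi> x assume H: "hilbert_representation B H \<pi>" and x: "x \<in> carrier H"
  interpret star_rep B H \<pi> by (rule star_repI[OF H])
  have "hnorm H (\<pi> a (\<pi> b x)) \<le> universal_norm B a * hnorm H (\<pi> b x)"
    using universal_bound[OF assms(1) H] rep_closed assms x by blast
  also have "\<dots> \<le> universal_norm B a * (universal_norm B b * hnorm H x)"
    using universal_bound[OF assms(2) H x] universal_norm_nonneg[OF assms(1)] by (rule mult_left_mono)
  finally show "hnorm H (\<pi> (a \<otimes> b) x) \<le> (universal_norm B a * universal_norm B b) * hnorm H x"
    by (simp add: rep_mult assms x mult.assoc)
qed (simp add: universal_norm_nonneg assms)

text \<open>With y = a* x the adjoint relation gives |y|^2 = <x, a y>, which is at most |x| |a| |y|;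
  one factor |y| cancels.\<close>

lemma universal_norm_star:
  assumes "a \<in> carrier B"
  shows "universal_norm B (star B a) \<le> universal_norm B a"
proof (rule universal_norm_le)
  fix H :: "('a \<Rightarrow> complex) inner_space" and \<pi> x assume H: "hilbert_representation B H \<pi>" and x: "x \<in> carrier H"
  interpret star_rep B H \<pi> by (rule star_repI[OF H])
  let ?y = "\<pi> (star B a) x"
  have y: "?y \<in> carrier H" using rep_closed star_closed assms x by blast
  have "(hnorm H ?y)\<^sup>2 = cmod (hinner H ?y ?y)" using H.inner_self[OF y] by (metis abs_power2 norm_of_real)
  also have "\<dots> = cmod (hinner H x (\<pi> a ?y))" using rep_star[OF assms x y] by simp
  also have "\<dots> \<le> hnorm H x * hnorm H (\<pi> a ?y)" using H.Cauchy_Schwarz rep_closed assms x y by blast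
  also have "\<dots> \<le> hnorm H x * (universal_norm B a * hnorm H ?y)"
    using universal_bound[OF assms H y] H.hnorm_nonneg[OF x] by (rule mult_left_mono)
  finally have "hnorm H ?y * hnorm H ?y \<le> (universal_norm B a * hnorm H x) * hnorm H ?y"
    by (simp add: power2_eq_square mult_ac)
  then show "hnorm H ?y \<le> universal_norm B a * hnorm H x"
    using H.hnorm_nonneg[OF y] H.hnorm_nonneg[OF x] universal_norm_nonneg[OF assms]
    by (cases "hnorm H ?y = 0") (auto simp: mult_le_cancel_right)
qed (simp add: universal_norm_nonneg assms)

end

section \<open>The universal property of the tensor algebra\<close>

context complex_algebra
begin

lemma smult_zero_right: "c \<odot> \<zero> = \<zero>"
proof -
  have "c \<odot> \<zero> = (c * 0) \<odot> \<zero>" using smult_assoc[of \<zero> c 0] smult_zero_left[of \<zero>] by simp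
  then show ?thesis using smult_zero_left[of \<zero>] by simp
qed

lemma smult_finsum: "finite S \<Longrightarrow> f \<in> S \<rightarrow> carrier A \<Longrightarrow> c \<odot> finsum A f S = (\<Oplus>i\<in>S. c \<odot> f i)"
proof (induction S rule: finite_induct)
  case empty
  then show ?case by (simp add: smult_zero_right)
next
  case (insert i S)
  then have "f i \<in> carrier A" "f \<in> S \<rightarrow> carrier A" "(\<lambda>i. c \<odot> f i) \<in> S \<rightarrow> carrier A" by (auto intro: smult_closed)
  then show ?case using insert by (simp add: finsum_insert smult_r_distr smult_closed finsum_closed)
qed

primrec word_prod :: "('n \<Rightarrow> 'a) \<Rightarrow> 'n list \<Rightarrow> 'a" where
  "word_prod g [] = \<one>"
| "word_prod g (i # w) = g i \<otimes> word_prod g w"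

definition tensor_lift :: "('n \<Rightarrow> 'a) \<Rightarrow> ('n list \<Rightarrow> complex) \<Rightarrow> 'a" where
  "tensor_lift g f = (\<Oplus>w\<in>{w. f w \<noteq> 0}. f w \<odot> word_prod g w)"

context
  fixes g :: "'n \<Rightarrow> 'a"
  assumes g: "\<And>i. g i \<in> carrier A"
begin

lemma word_prod_closed: "word_prod g w \<in> carrier A"
  by (induction w) (auto simp: g)

text \<open>Summing over a common larger set of words lets the lifts of several tensors be combined
  term by term.\<close>

lemma tensor_lift_superset:
  assumes "finite S" "{w. f w \<noteq> 0} \<subseteq> S"
  shows "tensor_lift g f = (\<Oplus>w\<in>S. f w \<odot> word_prod g w)"
  unfolding tensor_lift_def using assms
  by (intro add.finprod_mono_neutral_cong_left) (auto simp: smult_zero_left word_prod_closed smult_closed)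

lemma tensor_lift_closed: "tensor_lift g f \<in> carrier A"
  unfolding tensor_lift_def by (intro finsum_closed) (auto simp: word_prod_closed smult_closed)

lemma tensor_lift_add:
  assumes "f \<in> carrier tensor_algebra" "f' \<in> carrier tensor_algebra"
  shows "tensor_lift g (f \<oplus>\<^sub>T f') = tensor_lift g f \<oplus> tensor_lift g f'"
proof -
  let ?S = "{w. f w \<noteq> 0} \<union> {w. f' w \<noteq> 0}"
  have fin: "finite ?S" using assms by (simp add: tensor_algebra_simps)
  have "{w. (f \<oplus>\<^sub>T f') w \<noteq> 0} \<subseteq> ?S" by (auto simp: tensor_algebra_simps)
  then have "tensor_lift g (f \<oplus>\<^sub>T f') = (\<Oplus>w\<in>?S. (f w + f' w) \<odot> word_prod g w)"
    by (subst tensor_lift_superset[OF fin]) (simp_all add: tensor_algebra_simps)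
  also have "\<dots> = (\<Oplus>w\<in>?S. f w \<odot> word_prod g w \<oplus> f' w \<odot> word_prod g w)"
    by (simp add: smult_l_distr word_prod_closed)
  also have "\<dots> = (\<Oplus>w\<in>?S. f w \<odot> word_prod g w) \<oplus> (\<Oplus>w\<in>?S. f' w \<odot> word_prod g w)"
    by (intro finsum_addf) (auto simp: word_prod_closed smult_closed)
  also have "\<dots> = tensor_lift g f \<oplus> tensor_lift g f'"
    using tensor_lift_superset[OF fin, of f] tensor_lift_superset[OF fin, of f'] by simp
  finally show ?thesis .
qed

lemma tensor_lift_smult:
  assumes "f \<in> carrier tensor_algebra"
  shows "tensor_lift g (c \<odot>\<^sub>T f) = c \<odot> tensor_lift g f"
proof -
  let ?S = "{w. f w \<noteq> 0}"
  have fin: "finite ?S" using assms by (simp add: tensor_algebra_simps)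
  have "{w. (c \<odot>\<^sub>T f) w \<noteq> 0} \<subseteq> ?S" by (auto simp: tensor_algebra_simps)
  then have "tensor_lift g (c \<odot>\<^sub>T f) = (\<Oplus>w\<in>?S. (c * f w) \<odot> word_prod g w)"
    by (subst tensor_lift_superset[OF fin]) (simp_all add: tensor_algebra_simps)
  also have "\<dots> = (\<Oplus>w\<in>?S. c \<odot> (f w \<odot> word_prod g w))"
    by (simp add: smult_assoc word_prod_closed)
  also have "\<dots> = c \<odot> tensor_lift g f"
    unfolding tensor_lift_def using fin by (intro smult_finsum[symmetric]) (auto simp: word_prod_closed smult_closed)
  finally show ?thesis .
qed

lemma tensor_lift_word: "tensor_lift g (word w) = word_prod g w"
proof -
  have "tensor_lift g (word w) = (\<Oplus>u\<in>{w}. word w u \<odot> word_prod g u)"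
    by (intro tensor_lift_superset) (auto simp: word_def)
  then show ?thesis by (simp add: finsum_insert word_prod_closed smult_closed word_def smult_one)
qed

lemma tensor_lift_one: "tensor_lift g \<one>\<^sub>T = \<one>"
  using tensor_lift_word[of "[]"] by (simp add: word_Nil)

text \<open>The left factor is built up letter by letter and then by linearity, which avoids
  rearranging the double sum of the convolution.\<close>

lemma tensor_lift_mult:
  assumes f: "f \<in> carrier tensor_algebra" and f': "f' \<in> carrier tensor_algebra"
  shows "tensor_lift g (f \<otimes>\<^sub>T f') = tensor_lift g f \<otimes> tensor_lift g f'"
proof -
  have smult_l: "(c \<odot>\<^sub>T x) \<otimes>\<^sub>T y = c \<odot>\<^sub>T (x \<otimes>\<^sub>T y)"
    and smult_r: "x \<otimes>\<^sub>T (c \<odot>\<^sub>T y) = c \<odot>\<^sub>T (x \<otimes>\<^sub>T y)"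
    for c and x y :: "'n list \<Rightarrow> complex"
    by (simp_all add: tensor_algebra_simps sum_distrib_left mult_ac)
  have 1: "tensor_lift g (word [i] \<otimes>\<^sub>T y) = g i \<otimes> tensor_lift g y"
    if "y \<in> carrier tensor_algebra" for i y
    using that
  proof (induction rule: tensor_span_induct)
    case (word w)
    show ?case by (simp add: word_Cons[symmetric] tensor_lift_word)
  next
    case (add x y)
    then show ?case by (simp add: T.r_distr word_closed tensor_lift_add tensor_lift_closed g r_distr)
  next
    case (smult c x)
    then show ?case by (simp add: smult_r tensor_lift_smult word_closed tensor_lift_closed g smult_mult_right)
  qed
  have 2: "tensor_lift g (word w \<otimes>\<^sub>T y) = word_prod g w \<otimes> tensor_lift g y"
    if "y \<in> carrier tensor_algebra" for w y
    using that
  proof (induction w)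
    case Nil
    then show ?case by (simp add: word_Nil tensor_lift_closed)
  next
    case (Cons i w)
    have "tensor_lift g (word (i # w) \<otimes>\<^sub>T y)
        = tensor_lift g (word [i] \<otimes>\<^sub>T (word w \<otimes>\<^sub>T y))"
      using Cons.prems by (subst word_Cons) (simp add: T.m_assoc word_closed)
    then show ?case using Cons by (simp add: 1 word_closed g word_prod_closed tensor_lift_closed m_assoc)
  qed
  show ?thesis using f
  proof (induction rule: tensor_span_induct)
    case (word w)
    show ?case by (simp add: 2 f' tensor_lift_word)
  next
    case (add x y)
    then show ?case by (simp add: T.l_distr f' tensor_lift_add tensor_lift_closed l_distr)
  next
    case (smult c x)
    then show ?case by (simp add: smult_l f' tensor_lift_smult tensor_lift_closed smult_mult_left)
  qed
qed

end

end

section \<open>Completion\<close>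

text \<open>What the completion uses of the universal norm: a submultiplicative seminorm that the
  star does not increase. Elements on which \<open>p\<close> is zero disappear in the quotient by
  the null sequences.\<close>

locale seminormed_star = complex_star_algebra B for B :: "'a star_algebra" (structure) +
  fixes p :: "'a \<Rightarrow> real"
  assumes p_nonneg: "x \<in> carrier B \<Longrightarrow> 0 \<le> p x"
    and p_add: "x \<in> carrier B \<Longrightarrow> y \<in> carrier B \<Longrightarrow> p (x \<oplus> y) \<le> p x + p y"
    and p_smult: "x \<in> carrier B \<Longrightarrow> p (c \<odot> x) \<le> cmod c * p x"
    and p_mult: "x \<in> carrier B \<Longrightarrow> y \<in> carrier B \<Longrightarrow> p (x \<otimes> y) \<le> p x * p y"
    and p_star: "x \<in> carrier B \<Longrightarrow> p (star B x) \<le> p x"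
begin

lemma p_zero: "p \<zero> = 0"
  using p_smult[of \<zero> 0] p_nonneg[of \<zero>] smult_zero_left[of \<zero>] by simp

lemma p_minus: "x \<in> carrier B \<Longrightarrow> p (\<ominus> x) = p x"
  using p_smult[of x "-1"] p_smult[of "\<ominus> x" "-1"] smult_minus_one[of x] smult_minus_one[of "\<ominus> x"] by simp

lemma p_diff_comm: "x \<in> carrier B \<Longrightarrow> y \<in> carrier B \<Longrightarrow> p (x \<ominus> y) = p (y \<ominus> x)"
  using p_minus[of "y \<ominus> x"] by (simp add: a_minus_def minus_add a_comm)

lemma p_le_diff: "x \<in> carrier B \<Longrightarrow> y \<in> carrier B \<Longrightarrow> p x \<le> p (x \<ominus> y) + p y"
  using p_add[of "x \<ominus> y" y] by (simp add: a_minus_def a_assoc l_neg)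

lemma cauchyD: "cauchy_in B p s \<Longrightarrow> s k \<in> carrier B"
  by (simp add: cauchy_in_def)

text \<open>One comparison principle for sums, products, scalar multiples and adjoints of Cauchy
  sequences; for the unary operations both comparison sequences are the same.\<close>

lemma cauchyI:
  assumes s: "\<And>k. s k \<in> carrier B" and a: "cauchy_in B p a" and b: "cauchy_in B p b" and C: "0 \<le> C"
    and le: "\<And>k l. p (s k \<ominus> s l) \<le> C * p (a k \<ominus> a l) + C * p (b k \<ominus> b l)"
  shows "cauchy_in B p s"
  unfolding cauchy_in_def
proof (intro conjI allI impI s)
  fix e :: real assume e: "e > 0"
  \<comment> \<open>The denominator contains C + 1 rather than C so that the quotient is positive
    also for C = 0.\<close>
  define e' where "e' = e / 2 / (C + 1)"
  have e': "e' > 0" using e C by (simp add: e'_def)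
  obtain N1 N2 where N1: "\<And>k l. k \<ge> N1 \<Longrightarrow> l \<ge> N1 \<Longrightarrow> p (a k \<ominus> a l) < e'"
    and N2: "\<And>k l. k \<ge> N2 \<Longrightarrow> l \<ge> N2 \<Longrightarrow> p (b k \<ominus> b l) < e'"
    using a b e' unfolding cauchy_in_def by meson
  have "p (s k \<ominus> s l) < e" if "k \<ge> max N1 N2" "l \<ge> max N1 N2" for k l
  proof -
    have "p (s k \<ominus> s l) \<le> C * e' + C * e'"
      using le[of k l] N1[of k l] N2[of k l] that C
      by (smt (verit) max.bounded_iff mult_left_mono)
    also have "\<dots> < (C + 1) * e' + (C + 1) * e'" using e' by (simp add: distrib_right)
    also have "(C + 1) * e' = e / 2"
      unfolding e'_def by (subst times_divide_eq_right, rule nonzero_mult_div_cancel_left) (use C in simp)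
    also have "e / 2 + e / 2 = e" by simp
    finally show ?thesis .
  qed
  then show "\<exists>N. \<forall>k\<ge>N. \<forall>l\<ge>N. p (s k \<ominus> s l) < e" by blast
qed

lemma cauchy_bounded:
  assumes "cauchy_in B p s" obtains M where "M \<ge> 0" "\<And>k. p (s k) \<le> M"
proof -
  obtain N where N: "\<And>k. k \<ge> N \<Longrightarrow> p (s k \<ominus> s N) < 1"
    using assms unfolding cauchy_in_def by (meson order_refl zero_less_one)
  define M where "M = Max ((\<lambda>k. p (s k)) ` {..N}) + 1"
  have b: "p (s k) \<le> M - 1" if "k \<le> N" for k using that by (auto simp: M_def intro: Max_ge)
  have "p (s k) \<le> M" for k
  proof (cases "k \<le> N")
    case False
    then show ?thesis using N[of k] p_le_diff[of "s k" "s N"] b[of N] cauchyD[OF assms] by simp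
  qed (use b in fastforce)
  moreover have "0 \<le> M" using b[of 0] p_nonneg[OF cauchyD[OF assms, of 0]] by simp
  ultimately show thesis using that by blast
qed

lemma cauchy_const: "x \<in> carrier B \<Longrightarrow> cauchy_in B p (\<lambda>k. x)"
  by (simp add: cauchy_in_def a_minus_def r_neg p_zero)

lemma cauchy_add:
  assumes s: "cauchy_in B p s" and t: "cauchy_in B p t"
  shows "cauchy_in B p (\<lambda>k. s k \<oplus> t k)"
proof (rule cauchyI[OF _ s t, of _ 1])
  note c = cauchyD[OF s] cauchyD[OF t]
  fix k l
  have "(s k \<oplus> t k) \<ominus> (s l \<oplus> t l) = (s k \<ominus> s l) \<oplus> (t k \<ominus> t l)"
    using c by (simp add: a_minus_def minus_add a_ac)
  then show "p ((s k \<oplus> t k) \<ominus> (s l \<oplus> t l)) \<le> 1 * p (s k \<ominus> s l) + 1 * p (t k \<ominus> t l)"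
    using p_add[of "s k \<ominus> s l" "t k \<ominus> t l"] c by simp
qed (use cauchyD[OF s] cauchyD[OF t] in auto)

lemma cauchy_mult:
  assumes s: "cauchy_in B p s" and t: "cauchy_in B p t"
  shows "cauchy_in B p (\<lambda>k. s k \<otimes> t k)"
proof -
  note c = cauchyD[OF s] cauchyD[OF t]
  obtain M1 where M1: "M1 \<ge> 0" "\<And>k. p (s k) \<le> M1" using cauchy_bounded[OF s] by blast
  obtain M2 where M2: "M2 \<ge> 0" "\<And>k. p (t k) \<le> M2" using cauchy_bounded[OF t] by blast
  show ?thesis
  proof (rule cauchyI[OF _ s t, of _ "M1 + M2"])
    fix k l
    have "(s k \<otimes> t k) \<ominus> (s l \<otimes> t l) = ((s k \<ominus> s l) \<otimes> t l) \<oplus> (s k \<otimes> (t k \<ominus> t l))"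
    proof -
      have "((s k \<ominus> s l) \<otimes> t l) \<oplus> (s k \<otimes> (t k \<ominus> t l))
          = ((s k \<otimes> t l) \<oplus> \<ominus> (s l \<otimes> t l)) \<oplus> ((s k \<otimes> t k) \<oplus> \<ominus> (s k \<otimes> t l))"
        using c by (simp add: a_minus_def l_distr r_distr l_minus r_minus)
      also have "\<dots> = (s k \<otimes> t k) \<ominus> (s l \<otimes> t l)"
        using c by (simp add: a_minus_def a_ac r_neg2 r_neg1)
      finally show ?thesis by simp
    qed
    then have "p ((s k \<otimes> t k) \<ominus> (s l \<otimes> t l)) \<le> p (s k \<ominus> s l) * p (t l) + p (s k) * p (t k \<ominus> t l)"
      using p_add[of "(s k \<ominus> s l) \<otimes> t l" "s k \<otimes> (t k \<ominus> t l)"] p_mult[of "s k \<ominus> s l" "t l"]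
        p_mult[of "s k" "t k \<ominus> t l"] c by simp
    also have "\<dots> \<le> p (s k \<ominus> s l) * (M1 + M2) + (M1 + M2) * p (t k \<ominus> t l)"
      using M1(1) M2(1) M1(2)[of k] M2(2)[of l] c p_nonneg by (intro add_mono mult_mono) auto
    finally show "p ((s k \<otimes> t k) \<ominus> (s l \<otimes> t l)) \<le> (M1 + M2) * p (s k \<ominus> s l) + (M1 + M2) * p (t k \<ominus> t l)"
      by (simp add: mult.commute)
  qed (use c M1 M2 in auto)
qed

lemma cauchy_smult:
  assumes s: "cauchy_in B p s" shows "cauchy_in B p (\<lambda>k. c \<odot> s k)"
proof (rule cauchyI[OF _ s s, of _ "cmod c"])
  fix k l
  have "c \<odot> s k \<ominus> c \<odot> s l = c \<odot> (s k \<ominus> s l)"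
  proof -
    have "(c \<odot> (s k \<ominus> s l)) \<oplus> c \<odot> s l = c \<odot> s k"
      using cauchyD[OF s] by (simp add: smult_r_distr[symmetric] a_minus_def a_assoc l_neg)
    then have "c \<odot> s k \<ominus> c \<odot> s l = ((c \<odot> (s k \<ominus> s l)) \<oplus> c \<odot> s l) \<ominus> c \<odot> s l" by simp
    also have "\<dots> = c \<odot> (s k \<ominus> s l)"
      using cauchyD[OF s] smult_closed by (simp add: a_minus_def a_assoc r_neg)
    finally show ?thesis .
  qed
  moreover have "0 \<le> cmod c * p (s k \<ominus> s l)" using p_nonneg cauchyD[OF s] by simp
  ultimately show "p (c \<odot> s k \<ominus> c \<odot> s l) \<le> cmod c * p (s k \<ominus> s l) + cmod c * p (s k \<ominus> s l)"
    using p_smult[of "s k \<ominus> s l" c] cauchyD[OF s] by simp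
qed (use cauchyD[OF s] smult_closed in auto)

lemma cauchy_star:
  assumes s: "cauchy_in B p s" shows "cauchy_in B p (\<lambda>k. star B (s k))"
proof (rule cauchyI[OF _ s s, of _ 1])
  fix k l
  have "star B (s k) \<ominus> star B (s l) = star B (s k \<ominus> s l)"
    using cauchyD[OF s] by (simp add: a_minus_def star_add star_minus)
  moreover have "0 \<le> p (s k \<ominus> s l)" using p_nonneg cauchyD[OF s] by simp
  ultimately show "p (star B (s k) \<ominus> star B (s l)) \<le> 1 * p (s k \<ominus> s l) + 1 * p (s k \<ominus> s l)"
    using p_star[of "s k \<ominus> s l"] cauchyD[OF s] by simp
qed (use cauchyD[OF s] star_closed in auto)

abbreviation CA where "CA \<equiv> cauchy_algebra B p"
abbreviation NI where "NI \<equiv> null_ideal B p"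

lemma cauchy_uminus: "cauchy_in B p s \<Longrightarrow> cauchy_in B p (\<lambda>k. \<ominus> s k)"
  using cauchy_smult[of s "-1"] cauchyD[of s] by (simp add: smult_minus_one)

lemmas CA_simps = cauchy_algebra_def[of B p, THEN arg_cong, of carrier, simplified]
  cauchy_algebra_def[of B p, THEN arg_cong, of mult, simplified]
  cauchy_algebra_def[of B p, THEN arg_cong, of one, simplified]
  cauchy_algebra_def[of B p, THEN arg_cong, of zero, simplified]
  cauchy_algebra_def[of B p, THEN arg_cong, of add, simplified]
  cauchy_algebra_def[of B p, THEN arg_cong, of smult, simplified]

lemma ring_cauchy_algebra: "ring CA"
proof (rule ringI)
  show "abelian_group CA"
  proof (rule abelian_groupI)
    fix x assume "x \<in> carrier CA"
    then show "\<exists>y\<in>carrier CA. y \<oplus>\<^bsub>CA\<^esub> x = \<zero>\<^bsub>CA\<^esub>"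
      by (intro bexI[of _ "\<lambda>k. \<ominus> x k"]) (auto simp: CA_simps l_neg cauchyD cauchy_uminus)
  qed (auto simp: CA_simps cauchy_add cauchy_const cauchyD a_ac)
  show "Group.monoid CA"
    by (rule monoidI) (auto simp: CA_simps cauchy_mult cauchy_const cauchyD m_assoc)
qed (auto simp: CA_simps cauchyD l_distr r_distr)

lemma CA_minus: "s \<in> carrier CA \<Longrightarrow> \<ominus>\<^bsub>CA\<^esub> s = (\<lambda>k. \<ominus> s k)"
proof -
  assume s: "s \<in> carrier CA"
  interpret S: ring CA by (rule ring_cauchy_algebra)
  show ?thesis using s by (intro S.minus_equality) (auto simp: CA_simps l_neg cauchyD cauchy_uminus)
qed

text \<open>The counterpart of \<open>cauchyI\<close> for null sequences, by squeezing. For products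
  \<open>C\<close> is a bound of the other, Cauchy, factor.\<close>

lemma null_compare:
  assumes s: "cauchy_in B p s" and a: "a \<in> NI" and b: "b \<in> NI"
    and le: "\<And>k. p (s k) \<le> C * p (a k) + C * p (b k)"
  shows "s \<in> NI"
proof -
  have "(\<lambda>k. C * p (a k) + C * p (b k)) \<longlonglongrightarrow> C * 0 + C * 0"
    using a b by (intro tendsto_intros) (auto simp: null_ideal_def)
  then have lim: "(\<lambda>k. C * p (a k) + C * p (b k)) \<longlonglongrightarrow> 0" by simp
  have "(\<lambda>k. p (s k)) \<longlonglongrightarrow> 0"
    by (rule Lim_null_comparison[OF _ lim]) (use p_nonneg[OF cauchyD[OF s]] le in simp)
  then show ?thesis using s by (simp add: null_ideal_def)
qed

lemma algebra_ideal_null: "algebra_ideal NI CA"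
proof -
  have NIc: "s \<in> NI \<Longrightarrow> cauchy_in B p s" for s by (simp add: null_ideal_def)
  have id: "ideal NI CA"
  proof (rule idealI)
    show "ring CA" by (rule ring_cauchy_algebra)
    show "subgroup NI (add_monoid CA)"
    proof
      show "NI \<subseteq> carrier (add_monoid CA)" using NIc by (auto simp: CA_simps)
    next
      fix x y assume xy: "x \<in> NI" "y \<in> NI"
      have "(\<lambda>k. x k \<oplus> y k) \<in> NI"
        by (rule null_compare[OF cauchy_add[OF NIc[OF xy(1)] NIc[OF xy(2)]] xy, of 1])
          (simp add: p_add cauchyD[OF NIc[OF xy(1)]] cauchyD[OF NIc[OF xy(2)]])
      then show "x \<otimes>\<^bsub>add_monoid CA\<^esub> y \<in> NI" by (simp add: CA_simps)
    next
      show "\<one>\<^bsub>add_monoid CA\<^esub> \<in> NI" by (simp add: CA_simps null_ideal_def cauchy_const p_zero)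
    next
      fix x assume x: "x \<in> NI"
      have "(\<lambda>k. \<ominus> x k) \<in> NI"
        by (rule null_compare[OF cauchy_uminus[OF NIc[OF x]] x x, of 1])
          (simp add: p_minus p_nonneg cauchyD[OF NIc[OF x]])
      then show "inv\<^bsub>add_monoid CA\<^esub> x \<in> NI"
        using CA_minus[of x] NIc[OF x] by (simp add: a_inv_def CA_simps)
    qed
  next
    fix a x assume a: "a \<in> NI" and x: "x \<in> carrier CA"
    then have x: "cauchy_in B p x" by (simp add: CA_simps)
    obtain M where M: "M \<ge> 0" "\<And>k. p (x k) \<le> M" using cauchy_bounded[OF x] by blast
    note c = cauchyD[OF x] cauchyD[OF NIc[OF a]]
    have nn: "0 \<le> M * p (a k)" for k using M p_nonneg c by simp
    have 1: "p (x k) * p (a k) \<le> M * p (a k)" for k using M p_nonneg c by (simp add: mult_right_mono)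
    have "p (x k \<otimes> a k) \<le> M * p (a k) + M * p (a k)" for k
      using p_mult[OF c(1)[of k] c(2)[of k]] 1[of k] nn[of k] by linarith
    then show "x \<otimes>\<^bsub>CA\<^esub> a \<in> NI" unfolding CA_simps by (rule null_compare[OF cauchy_mult[OF x NIc[OF a]] a a])
    have "p (a k \<otimes> x k) \<le> M * p (a k) + M * p (a k)" for k
      using p_mult[OF c(2)[of k] c(1)[of k]] 1[of k] nn[of k] by (simp add: mult.commute)
    then show "a \<otimes>\<^bsub>CA\<^esub> x \<in> NI" unfolding CA_simps by (rule null_compare[OF cauchy_mult[OF NIc[OF a] x] a a])
  qed
  interpret ideal NI CA by (rule id)
  show ?thesis
  proof
    fix x c assume x: "x \<in> NI"
    have "p (c \<odot> x k) \<le> cmod c * p (x k) + cmod c * p (x k)" for k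
      using p_smult[OF cauchyD[OF NIc[OF x]], of c k]
        mult_nonneg_nonneg[OF norm_ge_zero[of c] p_nonneg[OF cauchyD[OF NIc[OF x]], of k]] by linarith
    then show "c \<odot>\<^bsub>CA\<^esub> x \<in> NI"
      unfolding CA_simps by (rule null_compare[OF cauchy_smult[OF NIc[OF x]] x x])
  qed (auto simp: CA_simps cauchy_smult smult_r_distr cauchyD)
qed

sublocale N: algebra_ideal NI CA by (rule algebra_ideal_null)

abbreviation CB where "CB \<equiv> star_completion B p"
abbreviation emb where "emb \<equiv> completion_embed B p"

lemma completion_simps:
  "carrier CB = carrier (quot_algebra CA NI)" "mult CB = mult (quot_algebra CA NI)"
  "one CB = one (quot_algebra CA NI)" "add CB = add (quot_algebra CA NI)" "smult CB = smult (quot_algebra CA NI)"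
  "star CB = (\<lambda>X. \<Union>s\<in>X. NI +>\<^bsub>CA\<^esub> (\<lambda>k. star B (s k)))"
  "alg_norm CB = (\<lambda>X. THE r. \<exists>s\<in>X. (\<lambda>k. p (s k)) \<longlonglongrightarrow> r)"
  by (simp_all add: star_completion_def Let_def)

lemma const_closed: "b \<in> carrier B \<Longrightarrow> (\<lambda>k. b) \<in> carrier CA"
  by (simp add: CA_simps cauchy_const)

lemma emb_closed: "b \<in> carrier B \<Longrightarrow> emb b \<in> carrier CB"
  by (simp add: completion_simps N.quot_carrier completion_embed_def const_closed)

lemma emb_add: "a \<in> carrier B \<Longrightarrow> b \<in> carrier B \<Longrightarrow> emb (a \<oplus> b) = emb a \<oplus>\<^bsub>CB\<^esub> emb b"
  by (simp add: completion_simps completion_embed_def N.quot_add const_closed) (simp add: CA_simps)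

lemma emb_mult: "a \<in> carrier B \<Longrightarrow> b \<in> carrier B \<Longrightarrow> emb (a \<otimes> b) = emb a \<otimes>\<^bsub>CB\<^esub> emb b"
  by (simp add: completion_simps completion_embed_def N.quot_mult const_closed) (simp add: CA_simps)

lemma emb_smult: "b \<in> carrier B \<Longrightarrow> emb (c \<odot> b) = c \<odot>\<^bsub>CB\<^esub> emb b"
  by (simp add: completion_simps completion_embed_def N.quot_smult const_closed) (simp add: CA_simps)

lemma emb_one: "emb \<one> = \<one>\<^bsub>CB\<^esub>"
  by (simp add: completion_simps completion_embed_def N.quot_one) (simp add: CA_simps)

lemma emb_star:
  assumes b: "b \<in> carrier B" shows "star CB (emb b) = emb (star B b)"
proof -
  have "(\<Union>s\<in>NI +>\<^bsub>CA\<^esub> (\<lambda>k. b). NI +>\<^bsub>CA\<^esub> (\<lambda>k. star B (s k))) = NI +>\<^bsub>CA\<^esub> (\<lambda>k. star B b)"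
  proof (rule N.coset_union[OF const_closed[OF b]])
    fix y assume y: "y \<in> carrier CA" "NI +>\<^bsub>CA\<^esub> y = NI +>\<^bsub>CA\<^esub> (\<lambda>k. b)"
    then have yc: "cauchy_in B p y" by (simp add: CA_simps)
    have mi: "s \<ominus>\<^bsub>CA\<^esub> (\<lambda>k. d) = (\<lambda>k. s k \<ominus> d)" if "d \<in> carrier B" for s d
      using CA_minus[OF const_closed[OF that]] by (simp add: a_minus_def CA_simps)
    have n: "(\<lambda>k. y k \<ominus> b) \<in> NI"
      using y N.coset_eq_iff[OF y(1) const_closed[OF b]] mi[OF b] by simp
    have eq: "star B (y k) \<ominus> star B b = star B (y k \<ominus> b)" for k
      using cauchyD[OF yc] b by (simp add: a_minus_def star_add star_minus)
    have nc: "cauchy_in B p (\<lambda>k. y k \<ominus> b)" using n by (simp add: null_ideal_def)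
    have "p (star B (y k \<ominus> b)) \<le> 1 * p (y k \<ominus> b) + 1 * p (y k \<ominus> b)" for k
      using p_star[of "y k \<ominus> b"] p_nonneg[of "y k \<ominus> b"] cauchyD[OF yc, of k] b by simp
    then have "(\<lambda>k. star B (y k) \<ominus> star B b) \<in> NI"
      unfolding eq by (rule null_compare[OF cauchy_star[OF nc] n n])
    then show "NI +>\<^bsub>CA\<^esub> (\<lambda>k. star B (y k)) = NI +>\<^bsub>CA\<^esub> (\<lambda>k. star B b)"
      using N.coset_eq_iff[OF _ const_closed[OF star_closed[OF b]], of "\<lambda>k. star B (y k)"]
        mi[OF star_closed[OF b]] cauchy_star[OF yc] by (simp add: CA_simps)
  qed
  then show ?thesis by (simp add: completion_simps completion_embed_def)
qed

text \<open>Every member of the coset differs from the constant sequence by a null sequence, so by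
  the triangle inequality its seminorms have the same limit. This determines the value of the
  definite description in \<open>alg_norm\<close>.\<close>

lemma alg_norm_emb:
  assumes b: "b \<in> carrier B" shows "alg_norm CB (emb b) = p b"
proof -
  have lim: "(\<lambda>k. p (s k)) \<longlonglongrightarrow> p b" if s: "s \<in> NI +>\<^bsub>CA\<^esub> (\<lambda>k. b)" for s
  proof -
    have sc: "s \<in> carrier CA" "NI +>\<^bsub>CA\<^esub> s = NI +>\<^bsub>CA\<^esub> (\<lambda>k. b)" using N.mem_coset[OF const_closed[OF b] s] by auto
    then have c: "s k \<in> carrier B" for k by (simp add: CA_simps cauchyD)
    have "s \<ominus>\<^bsub>CA\<^esub> (\<lambda>k. b) \<in> NI" using sc N.coset_eq_iff[OF sc(1) const_closed[OF b]] by simp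
    then have n: "(\<lambda>k. p (s k \<ominus> b)) \<longlonglongrightarrow> 0"
      using CA_minus[OF const_closed[OF b]] by (simp add: a_minus_def CA_simps null_ideal_def)
    have "norm (p (s k) - p b) \<le> p (s k \<ominus> b)" for k
      using p_le_diff[OF c[of k] b] p_le_diff[OF b c[of k]] p_diff_comm[OF b c[of k]] by simp
    then have "(\<lambda>k. p (s k) - p b) \<longlonglongrightarrow> 0"
      by (rule Lim_null_comparison[OF _ n, OF always_eventually, rule_format])
    then show ?thesis by (simp add: LIM_zero_iff)
  qed
  have self: "(\<lambda>k. b) \<in> NI +>\<^bsub>CA\<^esub> (\<lambda>k. b)" by (rule N.coset_self[OF const_closed[OF b]])
  have "(THE r. \<exists>s\<in>NI +>\<^bsub>CA\<^esub> (\<lambda>k. b). (\<lambda>k. p (s k)) \<longlonglongrightarrow> r) = p b"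
  proof (rule the_equality)
    show "\<exists>s\<in>NI +>\<^bsub>CA\<^esub> (\<lambda>k. b). (\<lambda>k. p (s k)) \<longlonglongrightarrow> p b" using self by (intro bexI[where x = "\<lambda>k. b"]) simp_all
    fix r assume "\<exists>s\<in>NI +>\<^bsub>CA\<^esub> (\<lambda>k. b). (\<lambda>k. p (s k)) \<longlonglongrightarrow> r"
    then obtain s where "s \<in> NI +>\<^bsub>CA\<^esub> (\<lambda>k. b)" "(\<lambda>k. p (s k)) \<longlonglongrightarrow> r" by blast
    then show "r = p b" using lim LIMSEQ_unique by blast
  qed
  then show ?thesis by (simp add: completion_simps completion_embed_def)
qed

text \<open>Needed to divide by sqrt 2 in the completion when two homomorphisms are compared on
  V.\<close>

lemma completion_smult_assoc: "X \<in> carrier CB \<Longrightarrow> c \<odot>\<^bsub>CB\<^esub> (d \<odot>\<^bsub>CB\<^esub> X) = (c * d) \<odot>\<^bsub>CB\<^esub> X"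
  and completion_smult_one: "X \<in> carrier CB \<Longrightarrow> 1 \<odot>\<^bsub>CB\<^esub> X = X"
proof -
  assume "X \<in> carrier CB"
  then obtain s where s: "s \<in> carrier CA" "X = NI +>\<^bsub>CA\<^esub> s" by (auto simp: completion_simps N.quot_carrier)
  have c: "s k \<in> carrier B" for k using s by (simp add: CA_simps cauchyD)
  have "e \<odot>\<^bsub>CA\<^esub> s = (\<lambda>k. e \<odot> s k)" for e by (simp add: CA_simps)
  show "c \<odot>\<^bsub>CB\<^esub> (d \<odot>\<^bsub>CB\<^esub> X) = (c * d) \<odot>\<^bsub>CB\<^esub> X"
    using s c by (simp add: completion_simps N.quot_smult N.smult_closed) (simp add: CA_simps smult_assoc)
  show "1 \<odot>\<^bsub>CB\<^esub> X = X"
    using s c by (simp add: completion_simps N.quot_smult) (simp add: CA_simps smult_one)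
qed

end

section \<open>Coordinates on the twisted crossed product\<close>

text \<open>The set where a continuous \<open>g\<close> does not vanish is open in \<open>K\<close>,
  so the limit at a point of this set is the same within it as within \<open>K\<close>.\<close>

lemma continuous_on_local:
  fixes F :: "'a::topological_space \<Rightarrow> 'b::topological_space"
  assumes "\<And>x. x \<in> K \<Longrightarrow> \<exists>g :: 'a \<Rightarrow> complex. continuous_on K g \<and> g x \<noteq> 0 \<and> continuous_on {y \<in> K. g y \<noteq> 0} F"
  shows "continuous_on K F"
  unfolding continuous_on_def
proof
  fix x assume x: "x \<in> K"
  then obtain g :: "'a \<Rightarrow> complex" where g: "continuous_on K g" "g x \<noteq> 0" "continuous_on {y \<in> K. g y \<noteq> 0} F"
    using assms by blast
  obtain A where A: "open A" "A \<inter> K = g -` (- {0}) \<inter> K"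
    using g(1) continuous_on_open_invariant[of K g] by (metis open_Compl closed_singleton)
  have "(F \<longlongrightarrow> F x) (at x within {y \<in> K. g y \<noteq> 0})" using g x by (simp add: continuous_on_def)
  also have "at x within {y \<in> K. g y \<noteq> 0} = at x within K"
    using A g(2) x by (intro at_within_nhd[of x A]) auto
  finally show "(F \<longlongrightarrow> F x) (at x within K)" .
qed

text \<open>Near a point where \<open>g\<close> is nonzero one divides by it. In this way a factor
  |phi vs|^2, brought in to let phases cancel, is removed again.\<close>

lemma continuous_on_multiplier:
  fixes F :: "'a::topological_space \<Rightarrow> complex"
  assumes "\<And>x. x \<in> K \<Longrightarrow> \<exists>g. continuous_on K g \<and> g x \<noteq> 0 \<and> continuous_on K (\<lambda>y. F y * g y)"
  shows "continuous_on K F"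
proof (rule continuous_on_local)
  fix x assume "x \<in> K"
  then obtain g where g: "continuous_on K g" "g x \<noteq> 0" "continuous_on K (\<lambda>y. F y * g y)" using assms by blast
  have "continuous_on {y \<in> K. g y \<noteq> 0} (\<lambda>y. (F y * g y) / g y)"
    using g by (intro continuous_on_divide continuous_on_subset[OF g(3)] continuous_on_subset[OF g(1)]) auto
  then have "continuous_on {y \<in> K. g y \<noteq> 0} F" by (rule continuous_on_eq) simp
  then show "\<exists>g :: 'a \<Rightarrow> complex. continuous_on K g \<and> g x \<noteq> 0 \<and> continuous_on {y \<in> K. g y \<noteq> 0} F" using g by blast
qed

text \<open>The arguments of a fibre are parametrised by scalars along the orbit, so that
  multilinearity on lines amounts to the single factor \<open>prod_list cs\<close>.\<close>

fun scaled_lift :: "('n::finite proj \<Rightarrow> 'n proj) \<Rightarrow> complex list \<Rightarrow> 'n proj \<Rightarrow> (complex^'n) list" where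
  "scaled_lift \<sigma> [] Z = []"
| "scaled_lift \<sigma> (c # cs) Z = c *s rep Z # scaled_lift \<sigma> cs (\<sigma> Z)"

lemma length_scaled_lift [simp]: "length (scaled_lift \<sigma> cs Z) = length cs"
  by (induction cs arbitrary: Z) auto

lemma scaled_lift_append: "scaled_lift \<sigma> (cs @ ds) Z = scaled_lift \<sigma> cs Z @ scaled_lift \<sigma> ds ((\<sigma> ^^ length cs) Z)"
  by (induction cs arbitrary: Z) (auto simp: funpow_swap1)

lemma lift_Suc: "lift \<sigma> (Suc m) Z = rep Z # lift \<sigma> m (\<sigma> Z)"
  unfolding lift_def by (simp add: upt_rec[of 0] map_Suc_upt[symmetric] funpow_swap1 del: upt_Suc) 

lemma lift_0 [simp]: "lift \<sigma> 0 Z = []"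
  by (simp add: lift_def)

lemma lift_eq_scaled: "lift \<sigma> m Z = scaled_lift \<sigma> (replicate m 1) Z"
  by (induction m arbitrary: Z) (auto simp: lift_Suc)

lemma length_lift [simp]: "length (lift \<sigma> m Z) = m"
  by (simp add: lift_def)

lemma lift_add: "lift \<sigma> (m + k) Z = lift \<sigma> m Z @ lift \<sigma> k ((\<sigma> ^^ m) Z)"
  by (simp add: lift_eq_scaled replicate_add scaled_lift_append)

lemma fibre_args_Suc: "z # zs \<in> fibre_args \<sigma> (Suc m) Z \<longleftrightarrow> z \<in> line Z \<and> zs \<in> fibre_args \<sigma> m (\<sigma> Z)"
  unfolding fibre_args_def by (auto simp: All_less_Suc2 funpow_swap1)

lemma fibre_args_eq: "zs \<in> fibre_args \<sigma> m Z \<longleftrightarrow> (\<exists>cs. length cs = m \<and> zs = scaled_lift \<sigma> cs Z)"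
proof (induction m arbitrary: zs Z)
  case 0
  then show ?case by (auto simp: fibre_args_def)
next
  case (Suc m)
  show ?case
  proof (cases zs)
    case Nil
    then show ?thesis by (auto simp: fibre_args_def) (metis length_Suc_conv length_scaled_lift list.size(3) nat.distinct(1))
  next
    case (Cons z ys)
    have "zs \<in> fibre_args \<sigma> (Suc m) Z \<longleftrightarrow> (\<exists>c. z = c *s rep Z) \<and> (\<exists>cs. length cs = m \<and> ys = scaled_lift \<sigma> cs (\<sigma> Z))"
      unfolding Cons fibre_args_Suc Suc.IH by (auto simp: line_rep[of Z])
    also have "\<dots> \<longleftrightarrow> (\<exists>cs. length cs = Suc m \<and> zs = scaled_lift \<sigma> cs Z)"
    proof
      assume "(\<exists>c. z = c *s rep Z) \<and> (\<exists>cs. length cs = m \<and> ys = scaled_lift \<sigma> cs (\<sigma> Z))"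
      then obtain c cs where "z = c *s rep Z" "length cs = m" "ys = scaled_lift \<sigma> cs (\<sigma> Z)" by blast
      then show "\<exists>cs. length cs = Suc m \<and> zs = scaled_lift \<sigma> cs Z" by (intro exI[of _ "c # cs"]) (simp add: Cons)
    next
      assume "\<exists>cs. length cs = Suc m \<and> zs = scaled_lift \<sigma> cs Z"
      then obtain cs where "length cs = Suc m" "zs = scaled_lift \<sigma> cs Z" by blast
      then show "(\<exists>c. z = c *s rep Z) \<and> (\<exists>cs. length cs = m \<and> ys = scaled_lift \<sigma> cs (\<sigma> Z))"
        by (cases cs) (auto simp: Cons)
    qed
    finally show ?thesis .
  qed
qed

lemma fibre_args_append:
  assumes "length ys = m"
  shows "ys @ zs \<in> fibre_args \<sigma> (m + k) Z \<longleftrightarrow> ys \<in> fibre_args \<sigma> m Z \<and> zs \<in> fibre_args \<sigma> k ((\<sigma> ^^ m) Z)"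
proof
  assume "ys @ zs \<in> fibre_args \<sigma> (m + k) Z"
  then obtain cs where cs: "length cs = m + k" "ys @ zs = scaled_lift \<sigma> cs Z" by (auto simp: fibre_args_eq)
  have "ys @ zs = scaled_lift \<sigma> (take m cs) Z @ scaled_lift \<sigma> (drop m cs) ((\<sigma> ^^ m) Z)"
    using cs scaled_lift_append[of \<sigma> "take m cs" "drop m cs" Z] by simp
  then have "ys = scaled_lift \<sigma> (take m cs) Z" "zs = scaled_lift \<sigma> (drop m cs) ((\<sigma> ^^ m) Z)"
    using assms cs by (auto simp: append_eq_append_conv)
  moreover have "length (take m cs) = m" "length (drop m cs) = k" using cs by auto
  ultimately show "ys \<in> fibre_args \<sigma> m Z \<and> zs \<in> fibre_args \<sigma> k ((\<sigma> ^^ m) Z)" unfolding fibre_args_eq by blast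
next
  assume "ys \<in> fibre_args \<sigma> m Z \<and> zs \<in> fibre_args \<sigma> k ((\<sigma> ^^ m) Z)"
  then obtain cs ds where "length cs = m" "ys = scaled_lift \<sigma> cs Z" "length ds = k" "zs = scaled_lift \<sigma> ds ((\<sigma> ^^ m) Z)"
    unfolding fibre_args_eq by blast
  then show "ys @ zs \<in> fibre_args \<sigma> (m + k) Z"
    unfolding fibre_args_eq by (intro exI[of _ "cs @ ds"]) (simp add: scaled_lift_append)
qed

text \<open>The crossed product is treated independently of the quadratic algebra. Neither
  \<open>rep\<close> nor \<open>h \<circ> rep\<close> need be continuous; in the quotients of
  \<open>h_cont\<close> the choice of representative cancels.\<close>

locale twisted =
  fixes K :: "'n::finite proj set" and \<sigma> :: "'n proj \<Rightarrow> 'n proj" and h :: "complex^'n \<Rightarrow> complex"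
  assumes compact_K: "compact K" and image_K: "\<sigma> ` K = K" and inj_K: "inj_on \<sigma> K"
    and cont: "continuous_on K \<sigma>" and cont_inv: "continuous_on K (inv_into K \<sigma>)"
    and h_pos: "\<And>Z. Z \<in> K \<Longrightarrow> \<exists>r>0. h (rep Z) = complex_of_real r"
    and h_cont: "\<And>L L'. continuous_on K (\<lambda>Z. pairing L (rep Z) * cnj (pairing L' (rep Z)) / h (rep Z))"
begin

abbreviation \<tau> where "\<tau> \<equiv> inv_into K \<sigma>"

lemma \<sigma>_in [simp]: "Z \<in> K \<Longrightarrow> \<sigma> Z \<in> K" using image_K by blast
lemma \<tau>_in [simp]: "Z \<in> K \<Longrightarrow> \<tau> Z \<in> K" using image_K by (metis inv_into_into)
lemma \<sigma>\<tau> [simp]: "Z \<in> K \<Longrightarrow> \<sigma> (\<tau> Z) = Z" using image_K by (metis f_inv_into_f)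
lemma \<tau>\<sigma> [simp]: "Z \<in> K \<Longrightarrow> \<tau> (\<sigma> Z) = Z" using inj_K by (simp add: inv_into_f_f)

definition pw :: "int \<Rightarrow> 'n proj \<Rightarrow> 'n proj" where
  "pw m Z = (if 0 \<le> m then (\<sigma> ^^ nat m) Z else (\<tau> ^^ nat (- m)) Z)"

lemma funpow_in [simp]: "Z \<in> K \<Longrightarrow> (\<sigma> ^^ m) Z \<in> K" "Z \<in> K \<Longrightarrow> (\<tau> ^^ m) Z \<in> K"
  by (induction m) auto

lemma pw_in [simp]: "Z \<in> K \<Longrightarrow> pw m Z \<in> K"
  by (simp add: pw_def)

lemma pw_0 [simp]: "pw 0 Z = Z" and pw_nat: "pw (int m) Z = (\<sigma> ^^ m) Z"
  by (simp_all add: pw_def)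

lemma pw_1: "pw 1 Z = \<sigma> Z" and pw_minus_1: "pw (-1) Z = \<tau> Z"
  by (simp_all add: pw_def)

lemma pw_plus_1: "Z \<in> K \<Longrightarrow> pw (m + 1) Z = \<sigma> (pw m Z)"
proof (cases "0 \<le> m")
  case True
  then show ?thesis by (simp add: pw_def nat_add_distrib)
next
  case False
  assume Z: "Z \<in> K"
  have "nat (- m) = Suc (nat (- (m + 1)))" using False by simp
  then have "pw m Z = \<tau> ((\<tau> ^^ nat (- (m + 1))) Z)" using False by (simp add: pw_def)
  moreover have "pw (m + 1) Z = (\<tau> ^^ nat (- (m + 1))) Z" using False by (cases "m = -1") (auto simp: pw_def)
  ultimately show ?thesis using Z by simp
qed

lemma pw_minus_one: "Z \<in> K \<Longrightarrow> pw (m - 1) Z = \<tau> (pw m Z)"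
  using pw_plus_1[of Z "m - 1"] by simp

lemma pw_add: "Z \<in> K \<Longrightarrow> pw k (pw m Z) = pw (m + k) Z"
proof (induction k rule: int_induct[where k = 0])
  case (step1 i)
  then show ?case using pw_plus_1[of "pw m Z" i] pw_plus_1[of Z "m + i"] by (simp add: add.assoc)
next
  case (step2 i)
  then show ?case using pw_minus_one[of "pw m Z" i] pw_minus_one[of Z "m + i"] by (simp add: add_diff_eq)
qed simp

lemma continuous_funpow: "continuous_on K (\<sigma> ^^ m)" "continuous_on K (\<tau> ^^ m)"
proof (induction m)
  case (Suc m)
  show "continuous_on K (\<sigma> ^^ Suc m)"
    using continuous_on_compose2[OF cont Suc(1)] by (simp add: image_subset_iff o_def)
  show "continuous_on K (\<tau> ^^ Suc m)"
    using continuous_on_compose2[OF cont_inv Suc(2)] by (simp add: image_subset_iff o_def)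
qed (simp_all add: continuous_on_id id_def)

lemma continuous_comp_funpow:
  assumes "continuous_on K F"
  shows "continuous_on K (\<lambda>Z. F ((\<sigma> ^^ m) Z))" "continuous_on K (\<lambda>Z. F ((\<tau> ^^ m) Z))"
  by (rule continuous_on_compose2[OF assms continuous_funpow(1)], simp add: image_subset_iff)
    (rule continuous_on_compose2[OF assms continuous_funpow(2)], simp add: image_subset_iff)

definition \<kappa> :: "'n proj \<Rightarrow> real" where "\<kappa> Z = sqrt (Re (h (rep Z)))"

lemma \<kappa>_pos: "Z \<in> K \<Longrightarrow> \<kappa> Z > 0" and h_rep: "Z \<in> K \<Longrightarrow> h (rep Z) = of_real ((\<kappa> Z)\<^sup>2)"
  using h_pos[of Z] by (auto simp: \<kappa>_def simp flip: of_real_power)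

text \<open>The length of the tensor of representatives along the first \<open>m\<close> points of
  the orbit.\<close>

primrec nrm :: "nat \<Rightarrow> 'n proj \<Rightarrow> real" where
  "nrm 0 Z = 1"
| "nrm (Suc m) Z = \<kappa> Z * nrm m (\<sigma> Z)"

lemma nrm_pos: "Z \<in> K \<Longrightarrow> nrm m Z > 0"
  by (induction m arbitrary: Z) (auto simp: \<kappa>_pos)

lemma nrm_add: "nrm (m + k) Z = nrm m Z * nrm k ((\<sigma> ^^ m) Z)"
  by (induction m arbitrary: Z) (auto simp: funpow_swap1)

lemma prod_h_lift: "Z \<in> K \<Longrightarrow> (\<Prod>z\<leftarrow>lift \<sigma> m Z. h z) = of_real ((nrm m Z)\<^sup>2)"
  by (induction m arbitrary: Z) (auto simp: lift_Suc h_rep power_mult_distrib)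

text \<open>Evaluation of \<open>v\<^sub>0 \<otimes> (v\<^sub>1 \<circ> \<sigma>) \<otimes> \<dots>\<close> on unit vectors: its modulus does not depend on the
  representatives, but its phase does.\<close>

primrec phi :: "(complex^'n) list \<Rightarrow> 'n proj \<Rightarrow> complex" where
  "phi [] Z = 1"
| "phi (v # vs) Z = pairing v (rep Z) / \<kappa> Z * phi vs (\<sigma> Z)"

lemma phi_append: "phi (vs @ ws) Z = phi vs Z * phi ws ((\<sigma> ^^ length vs) Z)"
  by (induction vs arbitrary: Z) (auto simp: funpow_swap1)

lemma phi_scaled_lift:
  "Z \<in> K \<Longrightarrow> length vs = m \<Longrightarrow> length cs = m \<Longrightarrow>
    (\<Prod>i<m. pairing (vs ! i) (scaled_lift \<sigma> cs Z ! i)) = prod_list cs * phi vs Z * nrm m Z"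
proof (induction m arbitrary: vs cs Z)
  case (Suc m)
  then obtain v ws c ds where "vs = v # ws" "length ws = m" "cs = c # ds" "length ds = m"
    by (auto simp: length_Suc_conv)
  then show ?case using Suc \<kappa>_pos[of Z] Suc.IH[of "\<sigma> Z" ws ds]
    by (simp add: prod.lessThan_Suc_shift pairing_scale_right field_simps del: prod.lessThan_Suc)
qed simp

lemma ex_phi_nonzero: "Z \<in> K \<Longrightarrow> \<exists>vs. length vs = m \<and> phi vs Z \<noteq> 0"
proof (induction m arbitrary: Z)
  case (Suc m)
  obtain i where "rep Z $ i \<noteq> 0" using rep_nonzero[of Z] by (auto simp: vec_eq_iff)
  moreover obtain vs where "length vs = m" "phi vs (\<sigma> Z) \<noteq> 0" using Suc.IH[of "\<sigma> Z"] Suc.prems by auto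
  ultimately show ?case using \<kappa>_pos[OF Suc.prems]
    by (intro exI[of _ "axis i 1 # vs"]) (simp add: pairing_axis)
qed simp

text \<open>Two words of equal length see the same representatives, so the phases of the two factors
  cancel point by point and only the functions of \<open>h_cont\<close> remain.\<close>

lemma continuous_phi: "length vs = length ws \<Longrightarrow> continuous_on K (\<lambda>Z. phi vs Z * cnj (phi ws Z))"
proof (induction vs ws rule: list_induct2)
  case (Cons v vs w ws)
  have "continuous_on K (\<lambda>Z. pairing v (rep Z) * cnj (pairing w (rep Z)) / h (rep Z) * (phi vs (\<sigma> Z) * cnj (phi ws (\<sigma> Z))))"
    using continuous_comp_funpow(1)[OF Cons.IH, of 1] by (intro continuous_on_mult[OF h_cont]) simp
  then show ?case
    by (rule continuous_on_eq) (simp add: h_rep power2_eq_square)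
qed simp

lemma phi_nonzero_iff: 
  "Z \<in> K \<Longrightarrow> length vs = m \<Longrightarrow> phi vs Z \<noteq> 0 \<longleftrightarrow> (\<forall>i<m. \<exists>z\<in>line ((\<sigma> ^^ i) Z). pairing (vs ! i) z \<noteq> 0)"
proof (induction m arbitrary: vs Z)
  case (Suc m)
  then obtain v ws where vs: "vs = v # ws" "length ws = m" by (auto simp: length_Suc_conv)
  have 1: "(\<exists>z\<in>line Z. pairing v z \<noteq> 0) \<longleftrightarrow> pairing v (rep Z) \<noteq> 0"
    unfolding line_rep[of Z] using vector_smult_lid[of "rep Z"] by (auto simp: pairing_scale_right intro: exI[of _ 1])
  show ?case unfolding vs(1) All_less_Suc2
    using Suc.IH[of "\<sigma> Z" ws] vs \<kappa>_pos[of Z] Suc.prems by (simp add: 1 funpow_swap1)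
qed simp

definition co :: "nat \<Rightarrow> 'n sect \<Rightarrow> 'n proj \<Rightarrow> complex" where
  "co m \<xi> Z = \<xi> Z (lift \<sigma> m Z) / nrm m Z"

text \<open>A change of representatives multiplies \<open>u\<close>, if it is the coefficient of a
  section, and \<open>phi vs\<close> by the same phase. The products with
  \<open>cnj (phi vs)\<close> are thus intrinsic, and as the words vary they test the section in
  local frames.\<close>

definition cosec :: "nat \<Rightarrow> ('n proj \<Rightarrow> complex) \<Rightarrow> bool" where
  "cosec m u \<longleftrightarrow> (\<forall>vs. length vs = m \<longrightarrow> continuous_on K (\<lambda>Z. u Z * cnj (phi vs Z)))"

definition multilin :: "nat \<Rightarrow> 'n sect \<Rightarrow> bool" where
  "multilin m \<xi> \<longleftrightarrow> (\<forall>Z\<in>K. \<forall>cs. length cs = m \<longrightarrow> \<xi> Z (scaled_lift \<sigma> cs Z) = prod_list cs * \<xi> Z (lift \<sigma> m Z))"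

definition zero_off :: "nat \<Rightarrow> 'n sect \<Rightarrow> bool" where
  "zero_off m \<xi> \<longleftrightarrow> (\<forall>Z zs. \<not> (Z \<in> K \<and> zs \<in> fibre_args \<sigma> m Z) \<longrightarrow> \<xi> Z zs = 0)"

text \<open>On the set where \<open>phi vs\<close> is nonzero the frame coefficient is the
  coefficient on unit vectors divided by \<open>phi vs\<close>. Such sets cover \<open>K\<close>, so
  the local conditions in \<open>sections\<close> amount to multilinearity at every point and
  continuity of the tested coefficients.\<close>

lemma sections_iff: "\<xi> \<in> sections K \<sigma> m \<longleftrightarrow> zero_off m \<xi> \<and> multilin m \<xi> \<and> cosec m (co m \<xi>)"
proof -
  let ?U = "\<lambda>vs. {Z \<in> K. phi vs Z \<noteq> 0}"
  have U: "{Z \<in> K. \<forall>i<m. \<exists>z\<in>line ((\<sigma> ^^ i) Z). pairing (vs ! i) z \<noteq> 0} = ?U vs" if "length vs = m" for vs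
    using phi_nonzero_iff that by blast
  let ?frame = "\<lambda>vs f. \<forall>Z\<in>?U vs. \<forall>cs. length cs = m \<longrightarrow>
      \<xi> Z (scaled_lift \<sigma> cs Z) = f Z * (prod_list cs * phi vs Z * nrm m Z)"
  have "\<xi> \<in> sections K \<sigma> m \<longleftrightarrow> zero_off m \<xi> \<and>
      (\<forall>vs. length vs = m \<longrightarrow> (\<exists>f. continuous_on (?U vs) f \<and> (\<forall>Z\<in>?U vs. \<forall>zs\<in>fibre_args \<sigma> m Z.
         \<xi> Z zs = f Z * (\<Prod>i<m. pairing (vs ! i) (zs ! i)))))"
    by (simp add: sections_def zero_off_def Let_def U)
  also have "\<dots> \<longleftrightarrow> zero_off m \<xi> \<and> (\<forall>vs. length vs = m \<longrightarrow> (\<exists>f. continuous_on (?U vs) f \<and> ?frame vs f))"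
  proof -
    have "(\<forall>Z\<in>?U vs. \<forall>zs\<in>fibre_args \<sigma> m Z. \<xi> Z zs = f Z * (\<Prod>i<m. pairing (vs ! i) (zs ! i))) \<longleftrightarrow> ?frame vs f"
      if vs: "length vs = m" for vs f
    proof (intro ball_cong refl)
      fix Z assume "Z \<in> ?U vs"
      then have Z: "Z \<in> K" by simp
      have "(\<forall>zs\<in>fibre_args \<sigma> m Z. P zs) \<longleftrightarrow> (\<forall>cs. length cs = m \<longrightarrow> P (scaled_lift \<sigma> cs Z))" for P
        unfolding fibre_args_eq Ball_def by blast
      then show "(\<forall>zs\<in>fibre_args \<sigma> m Z. \<xi> Z zs = f Z * (\<Prod>i<m. pairing (vs ! i) (zs ! i))) \<longleftrightarrow>
        (\<forall>cs. length cs = m \<longrightarrow> \<xi> Z (scaled_lift \<sigma> cs Z) = f Z * (prod_list cs * phi vs Z * nrm m Z))"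
        using phi_scaled_lift[OF Z vs] by simp
    qed
    then show ?thesis by simp
  qed
  also have "\<dots> \<longleftrightarrow> zero_off m \<xi> \<and> multilin m \<xi> \<and> cosec m (co m \<xi>)"
  proof (intro conj_cong refl iffI)
    assume F: "\<forall>vs. length vs = m \<longrightarrow> (\<exists>f. continuous_on (?U vs) f \<and> ?frame vs f)"
    have co_f: "co m \<xi> Z = f Z * phi vs Z" if "?frame vs f" "Z \<in> ?U vs" for Z vs f
      using that nrm_pos[of Z m] unfolding co_def lift_eq_scaled by (simp add: prod_list_replicate)
    have "multilin m \<xi>" unfolding multilin_def
    proof (intro ballI allI impI)
      fix Z and cs :: "complex list" assume Z: "Z \<in> K" and cs: "length cs = m"
      obtain vs where vs: "length vs = m" "phi vs Z \<noteq> 0" using ex_phi_nonzero[OF Z] by blast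
      then obtain f where f: "?frame vs f" using F by blast
      have A: "\<xi> Z (scaled_lift \<sigma> ds Z) = f Z * (prod_list ds * phi vs Z * nrm m Z)" if "length ds = m" for ds
        using f Z vs(2) that by blast
      show "\<xi> Z (scaled_lift \<sigma> cs Z) = prod_list cs * \<xi> Z (lift \<sigma> m Z)"
        unfolding lift_eq_scaled A[OF cs] A[OF length_replicate] by (simp add: prod_list_replicate)
    qed
    moreover have "cosec m (co m \<xi>)" unfolding cosec_def
    proof (intro allI impI continuous_on_local)
      fix ws :: "(complex^'n) list" and Z assume ws: "length ws = m" and Z: "Z \<in> K"
      obtain vs where vs: "length vs = m" "phi vs Z \<noteq> 0" using ex_phi_nonzero[OF Z] by blast
      then obtain f where f: "continuous_on (?U vs) f" "?frame vs f" using F by blast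
      have "continuous_on (?U vs) (\<lambda>Z. f Z * (phi vs Z * cnj (phi ws Z)))"
        using vs ws by (intro continuous_on_mult[OF f(1)] continuous_on_subset[OF continuous_phi[of vs ws]]) auto
      then have "continuous_on (?U vs) (\<lambda>Z. co m \<xi> Z * cnj (phi ws Z))"
        by (rule continuous_on_eq) (use co_f[OF f(2)] in simp)
      then show "\<exists>g :: 'n proj \<Rightarrow> complex. continuous_on K g \<and> g Z \<noteq> 0 \<and> continuous_on {y \<in> K. g y \<noteq> 0} (\<lambda>Z. co m \<xi> Z * cnj (phi ws Z))"
        using vs continuous_phi[of vs vs] by (intro exI[of _ "\<lambda>Z. phi vs Z * cnj (phi vs Z)"]) simp
    qed
    ultimately show "multilin m \<xi> \<and> cosec m (co m \<xi>)" ..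
  next
    assume mc: "multilin m \<xi> \<and> cosec m (co m \<xi>)"
    show "\<forall>vs. length vs = m \<longrightarrow> (\<exists>f. continuous_on (?U vs) f \<and> ?frame vs f)"
    proof (intro allI impI exI conjI)
      fix vs :: "(complex^'n) list" assume vs: "length vs = m"
      \<comment> \<open>Numerator and denominator of the frame coefficient are both multiplied by
        \<open>cnj (phi vs Z)\<close>, which makes each of them continuous.\<close>
      let ?f = "\<lambda>Z. (co m \<xi> Z * cnj (phi vs Z)) / (phi vs Z * cnj (phi vs Z))"
      show "continuous_on (?U vs) ?f"
        using mc vs continuous_phi[of vs vs] unfolding cosec_def
        by (intro continuous_on_divide continuous_on_subset[of K _ "?U vs"]) auto
      show "?frame vs ?f"
      proof (intro ballI allI impI)
        fix Z and cs :: "complex list" assume Z: "Z \<in> ?U vs" and cs: "length cs = m"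
        then have "\<xi> Z (scaled_lift \<sigma> cs Z) = prod_list cs * \<xi> Z (lift \<sigma> m Z)" using mc by (simp add: multilin_def)
        then show "\<xi> Z (scaled_lift \<sigma> cs Z) = ?f Z * (prod_list cs * phi vs Z * nrm m Z)"
          using Z nrm_pos[of Z m] by (simp add: co_def)
      qed
    qed
  qed
  finally show ?thesis .
qed

end

section \<open>Continuity of coefficients in arbitrary integer degree\<close>

context twisted
begin

text \<open>Functions \<open>u\<close> on \<open>K\<close> that represent a continuous section of degree \<open>m \<in> \<int>\<close>. Testing along paths that
  first go back \<open>N\<close> steps makes positive and negative degrees alike, and composition of sections becomes a
  product of matrices.\<close>

definition path_test :: "int \<Rightarrow> nat \<Rightarrow> ('n proj \<Rightarrow> complex) \<Rightarrow> bool" where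
  "path_test m N u \<longleftrightarrow> (\<forall>vs ws. length vs = N \<longrightarrow> int (length ws) = int N + m \<longrightarrow>
     continuous_on K (\<lambda>X. phi vs X * u ((\<sigma> ^^ N) X) * cnj (phi ws X)))"

lemma \<sigma>_pow_\<tau>_pow: "Z \<in> K \<Longrightarrow> (\<sigma> ^^ q) ((\<tau> ^^ q) Z) = Z"
  by (induction q) (simp_all add: funpow_swap1[of \<sigma>])

text \<open>The first \<open>d\<close> vectors of the two words form a continuous factor with
  cancelling phases; the rest is the given test at \<open>(\<sigma> ^^ d) X\<close>.\<close>

lemma path_test_up:
  assumes T: "path_test m N u" and le: "0 \<le> int N + m"
  shows "path_test m (d + N) u"
  unfolding path_test_def
proof (intro allI impI)
  fix vs ws :: "(complex^'n) list" assume vs: "length vs = d + N" and ws: "int (length ws) = int (d + N) + m"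
  have lw: "d \<le> length ws" using ws le by linarith
  have 1: "continuous_on K (\<lambda>X. phi (take d vs) X * cnj (phi (take d ws) X))"
    using vs lw by (intro continuous_phi) simp
  have "continuous_on K (\<lambda>X. phi (drop d vs) X * u ((\<sigma> ^^ N) X) * cnj (phi (drop d ws) X))"
    by (rule T[unfolded path_test_def, rule_format]) (use vs ws lw in auto)
  note c = continuous_on_mult[OF 1 continuous_comp_funpow(1)[OF this, of d]]
  have e: "phi xs X = phi (take d xs) X * phi (drop d xs) ((\<sigma> ^^ d) X)" if "d \<le> length xs" for xs X
  proof -
    have "phi xs X = phi (take d xs @ drop d xs) X" by simp
    also have "\<dots> = phi (take d xs) X * phi (drop d xs) ((\<sigma> ^^ d) X)"
      by (simp only: phi_append length_take min_absorb2[OF that])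
    finally show ?thesis .
  qed
  have f: "(\<sigma> ^^ (d + N)) X = (\<sigma> ^^ N) ((\<sigma> ^^ d) X)" for X by (simp add: add.commute[of d N] funpow_add)
  have dv: "d \<le> length vs" using vs by simp
  show "continuous_on K (\<lambda>X. phi vs X * u ((\<sigma> ^^ (d + N)) X) * cnj (phi ws X))"
    unfolding e[OF dv] e[OF lw] f by (rule continuous_on_eq[OF c]) (simp add: mult_ac)
qed

text \<open>Prepending the same word \<open>us\<close> to both words only adds the factor |phi
  us|^2, evaluated \<open>d\<close> steps back. It can be chosen nonzero at the point considered and
  is then divided out.\<close>

lemma path_test_down:
  assumes T: "path_test m (d + N) u"
  shows "path_test m N u"
  unfolding path_test_def
proof (intro allI impI continuous_on_multiplier)
  fix vs ws :: "(complex^'n) list" and Y assume vs: "length vs = N" and ws: "int (length ws) = int N + m" and Y: "Y \<in> K"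
  obtain us where us: "length us = d" "phi us ((\<tau> ^^ d) Y) \<noteq> 0" using ex_phi_nonzero[of "(\<tau> ^^ d) Y"] Y by auto
  note st = \<sigma>_pow_\<tau>_pow
  let ?G = "\<lambda>X. phi us X * cnj (phi us X)"
  let ?F = "\<lambda>X. phi vs X * u ((\<sigma> ^^ N) X) * cnj (phi ws X)"
  have "continuous_on K (\<lambda>X. phi (us @ vs) X * u ((\<sigma> ^^ (d + N)) X) * cnj (phi (us @ ws) X))"
    using T us vs ws unfolding path_test_def by simp
  from continuous_comp_funpow(2)[OF this, of d]
  have "continuous_on K (\<lambda>X. ?F X * ?G ((\<tau> ^^ d) X))"
    by (rule continuous_on_eq) (simp add: phi_append us st funpow_add add.commute[of d N] mult_ac)
  moreover have "continuous_on K (\<lambda>X. ?G ((\<tau> ^^ d) X))"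
    by (intro continuous_comp_funpow(2) continuous_phi refl)
  ultimately show "\<exists>g. continuous_on K g \<and> g Y \<noteq> 0 \<and> continuous_on K (\<lambda>X. ?F X * g X)"
    using us by (intro exI[of _ "\<lambda>X. ?G ((\<tau> ^^ d) X)"]) simp
qed

text \<open>The number of backward steps is the least one for which the forward word has nonnegative
  length; \<open>csec_iff\<close> permits any larger number.\<close>

definition csec :: "int \<Rightarrow> ('n proj \<Rightarrow> complex) \<Rightarrow> bool" where
  "csec m u \<longleftrightarrow> path_test m (nat (- m)) u"

lemma csec_iff: "nat (- m) \<le> N \<Longrightarrow> csec m u \<longleftrightarrow> path_test m N u"
  unfolding csec_def using path_test_up[of m "nat (- m)" u "N - nat (- m)"] path_test_down[of m "N - nat (- m)" "nat (- m)" u]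
  by auto

text \<open>A word \<open>us\<close> is inserted at the intermediate point, as the second word in
  the test of \<open>u\<close> and the first in that of \<open>v\<close>. The product of the two
  tests is the desired one times |phi us|^2.\<close>

lemma csec_mult:
  assumes u: "csec m u" and v: "csec k v"
  shows "csec (m + k) (\<lambda>X. u X * v (pw m X))"
proof -
  \<comment> \<open>Large enough for \<open>N\<close>, \<open>N + m\<close> and
    \<open>N + m + k\<close> to be nonnegative, so that all words have a length.\<close>
  define N where "N = nat (\<bar>m\<bar> + \<bar>k\<bar>)"
  define M where "M = nat (int N + m)"
  have M: "int M = int N + m" by (simp add: M_def N_def)
  have Tu: "path_test m N u" using u csec_iff[of m N u] by (simp add: N_def)
  have Tv: "path_test k M v" using v csec_iff[of k M v] M by (simp add: N_def nat_le_iff)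
  have pwM: "pw m ((\<sigma> ^^ N) X) = (\<sigma> ^^ M) X" if "X \<in> K" for X
    using pw_add[OF that, of m "int N"] M by (simp add: pw_nat[symmetric])
  have "path_test (m + k) N (\<lambda>X. u X * v (pw m X))"
    unfolding path_test_def
  proof (intro allI impI continuous_on_multiplier)
    fix vs ws :: "(complex^'n) list" and Y assume vs: "length vs = N" and ws: "int (length ws) = int N + (m + k)" and Y: "Y \<in> K"
    obtain us where us: "length us = M" "phi us Y \<noteq> 0" using ex_phi_nonzero[OF Y] by blast
    have 1: "continuous_on K (\<lambda>X. phi vs X * u ((\<sigma> ^^ N) X) * cnj (phi us X))"
      using Tu vs us M unfolding path_test_def by simp
    have 2: "continuous_on K (\<lambda>X. phi us X * v ((\<sigma> ^^ M) X) * cnj (phi ws X))"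
      using Tv ws us M unfolding path_test_def by simp
    have "continuous_on K (\<lambda>X. (phi vs X * (u ((\<sigma> ^^ N) X) * v (pw m ((\<sigma> ^^ N) X))) * cnj (phi ws X)) * (phi us X * cnj (phi us X)))"
      by (rule continuous_on_eq[OF continuous_on_mult[OF 1 2]]) (simp add: pwM mult_ac)
    then show "\<exists>g. continuous_on K g \<and> g Y \<noteq> 0 \<and>
        continuous_on K (\<lambda>X. (phi vs X * (u ((\<sigma> ^^ N) X) * v (pw m ((\<sigma> ^^ N) X))) * cnj (phi ws X)) * g X)"
      using us continuous_phi[of us us] by (intro exI[of _ "\<lambda>X. phi us X * cnj (phi us X)"]) simp
  qed
  then show ?thesis using csec_iff[of "m + k" N] by (simp add: N_def nat_le_iff)
qed

text \<open>The coefficient of \<open>\<xi>\<close>, placed in degree \<open>m\<close>, along the arrow \<open>Z \<rightarrow> \<sigma>\<^sup>m Z\<close>. In negative degrees the components are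
  conjugate linear coordinates at the end point of the arrow.\<close>

definition cf1 :: "int \<Rightarrow> 'n sect \<Rightarrow> 'n proj \<Rightarrow> complex" where
  "cf1 m \<xi> Z = (if 0 \<le> m then co (nat m) \<xi> Z else cnj (co (nat (- m)) \<xi> (pw m Z)))"

text \<open>In negative degree the shortest backward path leaves an empty forward word, and the test
  is the complex conjugate of the one in \<open>cosec\<close>.\<close>

lemma csec_cf1: "csec m (cf1 m \<xi>) \<longleftrightarrow> cosec (nat \<bar>m\<bar>) (co (nat \<bar>m\<bar>) \<xi>)"
proof (cases "0 \<le> m")
  case True
  then have e: "cf1 m \<xi> = co (nat m) \<xi>" "nat \<bar>m\<bar> = nat m" by (auto simp: cf1_def)
  have l: "int (length ws) = m \<longleftrightarrow> length ws = nat m" for ws :: "(complex^'n) list" using True by auto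
  show ?thesis using True unfolding csec_def path_test_def cosec_def e by (simp add: l)
next
  case False
  let ?N = "nat (- m)"
  have pwN: "pw m ((\<sigma> ^^ ?N) X) = X" if "X \<in> K" for X
    using pw_add[OF that, of m "- m"] False by (simp add: pw_def)
  have "csec m (cf1 m \<xi>) \<longleftrightarrow> (\<forall>vs. length vs = ?N \<longrightarrow> continuous_on K (\<lambda>X. phi vs X * cf1 m \<xi> ((\<sigma> ^^ ?N) X)))"
    using False by (simp add: csec_def path_test_def)
  also have "\<dots> \<longleftrightarrow> (\<forall>vs. length vs = ?N \<longrightarrow> continuous_on K (\<lambda>X. phi vs X * cnj (co ?N \<xi> X)))"
    using False by (intro all_cong continuous_on_cong refl) (simp add: cf1_def pwN)
  also have "\<dots> \<longleftrightarrow> (\<forall>vs. length vs = ?N \<longrightarrow> continuous_on K (\<lambda>X. cnj (co ?N \<xi> X * cnj (phi vs X))))"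
    by (simp add: mult.commute)
  also have "\<dots> \<longleftrightarrow> cosec ?N (co ?N \<xi>)" unfolding cosec_def
  proof (intro all_cong)
    fix vs
    show "continuous_on K (\<lambda>X. cnj (co ?N \<xi> X * cnj (phi vs X))) \<longleftrightarrow> continuous_on K (\<lambda>X. co ?N \<xi> X * cnj (phi vs X))"
      using continuous_on_cnj[of K "\<lambda>X. co ?N \<xi> X * cnj (phi vs X)"]
        continuous_on_cnj[of K "\<lambda>X. cnj (co ?N \<xi> X * cnj (phi vs X))"] by auto
  qed
  finally show ?thesis using False by simp
qed

lemma sections_csec: "\<xi> \<in> sections K \<sigma> (nat \<bar>m\<bar>) \<longleftrightarrow>
    zero_off (nat \<bar>m\<bar>) \<xi> \<and> multilin (nat \<bar>m\<bar>) \<xi> \<and> csec m (cf1 m \<xi>)"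
  by (simp add: sections_iff csec_cf1)

section \<open>Products of monomials in coordinates\<close>

lemma herm_eq: "Z \<in> K \<Longrightarrow> herm \<sigma> h m \<xi> \<eta> Z = co m \<xi> Z * cnj (co m \<eta> Z)"
  by (simp add: herm_def prod_h_lift co_def power2_eq_square)

lemma co_tensor: "Z \<in> K \<Longrightarrow> co (m + k) (sect_tensor \<sigma> m \<xi> \<eta>) Z = co m \<xi> Z * co k \<eta> ((\<sigma> ^^ m) Z)"
  by (simp add: co_def sect_tensor_def lift_add nrm_add)

lemma co_contract_right:
  "Z \<in> K \<Longrightarrow> co p (contract_right \<sigma> h p q \<xi> \<eta>) Z = co (p + q) \<xi> Z * cnj (co q \<eta> ((\<sigma> ^^ p) Z))"
  by (simp add: co_def contract_right_def herm_eq lift_add nrm_add)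

lemma co_contract_left:
  "Y \<in> K \<Longrightarrow> Z = (\<sigma> ^^ q) Y \<Longrightarrow> co p (contract_left K \<sigma> h q \<eta> \<xi>) Z = co (q + p) \<xi> Y * cnj (co q \<eta> Y)"
  using pw_add[of Y "- int q" "int q"]
  by (cases "q = 0") (auto simp: co_def contract_left_def herm_eq lift_add nrm_add pw_def)

lemma \<sigma>_pow_pw: "Z \<in> K \<Longrightarrow> (\<sigma> ^^ n) (pw m Z) = pw (m + int n) Z"
  using pw_add[of Z "int n" m] by (simp add: pw_nat)

lemma cf1_mono_mult:
  assumes Z: "Z \<in> K"
  shows "cf1 (m + k) (mono_mult K \<sigma> h m \<xi> k \<eta>) Z = cf1 m \<xi> Z * cf1 k \<eta> (pw m Z)"
proof -
  consider (pp) "0 \<le> m" "0 \<le> k" | (nn) "m < 0" "k < 0" | (r1) "0 \<le> m" "k < 0" "- k \<le> m"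
    | (r2) "0 \<le> m" "k < 0" "\<not> - k \<le> m" | (l1) "m < 0" "0 \<le> k" "- m \<le> k" | (l2) "m < 0" "0 \<le> k" "\<not> - m \<le> k"
    by linarith
  then show ?thesis
  proof cases
    case pp
    then show ?thesis using Z co_tensor[OF Z, of "nat m" "nat k" \<xi> \<eta>]
      by (simp add: mono_mult_def cf1_def nat_add_distrib pw_def)
  next
    case nn
    have Y: "pw (m + k) Z \<in> K" using Z by simp
    have "nat (- (m + k)) = nat (- k) + nat (- m)" using nn by simp
    then show ?thesis using nn Z co_tensor[OF Y, of "nat (- k)" "nat (- m)" \<eta> \<xi>]
      by (simp add: mono_mult_def cf1_def \<sigma>_pow_pw pw_add mult.commute)
  next
    case r1
    have e: "nat m = nat (m + k) + nat (- k)" using r1 by simp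
    have "(\<sigma> ^^ nat (m + k)) Z = pw (m + k) Z" using r1 by (simp add: pw_def)
    then show ?thesis using r1 Z co_contract_right[OF Z, of "nat (m + k)" "nat (- k)" \<xi> \<eta>]
      by (simp add: mono_mult_def cf1_def pw_add e[symmetric])
  next
    case r2
    have Y: "pw (m + k) Z \<in> K" using Z by simp
    have e: "nat (- k) = nat (- (m + k)) + nat m" using r2 by simp
    then show ?thesis using r2 Z co_contract_right[OF Y, of "nat (- (m + k))" "nat m" \<eta> \<xi>]
      by (simp add: mono_mult_def cf1_def pw_add \<sigma>_pow_pw e[symmetric])
  next
    case l1
    have Y: "pw m Z \<in> K" using Z by simp
    have e: "nat k = nat (- m) + nat (m + k)" using l1 by simp
    have z: "Z = (\<sigma> ^^ nat (- m)) (pw m Z)" using l1 Z by (simp add: \<sigma>_pow_pw)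
    show ?thesis using l1 Z co_contract_left[OF Y z, of "nat (m + k)" \<xi> \<eta>]
      by (simp add: mono_mult_def cf1_def e[symmetric])
  next
    case l2
    have Y: "pw m Z \<in> K" using Z by simp
    have e: "nat k + nat (- m - k) = nat (- m)" using l2 by simp
    have z: "pw (m + k) Z = (\<sigma> ^^ nat k) (pw m Z)" using l2 Z by (simp add: \<sigma>_pow_pw)
    show ?thesis using l2 Z co_contract_left[OF Y z, of "nat (- (m + k))" \<eta> \<xi>]
      by (simp add: mono_mult_def cf1_def e)
  qed
qed

lemma tensor_zero_off:
  assumes "zero_off m \<xi>" "zero_off k \<eta>" shows "zero_off (m + k) (sect_tensor \<sigma> m \<xi> \<eta>)"
  unfolding zero_off_def
proof (intro allI impI)
  fix Z zs assume n: "\<not> (Z \<in> K \<and> zs \<in> fibre_args \<sigma> (m + k) Z)"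
  show "sect_tensor \<sigma> m \<xi> \<eta> Z zs = 0"
  proof (rule ccontr)
    assume "sect_tensor \<sigma> m \<xi> \<eta> Z zs \<noteq> 0"
    then have "Z \<in> K" and t: "take m zs \<in> fibre_args \<sigma> m Z" and d: "drop m zs \<in> fibre_args \<sigma> k ((\<sigma> ^^ m) Z)"
      using assms by (auto simp: sect_tensor_def zero_off_def)
    moreover have "length (take m zs) = m" using t by (simp add: fibre_args_def)
    ultimately show False using n fibre_args_append[of "take m zs" m "drop m zs" \<sigma> k Z] by simp
  qed
qed

lemma contract_right_zero_off:
  assumes "zero_off (p + q) \<xi>" shows "zero_off p (contract_right \<sigma> h p q \<xi> \<eta>)"
  unfolding zero_off_def
proof (intro allI impI)
  fix Z zs assume n: "\<not> (Z \<in> K \<and> zs \<in> fibre_args \<sigma> p Z)"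
  let ?ys = "lift \<sigma> q ((\<sigma> ^^ p) Z)"
  have "\<not> (Z \<in> K \<and> zs @ ?ys \<in> fibre_args \<sigma> (p + q) Z)"
  proof
    assume a: "Z \<in> K \<and> zs @ ?ys \<in> fibre_args \<sigma> (p + q) Z"
    then have "length zs = p" by (simp add: fibre_args_def)
    then show False using a n fibre_args_append by blast
  qed
  then have "\<xi> Z (zs @ ?ys) = 0" using assms by (auto simp: zero_off_def)
  then show "contract_right \<sigma> h p q \<xi> \<eta> Z zs = 0" by (simp add: contract_right_def herm_def)
qed

lemma contract_left_zero_off:
  assumes "zero_off (q + p) \<xi>" shows "zero_off p (contract_left K \<sigma> h q \<eta> \<xi>)"
  unfolding zero_off_def
proof (intro allI impI)
  fix Z zs assume n: "\<not> (Z \<in> K \<and> zs \<in> fibre_args \<sigma> p Z)"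
  show "contract_left K \<sigma> h q \<eta> \<xi> Z zs = 0"
  proof (cases "Z \<in> K")
    case True
    let ?Y = "(\<tau> ^^ q) Z"
    have "(\<sigma> ^^ q) ?Y = Z" by (rule \<sigma>_pow_\<tau>_pow[OF True])
    then have "lift \<sigma> q ?Y @ zs \<notin> fibre_args \<sigma> (q + p) ?Y" using n True fibre_args_append[of "lift \<sigma> q ?Y" q zs \<sigma> p ?Y] by simp
    then have "\<xi> ?Y (lift \<sigma> q ?Y @ zs) = 0" using assms by (auto simp: zero_off_def)
    then show ?thesis by (simp add: contract_left_def herm_def)
  qed (simp add: contract_left_def)
qed

lemma tensor_multilin:
  assumes "multilin m \<xi>" "multilin k \<eta>" shows "multilin (m + k) (sect_tensor \<sigma> m \<xi> \<eta>)"
  unfolding multilin_def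
proof (intro ballI allI impI)
  fix Z and cs :: "complex list" assume Z: "Z \<in> K" and cs: "length cs = m + k"
  have e: "scaled_lift \<sigma> cs Z = scaled_lift \<sigma> (take m cs) Z @ scaled_lift \<sigma> (drop m cs) ((\<sigma> ^^ m) Z)"
    using cs scaled_lift_append[of \<sigma> "take m cs" "drop m cs" Z] by simp
  have p: "prod_list cs = prod_list (take m cs) * prod_list (drop m cs)"
    by (metis append_take_drop_id prod_list.append)
  have "\<xi> Z (scaled_lift \<sigma> (take m cs) Z) = prod_list (take m cs) * \<xi> Z (lift \<sigma> m Z)"
    "\<eta> ((\<sigma> ^^ m) Z) (scaled_lift \<sigma> (drop m cs) ((\<sigma> ^^ m) Z)) = prod_list (drop m cs) * \<eta> ((\<sigma> ^^ m) Z) (lift \<sigma> k ((\<sigma> ^^ m) Z))"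
    using assms Z cs unfolding multilin_def by auto
  then show "sect_tensor \<sigma> m \<xi> \<eta> Z (scaled_lift \<sigma> cs Z) = prod_list cs * sect_tensor \<sigma> m \<xi> \<eta> Z (lift \<sigma> (m + k) Z)"
    using cs by (simp add: sect_tensor_def lift_add e p)
qed

lemma contract_right_multilin:
  assumes "multilin (p + q) \<xi>" shows "multilin p (contract_right \<sigma> h p q \<xi> \<eta>)"
  unfolding multilin_def
proof (intro ballI allI impI)
  fix Z and cs :: "complex list" assume Z: "Z \<in> K" and cs: "length cs = p"
  have "\<xi> Z (scaled_lift \<sigma> (ds @ replicate q 1) Z) = prod_list ds * \<xi> Z (lift \<sigma> (p + q) Z)" if "length ds = p" for ds
    using assms Z that unfolding multilin_def by (simp add: prod_list_replicate)
  from this[OF cs] this[of "replicate p 1"]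
  show "contract_right \<sigma> h p q \<xi> \<eta> Z (scaled_lift \<sigma> cs Z) = prod_list cs * contract_right \<sigma> h p q \<xi> \<eta> Z (lift \<sigma> p Z)"
    using cs by (simp add: contract_right_def herm_def scaled_lift_append lift_eq_scaled[symmetric] lift_add)
qed

lemma contract_left_multilin:
  assumes "multilin (q + p) \<xi>" shows "multilin p (contract_left K \<sigma> h q \<eta> \<xi>)"
  unfolding multilin_def
proof (intro ballI allI impI)
  fix Z and cs :: "complex list" assume Z: "Z \<in> K" and cs: "length cs = p"
  let ?Y = "(\<tau> ^^ q) Z"
  have Y: "?Y \<in> K" "(\<sigma> ^^ q) ?Y = Z" using Z by (simp_all add: \<sigma>_pow_\<tau>_pow)
  have "\<xi> ?Y (scaled_lift \<sigma> (replicate q 1 @ cs) ?Y) = prod_list cs * \<xi> ?Y (lift \<sigma> (q + p) ?Y)"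
    using assms Y cs unfolding multilin_def by (simp add: prod_list_replicate)
  then show "contract_left K \<sigma> h q \<eta> \<xi> Z (scaled_lift \<sigma> cs Z) = prod_list cs * contract_left K \<sigma> h q \<eta> \<xi> Z (lift \<sigma> p Z)"
    using cs Z Y by (simp add: contract_left_def herm_def scaled_lift_append lift_eq_scaled[symmetric] lift_add)
qed

text \<open>Continuity is uniform in the degrees, by \<open>csec_mult\<close>; only supports and
  multilinearity depend on which contraction occurs.\<close>

lemma mono_mult_sections:
  assumes \<xi>: "\<xi> \<in> sections K \<sigma> (nat \<bar>m\<bar>)" and \<eta>: "\<eta> \<in> sections K \<sigma> (nat \<bar>k\<bar>)"
  shows "mono_mult K \<sigma> h m \<xi> k \<eta> \<in> sections K \<sigma> (nat \<bar>m + k\<bar>)"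
proof -
  have A: "zero_off (nat \<bar>m\<bar>) \<xi>" "multilin (nat \<bar>m\<bar>) \<xi>" "csec m (cf1 m \<xi>)"
    "zero_off (nat \<bar>k\<bar>) \<eta>" "multilin (nat \<bar>k\<bar>) \<eta>" "csec k (cf1 k \<eta>)"
    using \<xi> \<eta> sections_csec by blast+
  have "csec (m + k) (cf1 (m + k) (mono_mult K \<sigma> h m \<xi> k \<eta>))"
    using csec_mult[OF A(3,6)] cf1_mono_mult unfolding csec_def path_test_def
    by (simp cong: continuous_on_cong_simp)
  moreover have "zero_off (nat \<bar>m + k\<bar>) (mono_mult K \<sigma> h m \<xi> k \<eta>) \<and> multilin (nat \<bar>m + k\<bar>) (mono_mult K \<sigma> h m \<xi> k \<eta>)"
  proof -
    consider (pp) "0 \<le> m" "0 \<le> k" | (nn) "m < 0" "k < 0" | (r1) "0 \<le> m" "k < 0" "- k \<le> m"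
      | (r2) "0 \<le> m" "k < 0" "\<not> - k \<le> m" | (l1) "m < 0" "0 \<le> k" "- m \<le> k" | (l2) "m < 0" "0 \<le> k" "\<not> - m \<le> k"
      by linarith
    then show ?thesis
    proof cases
      case pp
      then have "nat \<bar>m\<bar> = nat m" "nat \<bar>k\<bar> = nat k" "nat \<bar>m + k\<bar> = nat m + nat k" by auto
      then show ?thesis using pp A tensor_zero_off tensor_multilin by (simp add: mono_mult_def)
    next
      case nn
      then have "nat \<bar>m\<bar> = nat (- m)" "nat \<bar>k\<bar> = nat (- k)" "nat \<bar>m + k\<bar> = nat (- k) + nat (- m)" by auto
      then show ?thesis using nn A tensor_zero_off tensor_multilin by (simp add: mono_mult_def)
    next
      case r1
      then have "nat \<bar>m\<bar> = nat (m + k) + nat (- k)" "nat \<bar>m + k\<bar> = nat (m + k)" by auto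
      then show ?thesis using r1 A contract_right_zero_off contract_right_multilin by (simp add: mono_mult_def)
    next
      case r2
      then have "nat \<bar>k\<bar> = nat (- (m + k)) + nat m" "nat \<bar>m + k\<bar> = nat (- (m + k))" by auto
      then show ?thesis using r2 A contract_right_zero_off contract_right_multilin by (simp add: mono_mult_def)
    next
      case l1
      then have "nat \<bar>k\<bar> = nat (- m) + nat (m + k)" "nat \<bar>m + k\<bar> = nat (m + k)" by auto
      then show ?thesis using l1 A contract_left_zero_off contract_left_multilin by (simp add: mono_mult_def)
    next
      case l2
      then have "nat \<bar>m\<bar> = nat k + nat (- (m + k))" "nat \<bar>m + k\<bar> = nat (- (m + k))" by auto
      then show ?thesis using l2 A contract_left_zero_off contract_left_multilin by (simp add: mono_mult_def)
    qed
  qed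
  ultimately show ?thesis using sections_csec by blast
qed

end

section \<open>The algebra of monomials\<close>

context twisted
begin

abbreviation D where "D \<equiv> monomial_algebra K \<sigma> h"

definition supp :: "(int \<Rightarrow> 'n sect) \<Rightarrow> int set" where "supp a = {m. a m \<noteq> (\<lambda>Z zs. 0)}"

lemma carrier_D: "a \<in> carrier D \<longleftrightarrow> finite (supp a) \<and> (\<forall>m. a m \<in> sections K \<sigma> (nat \<bar>m\<bar>))"
  by (simp add: monomial_algebra_def supp_def)

lemma fin_D: "a \<in> carrier D \<Longrightarrow> finite (supp a)" and sect_D: "a \<in> carrier D \<Longrightarrow> a m \<in> sections K \<sigma> (nat \<bar>m\<bar>)"
  using carrier_D by blast+

lemma mult_D: "(a \<otimes>\<^bsub>D\<^esub> b) k = (\<lambda>Z zs. \<Sum>m\<in>supp a. mono_mult K \<sigma> h m (a m) (k - m) (b (k - m)) Z zs)"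
  by (simp add: monomial_algebra_def supp_def)

lemma add_D: "(a \<oplus>\<^bsub>D\<^esub> b) m = (\<lambda>Z zs. a m Z zs + b m Z zs)"
  and smult_D: "(c \<odot>\<^bsub>D\<^esub> a) m = (\<lambda>Z zs. (if 0 \<le> m then c else cnj c) * a m Z zs)"
  and zero_D: "\<zero>\<^bsub>D\<^esub> m = (\<lambda>Z zs. 0)"
  and one_D: "\<one>\<^bsub>D\<^esub> = monomial 0 (\<lambda>Z zs. if Z \<in> K \<and> zs = [] then 1 else 0)"
  and star_D: "star D a m = (\<lambda>Z zs. if m = 0 then cnj (a 0 Z zs) else a (- m) Z zs)"
  by (simp_all add: monomial_algebra_def)

lemma sections_zero: "(\<lambda>Z zs. 0) \<in> sections K \<sigma> m"
  by (simp add: sections_iff zero_off_def multilin_def cosec_def co_def)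

lemma sections_add: "\<xi> \<in> sections K \<sigma> m \<Longrightarrow> \<eta> \<in> sections K \<sigma> m \<Longrightarrow> (\<lambda>Z zs. \<xi> Z zs + \<eta> Z zs) \<in> sections K \<sigma> m"
  unfolding sections_iff
proof (elim conjE, intro conjI)
  assume z: "zero_off m \<xi>" "zero_off m \<eta>" and l: "multilin m \<xi>" "multilin m \<eta>"
    and c: "cosec m (co m \<xi>)" "cosec m (co m \<eta>)"
  show "zero_off m (\<lambda>Z zs. \<xi> Z zs + \<eta> Z zs)" using z by (simp add: zero_off_def)
  show "multilin m (\<lambda>Z zs. \<xi> Z zs + \<eta> Z zs)" using l by (simp add: multilin_def distrib_left)
  have "continuous_on K (\<lambda>Z. co m \<xi> Z * cnj (phi vs Z) + co m \<eta> Z * cnj (phi vs Z))" if "length vs = m" for vs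
    using c that by (intro continuous_on_add) (auto simp: cosec_def)
  then show "cosec m (co m (\<lambda>Z zs. \<xi> Z zs + \<eta> Z zs))"
    by (simp add: cosec_def co_def add_divide_distrib distrib_right)
qed

lemma sections_scale: "\<xi> \<in> sections K \<sigma> m \<Longrightarrow> (\<lambda>Z zs. c * \<xi> Z zs) \<in> sections K \<sigma> m"
  unfolding sections_iff
proof (elim conjE, intro conjI)
  assume z: "zero_off m \<xi>" and l: "multilin m \<xi>" and co: "cosec m (co m \<xi>)"
  show "zero_off m (\<lambda>Z zs. c * \<xi> Z zs)" using z by (simp add: zero_off_def)
  show "multilin m (\<lambda>Z zs. c * \<xi> Z zs)" using l by (simp add: multilin_def)
  have "continuous_on K (\<lambda>Z. c * (co m \<xi> Z * cnj (phi vs Z)))" if "length vs = m" for vs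
    using co that by (intro continuous_on_mult_left) (auto simp: cosec_def)
  then show "cosec m (co m (\<lambda>Z zs. c * \<xi> Z zs))"
    by (simp add: cosec_def co_def mult.assoc)
qed

lemma sections_sum: "finite S \<Longrightarrow> (\<And>i. i \<in> S \<Longrightarrow> F i \<in> sections K \<sigma> m) \<Longrightarrow> (\<lambda>Z zs. \<Sum>i\<in>S. F i Z zs) \<in> sections K \<sigma> m"
  by (induction S rule: finite_induct) (auto simp: sections_zero intro: sections_add)

lemma sections_0: "\<xi> \<in> sections K \<sigma> 0 \<longleftrightarrow>
    (\<forall>Z zs. \<not> (Z \<in> K \<and> zs = []) \<longrightarrow> \<xi> Z zs = 0) \<and> continuous_on K (\<lambda>Z. \<xi> Z [])"
  by (simp add: sections_iff zero_off_def multilin_def cosec_def co_def fibre_args_def)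

lemma sections_0_cnj: "\<xi> \<in> sections K \<sigma> 0 \<Longrightarrow> (\<lambda>Z zs. cnj (\<xi> Z zs)) \<in> sections K \<sigma> 0"
  unfolding sections_0 by (auto intro: continuous_on_cnj)

lemma supp_D: "m \<notin> supp a \<Longrightarrow> a m = (\<lambda>Z zs. 0)"
  by (simp add: supp_def)

lemma mono_mult_zero_right: "mono_mult K \<sigma> h m \<xi> k (\<lambda>Z zs. 0) = (\<lambda>Z zs. 0)"
  by (intro ext) (simp add: mono_mult_def sect_tensor_def contract_right_def contract_left_def herm_def)

lemma supp_mult: "supp (a \<otimes>\<^bsub>D\<^esub> b) \<subseteq> (\<lambda>(p, q). p + q) ` (supp a \<times> supp b)"
proof
  fix k assume k: "k \<in> supp (a \<otimes>\<^bsub>D\<^esub> b)"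
  have "\<exists>m\<in>supp a. k - m \<in> supp b"
  proof (rule ccontr)
    assume "\<not> (\<exists>m\<in>supp a. k - m \<in> supp b)"
    then have "b (k - m) = (\<lambda>Z zs. 0)" if "m \<in> supp a" for m using that supp_D by blast
    then have "(a \<otimes>\<^bsub>D\<^esub> b) k = (\<lambda>Z zs. 0)" by (simp add: mult_D mono_mult_zero_right)
    then show False using k by (simp add: supp_def)
  qed
  then obtain m where m: "m \<in> supp a" "k - m \<in> supp b" by blast
  then have "(m, k - m) \<in> supp a \<times> supp b" by simp
  from imageI[OF this, of "\<lambda>(p, q). p + q"] show "k \<in> (\<lambda>(p, q). p + q) ` (supp a \<times> supp b)" by simp
qed

lemma mult_closed:
  assumes a: "a \<in> carrier D" and b: "b \<in> carrier D" shows "a \<otimes>\<^bsub>D\<^esub> b \<in> carrier D"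
proof -
  have f: "finite (supp a)" "finite (supp b)" using a b carrier_D by blast+
  have "mono_mult K \<sigma> h m (a m) (k - m) (b (k - m)) \<in> sections K \<sigma> (nat \<bar>k\<bar>)" for m k
    using mono_mult_sections[OF sect_D[OF a, of m] sect_D[OF b, of "k - m"]] by simp
  then have "(a \<otimes>\<^bsub>D\<^esub> b) k \<in> sections K \<sigma> (nat \<bar>k\<bar>)" for k
    unfolding mult_D using f by (intro sections_sum) auto
  moreover have "finite (supp (a \<otimes>\<^bsub>D\<^esub> b))" using finite_subset[OF supp_mult] f by blast
  ultimately show ?thesis by (simp add: carrier_D)
qed

lemma add_closed:
  assumes a: "a \<in> carrier D" and b: "b \<in> carrier D" shows "a \<oplus>\<^bsub>D\<^esub> b \<in> carrier D"
proof -
  have "supp (a \<oplus>\<^bsub>D\<^esub> b) \<subseteq> supp a \<union> supp b" by (auto simp: supp_def add_D)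
  then have "finite (supp (a \<oplus>\<^bsub>D\<^esub> b))" by (rule finite_subset) (use fin_D[OF a] fin_D[OF b] in simp)
  moreover have "(a \<oplus>\<^bsub>D\<^esub> b) m \<in> sections K \<sigma> (nat \<bar>m\<bar>)" for m
    unfolding add_D by (intro sections_add sect_D a b)
  ultimately show ?thesis using carrier_D by blast
qed

lemma smult_closed:
  assumes a: "a \<in> carrier D" shows "c \<odot>\<^bsub>D\<^esub> a \<in> carrier D"
proof -
  have "supp (c \<odot>\<^bsub>D\<^esub> a) \<subseteq> supp a" by (auto simp: supp_def smult_D)
  then have "finite (supp (c \<odot>\<^bsub>D\<^esub> a))" using fin_D[OF a] finite_subset by blast
  moreover have "(c \<odot>\<^bsub>D\<^esub> a) m \<in> sections K \<sigma> (nat \<bar>m\<bar>)" for m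
    unfolding smult_D by (intro sections_scale sect_D a)
  ultimately show ?thesis using carrier_D by blast
qed

lemma supp_star: "supp (star D a) = uminus ` supp a"
proof -
  have "star D a m = (\<lambda>Z zs. 0) \<longleftrightarrow> a (- m) = (\<lambda>Z zs. 0)" for m
    unfolding star_D by (cases "m = 0") (auto simp: fun_eq_iff)
  then have iff: "m \<in> supp (star D a) \<longleftrightarrow> - m \<in> supp a" for m by (simp add: supp_def)
  show ?thesis
  proof (intro equalityI subsetI)
    fix m assume "m \<in> supp (star D a)"
    then show "m \<in> uminus ` supp a" unfolding iff by (rule rev_image_eqI) simp
  qed (auto simp: iff)
qed

lemma star_closed: "a \<in> carrier D \<Longrightarrow> star D a \<in> carrier D"
proof -
  assume a: "a \<in> carrier D"
  have "finite (supp (star D a))" using a by (simp add: supp_star carrier_D)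
  moreover have "star D a m \<in> sections K \<sigma> (nat \<bar>m\<bar>)" for m
  proof (cases "m = 0")
    case True
    have "a 0 \<in> sections K \<sigma> (nat \<bar>0\<bar>)" using a carrier_D by blast
    then show ?thesis using True sections_0_cnj by (simp add: star_D)
  next
    case False
    have "a (- m) \<in> sections K \<sigma> (nat \<bar>- m\<bar>)" using a carrier_D by blast
    then show ?thesis using False by (simp add: star_D)
  qed
  ultimately show ?thesis by (simp add: carrier_D)
qed

lemma monomial_closed: "\<xi> \<in> sections K \<sigma> (nat \<bar>m\<bar>) \<Longrightarrow> monomial m \<xi> \<in> carrier D"
proof -
  have "supp (monomial m \<xi>) \<subseteq> {m}" by (auto simp: supp_def monomial_def)
  then show "\<xi> \<in> sections K \<sigma> (nat \<bar>m\<bar>) \<Longrightarrow> monomial m \<xi> \<in> carrier D"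
    using finite_subset sections_zero by (auto simp: carrier_D monomial_def)
qed

lemma zero_closed: "\<zero>\<^bsub>D\<^esub> \<in> carrier D"
  by (simp add: carrier_D zero_D sections_zero supp_def)

lemma one_closed: "\<one>\<^bsub>D\<^esub> \<in> carrier D"
  unfolding one_D by (rule monomial_closed) (simp add: sections_0 cong: continuous_on_cong_simp)

definition cf :: "(int \<Rightarrow> 'n sect) \<Rightarrow> 'n proj \<Rightarrow> int \<Rightarrow> complex" where
  "cf a Z m = (if Z \<in> K then cf1 m (a m) Z else 0)"

lemma cf_not_supp: "m \<notin> supp a \<Longrightarrow> cf a Z m = 0"
  by (simp add: cf_def cf1_def co_def supp_D)

lemma cf_add: "cf (a \<oplus>\<^bsub>D\<^esub> b) Z m = cf a Z m + cf b Z m"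
  by (simp add: cf_def cf1_def co_def add_D add_divide_distrib)

text \<open>In negative degree the scalar acts through its conjugate on the section, and
  \<open>cf1\<close> conjugates once more; so coefficients are complex linear in every
  degree.\<close>

lemma cf_smult: "cf (c \<odot>\<^bsub>D\<^esub> a) Z m = c * cf a Z m"
  by (simp add: cf_def cf1_def co_def smult_D)

lemma cf_one: "Z \<in> K \<Longrightarrow> cf \<one>\<^bsub>D\<^esub> Z m = (if m = 0 then 1 else 0)"
  by (simp add: cf_def cf1_def co_def one_D monomial_def)

lemma cf_zero: "cf \<zero>\<^bsub>D\<^esub> Z m = 0"
  by (simp add: cf_def cf1_def co_def zero_D)

lemma cf_star: "Z \<in> K \<Longrightarrow> cf (star D a) Z m = cnj (cf a (pw m Z) (- m))"
  by (auto simp: cf_def cf1_def co_def star_D pw_add)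

lemma cf_mult: "cf (a \<otimes>\<^bsub>D\<^esub> b) Z m = (\<Sum>p\<in>supp a. cf a Z p * cf b (pw p Z) (m - p))"
proof (cases "Z \<in> K")
  case True
  have "cf1 m (\<lambda>Z zs. \<Sum>i\<in>S. F i Z zs) Z = (\<Sum>i\<in>S. cf1 m (F i) Z)" for S :: "int set" and F
    by (simp add: cf1_def co_def sum_divide_distrib)
  then have "cf (a \<otimes>\<^bsub>D\<^esub> b) Z m = (\<Sum>p\<in>supp a. cf1 m (mono_mult K \<sigma> h p (a p) (m - p) (b (m - p))) Z)"
    using True by (simp add: cf_def mult_D)
  also have "\<dots> = (\<Sum>p\<in>supp a. cf a Z p * cf b (pw p Z) (m - p))"
  proof (intro sum.cong refl)
    fix p
    show "cf1 m (mono_mult K \<sigma> h p (a p) (m - p) (b (m - p))) Z = cf a Z p * cf b (pw p Z) (m - p)"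
      using cf1_mono_mult[OF True, of p "m - p" "a p" "b (m - p)"] True by (simp add: cf_def)
  qed
  finally show ?thesis .
qed (simp add: cf_def)

text \<open>By multilinearity a section is determined by its values on the chosen representatives,
  and these are the coefficients up to the positive factor \<open>nrm\<close>.\<close>

lemma cf_eqI:
  assumes a: "a \<in> carrier D" and b: "b \<in> carrier D"
    and eq: "\<And>Z m. Z \<in> K \<Longrightarrow> cf a Z m = cf b Z m"
  shows "a = b"
proof (intro ext)
  fix m Z zs
  let ?n = "nat \<bar>m\<bar>"
  have s: "zero_off ?n (a m)" "multilin ?n (a m)" "zero_off ?n (b m)" "multilin ?n (b m)"
    using a b carrier_D sections_iff by blast+
  show "a m Z zs = b m Z zs"
  proof (cases "Z \<in> K \<and> zs \<in> fibre_args \<sigma> ?n Z")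
    case True
    then obtain cs where cs: "length cs = ?n" "zs = scaled_lift \<sigma> cs Z" by (auto simp: fibre_args_eq)
    have "co ?n (a m) Z = co ?n (b m) Z"
    proof (cases "0 \<le> m")
      case True
      then show ?thesis using \<open>Z \<in> K \<and> _\<close> eq[of Z m] by (simp add: cf_def cf1_def)
    next
      case False
      \<comment> \<open>A coefficient of negative degree \<open>m\<close> at a point reads the
        section at the end of the arrow; the arrow that ends at \<open>Z\<close> starts at
        \<open>pw (- m) Z\<close>.\<close>
      have p: "pw m (pw (- m) Z) = Z" using \<open>Z \<in> K \<and> _\<close> by (simp add: pw_add)
      show ?thesis using False \<open>Z \<in> K \<and> _\<close> eq[of "pw (- m) Z" m] p by (simp add: cf_def cf1_def)
    qed
    then have "a m Z (lift \<sigma> ?n Z) = b m Z (lift \<sigma> ?n Z)" using nrm_pos[of Z ?n] True by (simp add: co_def)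
    then show ?thesis using s cs True unfolding multilin_def by simp
  next
    case False
    then show ?thesis using s unfolding zero_off_def by simp
  qed
qed

text \<open>The groupoid representation on functions on \<open>P(V*) \<times> \<int>\<close>. It is faithful, so the laws
  of a ring are inherited from the composition of linear maps.\<close>

definition tr :: "int \<Rightarrow> 'n proj \<times> int \<Rightarrow> 'n proj \<times> int" where
  "tr p = (\<lambda>(Z, k). (if Z \<in> K then pw p Z else Z, k + p))"

definition act :: "(int \<Rightarrow> 'n sect) \<Rightarrow> ('n proj \<times> int \<Rightarrow> complex) \<Rightarrow> 'n proj \<times> int \<Rightarrow> complex" where
  "act a u x = (\<Sum>p\<in>supp a. cf a (fst x) p * u (tr p x))"

lemma tr_add: "tr q (tr p x) = tr (p + q) x"
  by (cases x) (simp add: tr_def pw_add)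

lemma tr_0: "tr 0 x = x"
  by (cases x) (simp add: tr_def)

lemma bij_tr: "bij (tr p)"
  by (rule bij_betw_byWitness[where f' = "tr (- p)"]) (auto simp: tr_add tr_0)

lemma fst_tr: "fst x \<in> K \<Longrightarrow> fst (tr p x) = pw p (fst x)"
  by (cases x) (simp add: tr_def)

lemma act_superset:
  "finite S \<Longrightarrow> supp a \<subseteq> S \<Longrightarrow> act a u x = (\<Sum>p\<in>S. cf a (fst x) p * u (tr p x))"
  unfolding act_def by (rule sum.mono_neutral_left) (auto simp: cf_not_supp)

lemma act_add:
  assumes "a \<in> carrier D" "b \<in> carrier D" shows "act (a \<oplus>\<^bsub>D\<^esub> b) u x = act a u x + act b u x"
proof -
  let ?S = "supp a \<union> supp b"
  have f: "finite ?S" using assms carrier_D by blast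
  have "supp (a \<oplus>\<^bsub>D\<^esub> b) \<subseteq> ?S" by (auto simp: supp_def add_D)
  then show ?thesis using act_superset[OF f, of "a \<oplus>\<^bsub>D\<^esub> b"] act_superset[OF f, of a] act_superset[OF f, of b]
    by (simp add: cf_add distrib_right sum.distrib)
qed

lemma act_smult:
  assumes "a \<in> carrier D" shows "act (c \<odot>\<^bsub>D\<^esub> a) u x = c * act a u x"
proof -
  have f: "finite (supp a)" using assms carrier_D by blast
  have "supp (c \<odot>\<^bsub>D\<^esub> a) \<subseteq> supp a" by (auto simp: supp_def smult_D)
  then show ?thesis using act_superset[OF f, of "c \<odot>\<^bsub>D\<^esub> a"] by (simp add: act_def cf_smult sum_distrib_left mult.assoc)
qed

lemma act_mult:
  assumes a: "a \<in> carrier D" and b: "b \<in> carrier D"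
  shows "act (a \<otimes>\<^bsub>D\<^esub> b) u x = act a (act b u) x"
proof (cases "fst x \<in> K")
  case True
  let ?Z = "fst x"
  define S where "S = (\<lambda>(p, q). p + q) ` (supp a \<times> supp b)"
  have fin: "finite (supp a)" "finite (supp b)" "finite S" using a b by (auto simp: carrier_D S_def)
  have "act (a \<otimes>\<^bsub>D\<^esub> b) u x = (\<Sum>m\<in>S. cf (a \<otimes>\<^bsub>D\<^esub> b) ?Z m * u (tr m x))"
    using act_superset[OF fin(3)] supp_mult by (simp add: S_def)
  also have "\<dots> = (\<Sum>m\<in>S. \<Sum>p\<in>supp a. cf a ?Z p * cf b (pw p ?Z) (m - p) * u (tr m x))"
    by (simp add: cf_mult sum_distrib_right)
  also have "\<dots> = (\<Sum>p\<in>supp a. \<Sum>m\<in>S. cf a ?Z p * cf b (pw p ?Z) (m - p) * u (tr m x))" by (rule sum.swap)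
  also have "\<dots> = (\<Sum>p\<in>supp a. \<Sum>q\<in>supp b. cf a ?Z p * cf b (pw p ?Z) q * u (tr (p + q) x))"
  proof (rule sum.cong[OF refl])
    fix p assume p: "p \<in> supp a"
    let ?g = "\<lambda>m. cf a ?Z p * cf b (pw p ?Z) (m - p) * u (tr m x)"
    \<comment> \<open>For fixed \<open>p\<close> a term is nonzero only if \<open>m - p\<close> lies
      in the support of \<open>b\<close>, so \<open>m = p + q\<close> can be substituted.\<close>
    have "sum ?g S = sum ?g ((+) p ` supp b)"
    proof (rule sum.mono_neutral_right[OF fin(3)])
      show "(+) p ` supp b \<subseteq> S" using p by (auto simp: S_def)
      show "\<forall>i\<in>S - (+) p ` supp b. ?g i = 0"
      proof
        fix i assume i: "i \<in> S - (+) p ` supp b"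
        have "i - p \<notin> supp b"
        proof
          assume "i - p \<in> supp b"
          from imageI[OF this, of "(+) p"] show False using i by simp
        qed
        then show "?g i = 0" by (simp add: cf_not_supp)
      qed
    qed
    also have "\<dots> = (\<Sum>q\<in>supp b. ?g (p + q))" by (subst sum.reindex) (auto simp: inj_on_def)
    finally show "sum ?g S = (\<Sum>q\<in>supp b. cf a ?Z p * cf b (pw p ?Z) q * u (tr (p + q) x))" by simp
  qed
  also have "\<dots> = act a (act b u) x"
    using True by (simp add: act_def fst_tr tr_add sum_distrib_left mult.assoc)
  finally show ?thesis .
next
  case False
  then show ?thesis by (simp add: act_def cf_def)
qed

lemma act_one: "act \<one>\<^bsub>D\<^esub> u x = (if fst x \<in> K then u x else 0)"
proof -
  have "supp \<one>\<^bsub>D\<^esub> \<subseteq> {0}" by (auto simp: supp_def one_D monomial_def)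
  then show ?thesis using act_superset[of "{0}" "\<one>\<^bsub>D\<^esub>" u x] by (simp add: cf_one tr_0) (simp add: cf_def)
qed

text \<open>The integer coordinate records the degree of an arrow, so the points
  \<open>tr p (Z, 0)\<close> are distinct for distinct \<open>p\<close> even if \<open>Z\<close> is
  periodic under \<sigma>. A delta function then singles out one coefficient.\<close>

lemma act_delta:
  assumes "Z \<in> K" "a \<in> carrier D"
  shows "act a (\<lambda>y. if y = tr m (Z, 0) then 1 else 0) (Z, 0) = cf a Z m"
proof -
  have "act a (\<lambda>y. if y = tr m (Z, 0) then 1 else 0) (Z, 0) = (\<Sum>p\<in>supp a. if p = m then cf a Z m else 0)"
    unfolding act_def by (intro sum.cong refl) (auto simp: tr_def)
  also have "\<dots> = cf a Z m" using assms cf_not_supp by (simp add: carrier_D)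
  finally show ?thesis .
qed

lemma act_eqI:
  assumes "a \<in> carrier D" "b \<in> carrier D" "\<And>u x. act a u x = act b u x"
  shows "a = b"
proof (intro cf_eqI assms)
  fix Z m assume Z: "Z \<in> K"
  show "cf a Z m = cf b Z m"
    using act_delta[OF Z assms(1), of m] act_delta[OF Z assms(2), of m] by (simp only: assms(3))
qed

lemma act_outside: "fst x \<notin> K \<Longrightarrow> act a u x = 0"
  by (simp add: act_def cf_def)

text \<open>Arrows that start in \<open>K\<close> end in \<open>K\<close>. As the unit acts by
  restriction to \<open>K\<close>, this is the law of the right unit.\<close>

lemma act_restrict: "act a (\<lambda>y. if fst y \<in> K then u y else 0) x = act a u x"
proof (cases "fst x \<in> K")
  case True
  then show ?thesis unfolding act_def by (intro sum.cong refl) (simp add: fst_tr)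
qed (simp add: act_outside)

lemma act_linear: "act a (\<lambda>y. u y + v y) x = act a u x + act a v x"
  and act_scale: "act a (\<lambda>y. c * u y) x = c * act a u x"
  by (simp_all add: act_def distrib_left sum.distrib sum_distrib_left mult_ac)

lemma act_mult_fun: "a \<in> carrier D \<Longrightarrow> b \<in> carrier D \<Longrightarrow> act (a \<otimes>\<^bsub>D\<^esub> b) u = act a (act b u)"
  and act_add_fun: "a \<in> carrier D \<Longrightarrow> b \<in> carrier D \<Longrightarrow> act (a \<oplus>\<^bsub>D\<^esub> b) u = (\<lambda>x. act a u x + act b u x)"
  and act_one_fun: "act \<one>\<^bsub>D\<^esub> u = (\<lambda>x. if fst x \<in> K then u x else 0)"
  by (auto simp: fun_eq_iff act_mult act_add act_one)

lemma ring_D: "ring D"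
proof (rule ringI)
  show "abelian_group D"
  proof (rule abelian_groupI)
    fix a assume a: "a \<in> carrier D"
    show "\<exists>b\<in>carrier D. b \<oplus>\<^bsub>D\<^esub> a = \<zero>\<^bsub>D\<^esub>"
      using smult_closed[OF a, of "-1"] by (intro bexI[of _ "(-1) \<odot>\<^bsub>D\<^esub> a"]) (auto simp: fun_eq_iff add_D smult_D zero_D)
  qed (auto simp: add_closed zero_closed fun_eq_iff add_D zero_D)
  show "Group.monoid D"
  proof (rule monoidI)
    fix a b c assume abc: "a \<in> carrier D" "b \<in> carrier D" "c \<in> carrier D"
    then show "a \<otimes>\<^bsub>D\<^esub> b \<otimes>\<^bsub>D\<^esub> c = a \<otimes>\<^bsub>D\<^esub> (b \<otimes>\<^bsub>D\<^esub> c)"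
      by (intro act_eqI mult_closed) (simp_all add: act_mult_fun mult_closed)
  next
    fix a assume a: "a \<in> carrier D"
    show "\<one>\<^bsub>D\<^esub> \<otimes>\<^bsub>D\<^esub> a = a"
      using a one_closed by (intro act_eqI mult_closed) (auto simp: act_mult act_one act_outside)
    show "a \<otimes>\<^bsub>D\<^esub> \<one>\<^bsub>D\<^esub> = a"
      using a one_closed by (intro act_eqI mult_closed) (auto simp: act_mult act_one_fun act_restrict)
  qed (auto simp: mult_closed one_closed)
next
  fix a b c assume abc: "a \<in> carrier D" "b \<in> carrier D" "c \<in> carrier D"
  then show "(a \<oplus>\<^bsub>D\<^esub> b) \<otimes>\<^bsub>D\<^esub> c = a \<otimes>\<^bsub>D\<^esub> c \<oplus>\<^bsub>D\<^esub> b \<otimes>\<^bsub>D\<^esub> c"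
    by (intro act_eqI mult_closed add_closed) (simp_all add: act_mult act_add mult_closed add_closed)
  show "c \<otimes>\<^bsub>D\<^esub> (a \<oplus>\<^bsub>D\<^esub> b) = c \<otimes>\<^bsub>D\<^esub> a \<oplus>\<^bsub>D\<^esub> c \<otimes>\<^bsub>D\<^esub> b"
    using abc by (intro act_eqI mult_closed add_closed)
      (simp_all add: act_mult act_add act_add_fun act_linear mult_closed add_closed)
qed


lemma star_mult_D:
  assumes a: "a \<in> carrier D" and b: "b \<in> carrier D"
  shows "star D (a \<otimes>\<^bsub>D\<^esub> b) = star D b \<otimes>\<^bsub>D\<^esub> star D a"
proof (intro cf_eqI star_closed mult_closed a b)
  fix Z m assume Z: "Z \<in> K"
  have fin: "finite (supp a)" "finite (supp b)" using a b by (auto simp: carrier_D)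
  let ?G = "\<lambda>p. cnj (cf a (pw m Z) p) * cnj (cf b (pw p (pw m Z)) (- m - p))"
  have "cf (star D (a \<otimes>\<^bsub>D\<^esub> b)) Z m = (\<Sum>p\<in>supp a. ?G p)"
    using Z by (simp add: cf_star cf_mult)
  \<comment> \<open>The support of \<open>a\<close> is exchanged for the set of all
    \<open>- m - q\<close> with \<open>q\<close> in the support of \<open>b\<close> by passing
    through the union: outside either set one of the two factors is zero.\<close>
  also have "\<dots> = (\<Sum>p\<in>supp a \<union> (\<lambda>q. - m - q) ` supp b. ?G p)"
    using fin by (intro sum.mono_neutral_left) (auto simp: cf_not_supp)
  also have "\<dots> = (\<Sum>p\<in>(\<lambda>q. - m - q) ` supp b. ?G p)"
  proof (rule sum.mono_neutral_right)
    show "\<forall>p\<in>supp a \<union> (\<lambda>q. - m - q) ` supp b - (\<lambda>q. - m - q) ` supp b. ?G p = 0"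
    proof
      fix p assume p: "p \<in> supp a \<union> (\<lambda>q. - m - q) ` supp b - (\<lambda>q. - m - q) ` supp b"
      have "- m - p \<notin> supp b"
      proof
        assume "- m - p \<in> supp b"
        from imageI[OF this, of "\<lambda>q. - m - q"] show False using p by simp
      qed
      then show "?G p = 0" by (simp add: cf_not_supp)
    qed
  qed (use fin in auto)
  also have "\<dots> = (\<Sum>q\<in>supp b. ?G (- m - q))" by (subst sum.reindex) (auto simp: inj_on_def)
  also have "\<dots> = (\<Sum>q\<in>supp b. cf (star D b) Z (- q) * cf (star D a) (pw (- q) Z) (m - (- q)))"
    using Z by (intro sum.cong refl) (simp add: cf_star pw_add mult.commute)
  also have "\<dots> = (\<Sum>q\<in>supp (star D b). cf (star D b) Z q * cf (star D a) (pw q Z) (m - q))"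
    unfolding supp_star by (subst sum.reindex) (auto simp: inj_on_def)
  finally show "cf (star D (a \<otimes>\<^bsub>D\<^esub> b)) Z m = cf (star D b \<otimes>\<^bsub>D\<^esub> star D a) Z m"
    by (simp add: cf_mult)
qed

lemma complex_star_algebra_D: "complex_star_algebra D"
proof -
  interpret ring D by (rule ring_D)
  show ?thesis
  proof
    show "star_involution D (star D)"
      unfolding star_involution_def
    proof (intro conjI ballI allI)
      show "star D \<in> carrier D \<rightarrow> carrier D" by (auto intro: star_closed)
      fix x y c assume "x \<in> carrier D" "y \<in> carrier D"
      then show "star D (x \<otimes>\<^bsub>D\<^esub> y) = star D y \<otimes>\<^bsub>D\<^esub> star D x" by (rule star_mult_D)
    qed (auto simp: fun_eq_iff star_D add_D smult_D)
  next
    fix x y c assume x: "x \<in> carrier D" and y: "y \<in> carrier D"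
    show "(c \<odot>\<^bsub>D\<^esub> x) \<otimes>\<^bsub>D\<^esub> y = c \<odot>\<^bsub>D\<^esub> (x \<otimes>\<^bsub>D\<^esub> y)"
      by (intro act_eqI mult_closed smult_closed x y) (simp add: act_mult act_smult mult_closed smult_closed x y)
    have s: "act (c \<odot>\<^bsub>D\<^esub> y) u = (\<lambda>z. c * act y u z)" for u by (rule ext) (rule act_smult[OF y])
    show "x \<otimes>\<^bsub>D\<^esub> (c \<odot>\<^bsub>D\<^esub> y) = c \<odot>\<^bsub>D\<^esub> (x \<otimes>\<^bsub>D\<^esub> y)"
      by (intro act_eqI mult_closed smult_closed x y)
        (simp add: act_mult act_smult s act_scale mult_closed smult_closed x y)
  qed (auto simp: smult_closed fun_eq_iff smult_D add_D distrib_right distrib_left)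
qed

end

section \<open>Square summable functions\<close>

definition l2 :: "('i \<Rightarrow> complex) \<Rightarrow> bool" where
  "l2 u \<longleftrightarrow> (\<lambda>i. (cmod (u i))\<^sup>2) summable_on UNIV"

definition sqnorm :: "('i \<Rightarrow> complex) \<Rightarrow> real" where
  "sqnorm u = (\<Sum>\<^sub>\<infinity>i. (cmod (u i))\<^sup>2)"

lemma sqnorm_nonneg: "0 \<le> sqnorm u"
  unfolding sqnorm_def by (rule infsum_nonneg) simp

lemma cmod_add_square: "(cmod (a + b))\<^sup>2 \<le> 2 * (cmod a)\<^sup>2 + 2 * (cmod b)\<^sup>2"
proof -
  have "(cmod (a + b))\<^sup>2 \<le> (cmod a + cmod b)\<^sup>2" by (simp add: norm_triangle_ineq power_mono)
  also have "\<dots> \<le> 2 * (cmod a)\<^sup>2 + 2 * (cmod b)\<^sup>2"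
    using sum_squares_bound[of "cmod a" "cmod b"] by (simp add: power2_sum)
  finally show ?thesis .
qed

lemma l2_add:
  assumes u: "l2 u" and v: "l2 v"
  shows "l2 (\<lambda>i. u i + v i)" and "sqnorm (\<lambda>i. u i + v i) \<le> 2 * sqnorm u + 2 * sqnorm v"
proof -
  have s: "(\<lambda>i. 2 * (cmod (u i))\<^sup>2 + 2 * (cmod (v i))\<^sup>2) summable_on UNIV"
    using u v by (intro summable_on_add summable_on_cmult_right) (auto simp: l2_def)
  show l: "l2 (\<lambda>i. u i + v i)" unfolding l2_def
    by (rule summable_on_comparison_test[OF s]) (auto simp: cmod_add_square)
  have "sqnorm (\<lambda>i. u i + v i) \<le> (\<Sum>\<^sub>\<infinity>i. 2 * (cmod (u i))\<^sup>2 + 2 * (cmod (v i))\<^sup>2)"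
    unfolding sqnorm_def using l s by (intro infsum_mono) (auto simp: l2_def cmod_add_square)
  also have "\<dots> = 2 * sqnorm u + 2 * sqnorm v"
    using u v unfolding sqnorm_def l2_def by (simp add: infsum_add infsum_cmult_right summable_on_cmult_right)
  finally show "sqnorm (\<lambda>i. u i + v i) \<le> 2 * sqnorm u + 2 * sqnorm v" .
qed

lemma l2_scale: "l2 u \<Longrightarrow> l2 (\<lambda>i. c * u i)"
  by (simp add: l2_def norm_mult power_mult_distrib summable_on_cmult_right)

lemma l2_zero: "l2 (\<lambda>i. 0)"
  by (simp add: l2_def)

lemma l2_inner_summable:
  assumes "l2 u" "l2 v" shows "(\<lambda>i. u i * cnj (v i)) summable_on UNIV"
proof -
  have s: "(\<lambda>i. (cmod (u i))\<^sup>2 + (cmod (v i))\<^sup>2) summable_on UNIV"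
    using assms by (intro summable_on_add) (auto simp: l2_def)
  have le: "cmod a * cmod b \<le> (cmod a)\<^sup>2 + (cmod b)\<^sup>2" for a b
    using sum_squares_bound[of "cmod a" "cmod b"] mult_nonneg_nonneg[OF norm_ge_zero[of a] norm_ge_zero[of b]] by linarith
  have "(\<lambda>i. norm (u i * cnj (v i))) summable_on UNIV"
    by (rule summable_on_comparison_test[OF s]) (simp_all add: norm_mult le)
  then show ?thesis by (rule abs_summable_summable)
qed

lemma sqnorm_inner: "l2 u \<Longrightarrow> (\<Sum>\<^sub>\<infinity>i. u i * cnj (u i)) = of_real (sqnorm u)"
proof -
  assume "l2 u"
  then have "((\<lambda>i. (cmod (u i))\<^sup>2) has_sum sqnorm u) UNIV" unfolding l2_def sqnorm_def by (rule has_sum_infsum)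
  then have "((\<lambda>i. complex_of_real ((cmod (u i))\<^sup>2)) has_sum of_real (sqnorm u)) UNIV" by (simp only: has_sum_of_real_iff)
  then have "((\<lambda>i. u i * cnj (u i)) has_sum of_real (sqnorm u)) UNIV" by (simp only: complex_norm_square)
  then show ?thesis by (rule infsumI)
qed

lemma l2_eval: "l2 u \<Longrightarrow> (cmod (u i))\<^sup>2 \<le> sqnorm u"
  using finite_sum_le_infsum[of "\<lambda>i. (cmod (u i))\<^sup>2" UNIV "{i}"] by (simp add: l2_def sqnorm_def)

lemma l2_finite_sums:
  assumes "\<And>F. finite F \<Longrightarrow> (\<Sum>i\<in>F. (cmod (u i))\<^sup>2) \<le> C"
  shows "l2 u" and "sqnorm u \<le> C"
proof -
  show l: "l2 u" unfolding l2_def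
    using assms by (intro nonneg_bdd_above_summable_on bdd_aboveI[of _ C]) auto
  then show "sqnorm u \<le> C" unfolding sqnorm_def l2_def using assms by (intro infsum_le_finite_sums) auto
qed

text \<open>The universal norm of an algebra on \<open>'a\<close> refers to Hilbert spaces in \<open>'a \<Rightarrow> complex\<close> only, so \<open>\<ell>\<^sup>2(I)\<close> is
  copied there along an injection of \<open>I\<close>.\<close>

definition l2_space :: "('i \<Rightarrow> 'a) \<Rightarrow> ('a \<Rightarrow> complex) inner_space" where
  "l2_space \<iota> =
     \<lparr>carrier = {f. (\<forall>x. x \<notin> range \<iota> \<longrightarrow> f x = 0) \<and> l2 (f \<circ> \<iota>)},
      mult = undefined, one = undefined, zero = (\<lambda>x. 0), add = (\<lambda>f g x. f x + g x),
      smult = (\<lambda>c f x. c * f x), hinner = (\<lambda>f g. \<Sum>\<^sub>\<infinity>i. f (\<iota> i) * cnj (g (\<iota> i)))\<rparr>"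

lemma l2_space_simps:
  "f \<in> carrier (l2_space \<iota>) \<longleftrightarrow> (\<forall>x. x \<notin> range \<iota> \<longrightarrow> f x = 0) \<and> l2 (\<lambda>i. f (\<iota> i))"
  "\<zero>\<^bsub>l2_space \<iota>\<^esub> = (\<lambda>x. 0)" "f \<oplus>\<^bsub>l2_space \<iota>\<^esub> g = (\<lambda>x. f x + g x)"
  "c \<odot>\<^bsub>l2_space \<iota>\<^esub> f = (\<lambda>x. c * f x)"
  "hinner (l2_space \<iota>) f g = (\<Sum>\<^sub>\<infinity>i. f (\<iota> i) * cnj (g (\<iota> i)))"
  by (simp_all add: l2_space_def o_def)

lemma hnorm_l2_space: "l2 (\<lambda>i. f (\<iota> i)) \<Longrightarrow> hnorm (l2_space \<iota>) f = sqrt (sqnorm (\<lambda>i. f (\<iota> i)))"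
  by (simp add: hnorm_def l2_space_simps sqnorm_inner)

lemma abelian_group_l2_space: "abelian_group (l2_space \<iota>)"
proof (rule abelian_groupI)
  fix f assume "f \<in> carrier (l2_space \<iota>)"
  then show "\<exists>g\<in>carrier (l2_space \<iota>). g \<oplus>\<^bsub>l2_space \<iota>\<^esub> f = \<zero>\<^bsub>l2_space \<iota>\<^esub>"
    by (intro bexI[of _ "\<lambda>x. - f x"]) (auto simp: l2_space_simps l2_def)
qed (auto simp: l2_space_simps l2_zero fun_eq_iff intro: l2_add)

lemma l2_space_minus:
  assumes "g \<in> carrier (l2_space \<iota>)"
  shows "f \<ominus>\<^bsub>l2_space \<iota>\<^esub> g = (\<lambda>x. f x - g x)"
proof -
  interpret abelian_group "l2_space \<iota>" by (rule abelian_group_l2_space)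
  have "\<ominus>\<^bsub>l2_space \<iota>\<^esub> g = (\<lambda>x. - g x)"
    using assms by (intro minus_equality) (auto simp: l2_space_simps l2_def)
  then show ?thesis by (simp add: a_minus_def l2_space_simps)
qed

lemma hilbert_l2_space: "hilbert_space (l2_space (\<iota> :: 'i \<Rightarrow> 'a))"
proof -
  let ?H = "l2_space \<iota>"
  have complete: "\<exists>x\<in>carrier ?H. (\<lambda>k. hnorm ?H (s k \<ominus>\<^bsub>?H\<^esub> x)) \<longlonglongrightarrow> 0" if "cauchy_in ?H (hnorm ?H) s" for s
  proof -
    have sc: "s k \<in> carrier ?H" for k using that by (simp add: cauchy_in_def)
    then have off: "x \<notin> range \<iota> \<Longrightarrow> s k x = 0" and sl: "l2 (\<lambda>i. s k (\<iota> i))" for k x by (auto simp: l2_space_simps)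
    have dl: "l2 (\<lambda>i. s k (\<iota> i) - s l (\<iota> i))" for k l
      using l2_add(1)[OF sl[of k] l2_scale[OF sl[of l], of "-1"]] by simp
    have d: "hnorm ?H (s k \<ominus>\<^bsub>?H\<^esub> s l) = sqrt (sqnorm (\<lambda>i. s k (\<iota> i) - s l (\<iota> i)))" for k l
      by (simp add: l2_space_minus sc hnorm_l2_space dl)
    have C: "\<exists>N. \<forall>k\<ge>N. \<forall>l\<ge>N. sqnorm (\<lambda>i. s k (\<iota> i) - s l (\<iota> i)) < e\<^sup>2" if "e > 0" for e
    proof -
      obtain N where N: "\<And>k l. k \<ge> N \<Longrightarrow> l \<ge> N \<Longrightarrow> sqrt (sqnorm (\<lambda>i. s k (\<iota> i) - s l (\<iota> i))) < e"
        using \<open>cauchy_in _ _ s\<close> \<open>e > 0\<close> unfolding cauchy_in_def d by meson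
      have "sqnorm (\<lambda>i. s k (\<iota> i) - s l (\<iota> i)) < e\<^sup>2" if "k \<ge> N" "l \<ge> N" for k l
        using power_strict_mono[OF N[OF that], of 2] by (simp add: sqnorm_nonneg)
      then show ?thesis by blast
    qed
    have "Cauchy (\<lambda>k. s k (\<iota> i))" for i
    proof (rule CauchyI)
      fix e :: real assume e: "0 < e"
      then obtain N where N: "\<forall>k\<ge>N. \<forall>l\<ge>N. sqnorm (\<lambda>i. s k (\<iota> i) - s l (\<iota> i)) < e\<^sup>2" using C by blast
      have "norm (s k (\<iota> i) - s l (\<iota> i)) < e" if "k \<ge> N" "l \<ge> N" for k l
      proof -
        have "(cmod (s k (\<iota> i) - s l (\<iota> i)))\<^sup>2 < e\<^sup>2"
          using l2_eval[OF dl[of k l], of i] N that by (meson order_le_less_trans)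
        then show ?thesis using e by (simp add: power2_less_imp_less)
      qed
      then show "\<exists>N. \<forall>k\<ge>N. \<forall>l\<ge>N. norm (s k (\<iota> i) - s l (\<iota> i)) < e" by blast
    qed
    then have "\<forall>i. \<exists>l. (\<lambda>k. s k (\<iota> i)) \<longlonglongrightarrow> l"
      by (intro allI) (simp only: Cauchy_convergent_iff convergent_def)
    from choice[OF this] obtain y where "\<forall>i. (\<lambda>k. s k (\<iota> i)) \<longlonglongrightarrow> y i" by (elim exE)
    then have y: "(\<lambda>k. s k (\<iota> i)) \<longlonglongrightarrow> y i" for i by (rule spec)
    \<comment> \<open>The pointwise limit on the whole type; off the range of the injection all
      members of the sequence are zero, so the limit is zero there.\<close>
    define x where "x = (\<lambda>z. lim (\<lambda>k. s k z))"
    have xi: "x (\<iota> i) = y i" for i unfolding x_def by (rule limI[OF y])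
    have xoff: "x z = 0" if "z \<notin> range \<iota>" for z
    proof -
      have "(\<lambda>k. s k z) \<longlonglongrightarrow> 0" unfolding off[OF that] by (rule tendsto_const)
      then show ?thesis unfolding x_def by (rule limI)
    qed
    \<comment> \<open>For a finite set of indices the bound passes to the limit in \<open>l\<close>;
      the bound for all finite sets then bounds the infinite sum.\<close>
    have near: "l2 (\<lambda>i. s k (\<iota> i) - y i) \<and> sqnorm (\<lambda>i. s k (\<iota> i) - y i) \<le> e\<^sup>2"
      if N: "\<forall>k\<ge>N. \<forall>l\<ge>N. sqnorm (\<lambda>i. s k (\<iota> i) - s l (\<iota> i)) < e\<^sup>2" and k: "k \<ge> N" for N k e
    proof -
      have "(\<Sum>i\<in>F. (cmod (s k (\<iota> i) - y i))\<^sup>2) \<le> e\<^sup>2" if F: "finite F" for F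
      proof (rule LIMSEQ_le_const2)
        show "(\<lambda>l. \<Sum>i\<in>F. (cmod (s k (\<iota> i) - s l (\<iota> i)))\<^sup>2) \<longlonglongrightarrow> (\<Sum>i\<in>F. (cmod (s k (\<iota> i) - y i))\<^sup>2)"
          by (intro tendsto_intros y)
        have "(\<Sum>i\<in>F. (cmod (s k (\<iota> i) - s l (\<iota> i)))\<^sup>2) \<le> e\<^sup>2" if "l \<ge> N" for l
        proof -
          have "(\<Sum>i\<in>F. (cmod (s k (\<iota> i) - s l (\<iota> i)))\<^sup>2) \<le> sqnorm (\<lambda>i. s k (\<iota> i) - s l (\<iota> i))"
            unfolding sqnorm_def using F dl[of k l] by (intro finite_sum_le_infsum) (auto simp: l2_def)
          then show ?thesis using N k that by fastforce
        qed
        then show "\<exists>N. \<forall>l\<ge>N. (\<Sum>i\<in>F. (cmod (s k (\<iota> i) - s l (\<iota> i)))\<^sup>2) \<le> e\<^sup>2" by blast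
      qed
      from l2_finite_sums[OF this] show ?thesis by blast
    qed
    have yl: "l2 y"
    proof -
      obtain N where N: "\<forall>k\<ge>N. \<forall>l\<ge>N. sqnorm (\<lambda>i. s k (\<iota> i) - s l (\<iota> i)) < 1\<^sup>2" using C[of 1] by auto
      have "l2 (\<lambda>i. s N (\<iota> i) - y i)" using near[OF N, of N] by simp
      from l2_add(1)[OF sl[of N] l2_scale[OF this, of "-1"]] show ?thesis by simp
    qed
    have xc: "x \<in> carrier ?H" using xoff yl by (simp add: l2_space_simps xi)
    have "(\<lambda>k. hnorm ?H (s k \<ominus>\<^bsub>?H\<^esub> x)) \<longlonglongrightarrow> 0"
    proof (rule LIMSEQ_I)
      fix r :: real assume r: "0 < r"
      then obtain N where N: "\<forall>k\<ge>N. \<forall>l\<ge>N. sqnorm (\<lambda>i. s k (\<iota> i) - s l (\<iota> i)) < (r / 2)\<^sup>2" using C[of "r / 2"] by auto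
      have "norm (hnorm ?H (s k \<ominus>\<^bsub>?H\<^esub> x) - 0) < r" if "k \<ge> N" for k
      proof -
        have "sqrt (sqnorm (\<lambda>i. s k (\<iota> i) - y i)) \<le> r / 2"
          using near[OF N that] r by (intro real_le_lsqrt) (auto simp: sqnorm_nonneg)
        then show ?thesis using r near[OF N that] by (simp add: l2_space_minus[OF xc] hnorm_l2_space xi sqnorm_nonneg)
      qed
      then show "\<exists>N. \<forall>k\<ge>N. norm (hnorm ?H (s k \<ominus>\<^bsub>?H\<^esub> x) - 0) < r" by blast
    qed
    then show ?thesis using xc by blast
  qed
  have inner_add: "hinner ?H (f \<oplus>\<^bsub>?H\<^esub> g) k = hinner ?H f k + hinner ?H g k"
    if "f \<in> carrier ?H" "g \<in> carrier ?H" "k \<in> carrier ?H" for f g k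
    using that l2_inner_summable[of "\<lambda>i. f (\<iota> i)" "\<lambda>i. k (\<iota> i)"] l2_inner_summable[of "\<lambda>i. g (\<iota> i)" "\<lambda>i. k (\<iota> i)"]
    unfolding l2_space_simps by (simp add: distrib_right infsum_add)
  have inner_cnj: "hinner ?H g f = cnj (hinner ?H f g)" for f g
    by (simp add: l2_space_simps infsum_cnj[symmetric] mult.commute del: infsum_cnj)
  have pos: "0 < Re (hinner ?H f f)" if f: "f \<in> carrier ?H" and nz: "f \<noteq> \<zero>\<^bsub>?H\<^esub>" for f
  proof -
    obtain i where "f (\<iota> i) \<noteq> 0" using f nz unfolding l2_space_simps by (metis rangeE)
    then have "0 < (cmod (f (\<iota> i)))\<^sup>2" by simp
    also have "\<dots> \<le> sqnorm (\<lambda>i. f (\<iota> i))" using f by (intro l2_eval) (simp add: l2_space_simps)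
    finally show ?thesis using f by (simp add: l2_space_simps sqnorm_inner)
  qed
  show ?thesis
    unfolding hilbert_space_def
  proof (intro conjI allI ballI impI)
    show "abelian_group ?H" by (rule abelian_group_l2_space)
  next
    fix f g k assume "f \<in> carrier ?H" "g \<in> carrier ?H" "k \<in> carrier ?H"
    then show "hinner ?H (f \<oplus>\<^bsub>?H\<^esub> g) k = hinner ?H f k + hinner ?H g k" by (rule inner_add)
  next
    fix f g
    show "hinner ?H g f = cnj (hinner ?H f g)" by (rule inner_cnj)
  next
    fix f assume "f \<in> carrier ?H" "f \<noteq> \<zero>\<^bsub>?H\<^esub>"
    then show "0 < Re (hinner ?H f f)" by (rule pos)
  next
    fix s assume "cauchy_in ?H (hnorm ?H) s"
    then show "\<exists>x\<in>carrier ?H. (\<lambda>k. hnorm ?H (s k \<ominus>\<^bsub>?H\<^esub> x)) \<longlonglongrightarrow> 0" by (rule complete)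
  next
    fix c f g
    show "hinner ?H (c \<odot>\<^bsub>?H\<^esub> f) g = c * hinner ?H f g"
      by (simp add: l2_space_simps mult.assoc infsum_cmult_right')
  qed (auto simp: l2_space_simps l2_scale algebra_simps)
qed

lemma weighted_composition:
  assumes u: "l2 u" and t: "bij t" and c: "\<And>i. cmod (c i) \<le> M"
  shows "l2 (\<lambda>i. c i * u (t i))" and "sqnorm (\<lambda>i. c i * u (t i)) \<le> M\<^sup>2 * sqnorm u"
proof -
  have s: "(\<lambda>i. (cmod (u (t i)))\<^sup>2) summable_on UNIV"
    using u summable_on_reindex_bij_betw[OF t, of "\<lambda>i. (cmod (u i))\<^sup>2"] by (simp add: l2_def)
  then have s': "(\<lambda>i. M\<^sup>2 * (cmod (u (t i)))\<^sup>2) summable_on UNIV" by (rule summable_on_cmult_right)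
  have le: "(cmod (c i * u (t i)))\<^sup>2 \<le> M\<^sup>2 * (cmod (u (t i)))\<^sup>2" for i
    using c[of i] by (simp add: norm_mult power_mult_distrib mult_right_mono power_mono)
  show l: "l2 (\<lambda>i. c i * u (t i))"
    unfolding l2_def by (rule summable_on_comparison_test[OF s']) (use le in auto)
  have "sqnorm (\<lambda>i. c i * u (t i)) \<le> (\<Sum>\<^sub>\<infinity>i. M\<^sup>2 * (cmod (u (t i)))\<^sup>2)"
    unfolding sqnorm_def using l s' le by (intro infsum_mono) (auto simp: l2_def)
  also have "\<dots> = M\<^sup>2 * sqnorm u"
    using infsum_reindex_bij_betw[OF t, of "\<lambda>i. (cmod (u i))\<^sup>2"] by (simp add: infsum_cmult_right' sqnorm_def)
  finally show "sqnorm (\<lambda>i. c i * u (t i)) \<le> M\<^sup>2 * sqnorm u" .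
qed

text \<open>Terms are added one at a time with |a + b|^2 \<le> 2 |a|^2 + 2 |b|^2, whence the
  constants 2.\<close>

lemma weighted_composition_sum:
  assumes "finite S" "\<And>p. p \<in> S \<Longrightarrow> bij (t p)" "\<And>p. p \<in> S \<Longrightarrow> \<exists>M. \<forall>i. cmod (c p i) \<le> M"
  shows "\<exists>C\<ge>0. \<forall>u. l2 u \<longrightarrow> l2 (\<lambda>i. \<Sum>p\<in>S. c p i * u (t p i)) \<and> sqnorm (\<lambda>i. \<Sum>p\<in>S. c p i * u (t p i)) \<le> C * sqnorm u"
  using assms
proof (induction S rule: finite_induct)
  case empty
  then show ?case by (intro exI[of _ 0]) (simp add: l2_zero sqnorm_def)
next
  case (insert q S)
  obtain C where C: "C \<ge> 0" "\<And>u. l2 u \<Longrightarrow> l2 (\<lambda>i. \<Sum>p\<in>S. c p i * u (t p i))"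
    "\<And>u. l2 u \<Longrightarrow> sqnorm (\<lambda>i. \<Sum>p\<in>S. c p i * u (t p i)) \<le> C * sqnorm u" using insert by auto
  obtain M where M: "\<And>i. cmod (c q i) \<le> M" using insert.prems by blast
  have b: "bij (t q)" using insert.prems by blast
  have "l2 (\<lambda>i. \<Sum>p\<in>insert q S. c p i * u (t p i)) \<and>
      sqnorm (\<lambda>i. \<Sum>p\<in>insert q S. c p i * u (t p i)) \<le> (2 * M\<^sup>2 + 2 * C) * sqnorm u" if u: "l2 u" for u
  proof -
    note w = weighted_composition[where c = "c q", OF u b M]
    show ?thesis using l2_add[OF w(1) C(2)[OF u]] w(2) C(3)[OF u] insert.hyps by (simp add: algebra_simps)
  qed
  then show ?case using C(1) by (intro exI[of _ "2 * M\<^sup>2 + 2 * C"]) auto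
qed

lemma inner_sum_left:
  assumes "finite S" "\<And>p. p \<in> S \<Longrightarrow> (\<lambda>i. f p i) summable_on UNIV"
  shows "(\<lambda>i. \<Sum>p\<in>S. f p i) summable_on UNIV \<and>
    (\<Sum>\<^sub>\<infinity>i. \<Sum>p\<in>S. f p i) = (\<Sum>p\<in>S. \<Sum>\<^sub>\<infinity>i. (f p i :: complex))"
  using assms
proof (induction S rule: finite_induct)
  case (insert q S)
  then show ?case by (simp add: infsum_add summable_on_add)
qed simp

section \<open>Norms in the crossed product\<close>

context twisted
begin

interpretation D: complex_star_algebra D by (rule complex_star_algebra_D)

text \<open>The square of the modulus has no phase. Multiplied by |phi vs|^2 it is the squared
  modulus of a tested coefficient, hence continuous.\<close>

lemma co_square_continuous:
  assumes "\<xi> \<in> sections K \<sigma> m" shows "continuous_on K (\<lambda>Z. co m \<xi> Z * cnj (co m \<xi> Z))"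
proof (rule continuous_on_multiplier)
  fix Z assume Z: "Z \<in> K"
  obtain vs where vs: "length vs = m" "phi vs Z \<noteq> 0" using ex_phi_nonzero[OF Z] by blast
  have c: "continuous_on K (\<lambda>Z. co m \<xi> Z * cnj (phi vs Z))" using assms vs by (simp add: sections_iff cosec_def)
  have "continuous_on K (\<lambda>Z. (co m \<xi> Z * cnj (co m \<xi> Z)) * (phi vs Z * cnj (phi vs Z)))"
    by (rule continuous_on_eq[OF continuous_on_mult[OF c continuous_on_cnj[OF c]]]) simp
  then show "\<exists>g. continuous_on K g \<and> g Z \<noteq> 0 \<and> continuous_on K (\<lambda>Z. (co m \<xi> Z * cnj (co m \<xi> Z)) * g Z)"
    using vs continuous_phi[of vs vs] by (intro exI[of _ "\<lambda>Z. phi vs Z * cnj (phi vs Z)"]) simp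
qed

lemma co_bounded:
  assumes "\<xi> \<in> sections K \<sigma> m" shows "\<exists>M\<ge>0. \<forall>Z\<in>K. cmod (co m \<xi> Z) \<le> M"
proof -
  have "compact ((\<lambda>Z. co m \<xi> Z * cnj (co m \<xi> Z)) ` K)"
    by (rule compact_continuous_image[OF co_square_continuous[OF assms] compact_K])
  from compact_imp_bounded[OF this, unfolded bounded_iff]
  obtain B where B: "\<forall>x\<in>(\<lambda>Z. co m \<xi> Z * cnj (co m \<xi> Z)) ` K. norm x \<le> B" by (elim exE)
  have "cmod (co m \<xi> Z) \<le> sqrt \<bar>B\<bar>" if "Z \<in> K" for Z
  proof (rule real_le_rsqrt)
    have "norm (co m \<xi> Z * cnj (co m \<xi> Z)) \<le> B" using B that by blast
    then show "(cmod (co m \<xi> Z))\<^sup>2 \<le> \<bar>B\<bar>" by (simp add: norm_mult power2_eq_square)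
  qed
  then show ?thesis by (intro exI[of _ "sqrt \<bar>B\<bar>"]) simp
qed

lemma cf_bounded:
  assumes "a \<in> carrier D" shows "\<exists>M\<ge>0. \<forall>Z. cmod (cf a Z p) \<le> M"
proof -
  obtain M where M: "M \<ge> 0" "\<And>Z. Z \<in> K \<Longrightarrow> cmod (co (nat \<bar>p\<bar>) (a p) Z) \<le> M"
    using co_bounded[OF sect_D[OF assms, of p]] by blast
  have "cmod (cf a Z p) \<le> M" for Z using M M(2)[of Z] M(2)[of "pw p Z"]
    by (cases "0 \<le> p") (auto simp: cf_def cf1_def)
  then show ?thesis using M(1) by blast
qed

lemma act_l2:
  assumes "a \<in> carrier D"
  shows "\<exists>C\<ge>0. \<forall>u. l2 u \<longrightarrow> l2 (act a u) \<and> sqnorm (act a u) \<le> C * sqnorm u"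
proof -
  have "\<exists>C\<ge>0. \<forall>u. l2 u \<longrightarrow> l2 (\<lambda>x. \<Sum>p\<in>supp a. cf a (fst x) p * u (tr p x)) \<and>
      sqnorm (\<lambda>x. \<Sum>p\<in>supp a. cf a (fst x) p * u (tr p x)) \<le> C * sqnorm u"
    using fin_D[OF assms] bij_tr cf_bounded[OF assms] by (intro weighted_composition_sum) blast+
  then show ?thesis by (simp only: act_def[abs_def])
qed

text \<open>The term of degree \<open>- q\<close> of the adjoint at \<open>x\<close> is the term of
  degree \<open>q\<close> on the other side at \<open>tr (- q) x\<close>. Translations are
  bijections, so the sums over all \<open>x\<close> agree.\<close>

lemma act_adjoint:
  assumes a: "a \<in> carrier D" and u: "l2 u" and v: "l2 v"
  shows "(\<Sum>\<^sub>\<infinity>x. act (star D a) u x * cnj (v x)) = (\<Sum>\<^sub>\<infinity>x. u x * cnj (act a v x))"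
proof -
  define G where "G q x = u x * cnj (cf a (fst x) q * v (tr q x))" for q x
  have G: "G q summable_on UNIV" for q
  proof -
    obtain M where "\<And>Z. cmod (cf a Z q) \<le> M" using cf_bounded[OF a] by blast
    then have "l2 (\<lambda>x. cf a (fst x) q * v (tr q x))" by (intro weighted_composition(1)[OF v bij_tr])
    from l2_inner_summable[OF u this] show ?thesis by (simp add: G_def[abs_def])
  qed
  have F: "cf (star D a) (fst x) (- q) * u (tr (- q) x) * cnj (v x) = G q (tr (- q) x)" for q x
  proof (cases "fst x \<in> K")
    case True
    then show ?thesis by (simp add: G_def cf_star fst_tr tr_add tr_0 mult_ac)
  next
    case False
    then have "fst (tr (- q) x) \<notin> K" by (cases x) (simp add: tr_def)
    then show ?thesis using False by (simp add: G_def cf_def)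
  qed
  have "(\<Sum>\<^sub>\<infinity>x. act (star D a) u x * cnj (v x)) = (\<Sum>\<^sub>\<infinity>x. \<Sum>q\<in>supp a. G q (tr (- q) x))"
    unfolding act_def supp_star
    by (subst sum.reindex) (auto simp: inj_on_def sum_distrib_right F)
  also have "\<dots> = (\<Sum>q\<in>supp a. \<Sum>\<^sub>\<infinity>x. G q (tr (- q) x))"
    using fin_D[OF a] G summable_on_reindex_bij_betw[OF bij_tr]
    by (intro conjunct2[OF inner_sum_left]) auto
  also have "\<dots> = (\<Sum>q\<in>supp a. \<Sum>\<^sub>\<infinity>x. G q x)"
    by (intro sum.cong refl infsum_reindex_bij_betw[OF bij_tr])
  also have "\<dots> = (\<Sum>\<^sub>\<infinity>x. \<Sum>q\<in>supp a. G q x)"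
    using fin_D[OF a] G by (intro conjunct2[OF inner_sum_left, symmetric]) auto
  also have "\<dots> = (\<Sum>\<^sub>\<infinity>x. u x * cnj (act a v x))"
    by (simp add: G_def act_def sum_distrib_left)
  finally show ?thesis .
qed

text \<open>Merely an injective labelling of points by elements of the type underlying the algebra,
  as required by \<open>l2_space\<close>; the labels are not meant as members of the
  algebra.\<close>

definition point_index :: "'n proj \<times> int \<Rightarrow> int \<Rightarrow> 'n sect" where
  "point_index x = (\<lambda>m Y zs. if m = snd x \<and> Y = fst x then 1 else 0)"

lemma inj_point_index: "inj point_index"
proof (rule injI)
  fix x y assume "point_index x = point_index y"
  then have "point_index x (snd x) (fst x) [] = point_index y (snd x) (fst x) []" by simp
  then show "x = y" by (auto simp: point_index_def prod_eq_iff split: if_splits)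
qed

abbreviation H0 where "H0 \<equiv> l2_space point_index"

definition reg :: "(int \<Rightarrow> 'n sect) \<Rightarrow> ((int \<Rightarrow> 'n sect) \<Rightarrow> complex) \<Rightarrow> (int \<Rightarrow> 'n sect) \<Rightarrow> complex" where
  "reg a f y = (if y \<in> range point_index then act a (\<lambda>x. f (point_index x)) (inv_into UNIV point_index y) else 0)"

lemma reg_point: "reg a f (point_index x) = act a (\<lambda>x. f (point_index x)) x"
  by (simp add: reg_def inv_f_f[OF inj_point_index])

lemma H0_eqI: "(\<And>x. f (point_index x) = g (point_index x)) \<Longrightarrow> (\<And>y. y \<notin> range point_index \<Longrightarrow> f y = g y) \<Longrightarrow> f = g"
  by (metis ext rangeE)

lemma hilbert_representation_reg: "hilbert_representation D H0 reg"
proof -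
  interpret H: hilbert H0 by (rule hilbert.intro[OF hilbert_l2_space])
  have off: "reg a f y = 0" if "y \<notin> range point_index" for a f y using that by (simp add: reg_def)
  have foff: "f y = 0" if "f \<in> carrier H0" "y \<notin> range point_index" for f y using that by (simp add: l2_space_simps)
  have fl: "l2 (\<lambda>x. f (point_index x))" if "f \<in> carrier H0" for f using that by (simp add: l2_space_simps)
  have closed: "reg a f \<in> carrier H0" if "a \<in> carrier D" "f \<in> carrier H0" for a f
    using act_l2[OF that(1)] fl[OF that(2)] by (auto simp: l2_space_simps off reg_point)
  have bounded: "bounded_operator H0 (reg a)" if a: "a \<in> carrier D" for a
    unfolding bounded_operator_def
  proof (intro conjI ballI allI)
    show "reg a \<in> carrier H0 \<rightarrow> carrier H0" using closed[OF a] by blast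
    show "reg a (f \<oplus>\<^bsub>H0\<^esub> g) = reg a f \<oplus>\<^bsub>H0\<^esub> reg a g" for f g
      by (rule H0_eqI) (simp_all add: l2_space_simps reg_point act_linear off)
    show "reg a (c \<odot>\<^bsub>H0\<^esub> f) = c \<odot>\<^bsub>H0\<^esub> reg a f" for c f
      by (rule H0_eqI) (simp_all add: l2_space_simps reg_point act_scale off)
    obtain C where C: "C \<ge> 0" "\<And>u. l2 u \<Longrightarrow> l2 (act a u) \<and> sqnorm (act a u) \<le> C * sqnorm u" using act_l2[OF a] by blast
    have "hnorm H0 (reg a f) \<le> sqrt C * hnorm H0 f" if f: "f \<in> carrier H0" for f
    proof -
      have "hnorm H0 (reg a f) = sqrt (sqnorm (act a (\<lambda>x. f (point_index x))))"
        using C(2)[OF fl[OF f]] by (simp add: hnorm_l2_space reg_point)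
      also have "\<dots> \<le> sqrt (C * sqnorm (\<lambda>x. f (point_index x)))" using C(2)[OF fl[OF f]] by simp
      also have "\<dots> = sqrt C * hnorm H0 f" using fl[OF f] by (simp add: real_sqrt_mult hnorm_l2_space)
      finally show ?thesis .
    qed
    then show "\<exists>M. \<forall>f\<in>carrier H0. hnorm H0 (reg a f) \<le> M * hnorm H0 f" by blast
  qed
  show ?thesis
    unfolding hilbert_representation_def
  proof (intro conjI ballI allI)
    show "hilbert_space H0" by (rule hilbert_l2_space)
    show "bounded_operator H0 (reg a)" if "a \<in> carrier D" for a by (rule bounded[OF that])
    show "reg (a \<oplus>\<^bsub>D\<^esub> b) f = reg a f \<oplus>\<^bsub>H0\<^esub> reg b f" if "a \<in> carrier D" "b \<in> carrier D" for a b f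
      by (rule H0_eqI) (simp_all add: l2_space_simps reg_point act_add that off)
    show "reg (c \<odot>\<^bsub>D\<^esub> a) f = c \<odot>\<^bsub>H0\<^esub> reg a f" if "a \<in> carrier D" for c a f
      by (rule H0_eqI) (simp_all add: l2_space_simps reg_point act_smult that off)
    show "reg (a \<otimes>\<^bsub>D\<^esub> b) f = reg a (reg b f)" if "a \<in> carrier D" "b \<in> carrier D" for a b f
      by (rule H0_eqI) (simp_all add: l2_space_simps reg_point act_mult that off)
    show "hinner H0 (reg (star D a) f) g = hinner H0 f (reg a g)"
      if "a \<in> carrier D" "f \<in> carrier H0" "g \<in> carrier H0" for a f g
      using act_adjoint[OF that(1) fl[OF that(2)] fl[OF that(3)]] by (simp add: l2_space_simps reg_point)
  qed
qed

lemma cf_mult_superset: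
  "finite S \<Longrightarrow> supp a \<subseteq> S \<Longrightarrow> cf (a \<otimes>\<^bsub>D\<^esub> b) Z m = (\<Sum>p\<in>S. cf a Z p * cf b (pw p Z) (m - p))"
  unfolding cf_mult by (rule sum.mono_neutral_left) (auto simp: cf_not_supp)

text \<open>If \<open>b\<close> is homogeneous with \<open>|b| \<le> M\<close> then \<open>M\<^sup>2 - b* b\<close> is a positive function on \<open>K\<close>; it has a
  continuous square root.\<close>

lemma homogeneous_bound:
  fixes H :: "('h, 'm) inner_space_scheme"
  assumes b: "b \<in> carrier D" and sb: "supp b \<subseteq> {m}" and M: "0 \<le> M"
    and le: "\<And>Z. Z \<in> K \<Longrightarrow> cmod (cf b Z m) \<le> M"
    and H: "hilbert_representation D H \<pi>" and x: "x \<in> carrier H"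
  shows "hnorm H (\<pi> b x) \<le> M * hnorm H x"
proof -
  let ?c = "star D b \<otimes>\<^bsub>D\<^esub> b"
  have c: "?c \<in> carrier D" by (intro mult_closed star_closed b)
  have cfb: "cf b Z p = (if p = m then cf b Z m else 0)" for Z p using sb cf_not_supp[of p b Z] by auto
  \<comment> \<open>The product b* b has degree 0 only. Its value at \<open>Z\<close> is that of
    |b|^2 at the source of the arrow of degree \<open>m\<close> ending at \<open>Z\<close>.\<close>
  have cfc: "cf ?c Z r = (if r = 0 then of_real ((cmod (cf b (pw (- m) Z) m))\<^sup>2) else 0)" if Z: "Z \<in> K" for Z r
  proof -
    have "cf ?c Z r = (\<Sum>p\<in>{- m}. cf (star D b) Z p * cf b (pw p Z) (r - p))"
      using sb by (intro cf_mult_superset) (auto simp: supp_star)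
    then show ?thesis using Z cfb[of "pw (- m) Z" "r + m"] by (auto simp: cf_star complex_norm_square mult.commute simp del: of_real_power)
  qed
  define w where "w Z = M\<^sup>2 - (cmod (cf b (pw (- m) Z) m))\<^sup>2" for Z
  define g where "g = monomial 0 (\<lambda>Z zs. if Z \<in> K \<and> zs = [] then complex_of_real (sqrt (w Z)) else 0)"
  have wpos: "0 \<le> w Z" if "Z \<in> K" for Z
    using le[of "pw (- m) Z"] that by (simp add: w_def power_mono)
  have c0: "?c 0 Z [] = of_real ((cmod (cf b (pw (- m) Z) m))\<^sup>2)" if "Z \<in> K" for Z
    using cfc[OF that, of 0] that by (simp add: cf_def cf1_def co_def)
  \<comment> \<open>Continuity of |b|^2 comes from b* b being a member of the algebra: its component
    of degree 0 is a continuous function.\<close>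
  have "continuous_on K (\<lambda>Z. ?c 0 Z [])" using sect_D[OF c, of 0] by (simp add: sections_0)
  then have "continuous_on K (\<lambda>Z. complex_of_real (sqrt (M\<^sup>2 - Re (?c 0 Z []))))"
    by (intro continuous_intros)
  then have "continuous_on K (\<lambda>Z. complex_of_real (sqrt (w Z)))"
    by (rule continuous_on_eq) (simp add: c0 w_def)
  then have g: "g \<in> carrier D" unfolding g_def
    by (intro monomial_closed) (simp add: sections_0 cong: continuous_on_cong_simp)
  have sg: "supp (star D g) \<subseteq> {0}"   proof -
    have "supp g \<subseteq> {0}" by (auto simp: g_def supp_def monomial_def)
    then show ?thesis unfolding supp_star by auto
  qed
  have cfg: "cf g Z p = (if p = 0 then of_real (sqrt (w Z)) else 0)" if "Z \<in> K" for Z p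
    using that by (simp add: cf_def cf1_def co_def g_def monomial_def)
  have cfgg: "cf (star D g \<otimes>\<^bsub>D\<^esub> g) Z r = (if r = 0 then of_real (w Z) else 0)" if Z: "Z \<in> K" for Z r
  proof -
    have "cf (star D g \<otimes>\<^bsub>D\<^esub> g) Z r = (\<Sum>p\<in>{0}. cf (star D g) Z p * cf g (pw p Z) (r - p))"
      using sg by (intro cf_mult_superset) auto
    then show ?thesis using Z wpos[OF Z] by (simp add: cf_star cfg flip: of_real_mult)
  qed
  have eq: "?c \<oplus>\<^bsub>D\<^esub> (star D g \<otimes>\<^bsub>D\<^esub> g) = of_real (M\<^sup>2) \<odot>\<^bsub>D\<^esub> \<one>\<^bsub>D\<^esub>"
    by (intro cf_eqI add_closed smult_closed mult_closed star_closed b g one_closed)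
      (simp add: cf_add cf_smult cf_one cfc cfgg w_def)
  interpret star_rep D H \<pi>
    by (intro star_rep.intro star_rep_axioms.intro hilbert.intro complex_star_algebra_D H)
      (use H in \<open>simp only: hilbert_representation_def\<close>)
  show ?thesis by (rule hnorm_rep_le_of_squares[OF b g M eq x])
qed

text \<open>Homogeneous components are split off one by one and their bounds added. Each component
  has a bounded coefficient by compactness of \<open>K\<close>, and this bound holds in every
  representation.\<close>

lemma all_bounded:
  assumes "finite S" "a \<in> carrier D" "supp a \<subseteq> S"
  shows "\<exists>M\<ge>0. \<forall>(H :: ((int \<Rightarrow> 'n sect) \<Rightarrow> complex) inner_space) \<pi>.
      hilbert_representation D H \<pi> \<longrightarrow> (\<forall>x\<in>carrier H. hnorm H (\<pi> a x) \<le> M * hnorm H x)"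
  using assms
proof (induction S arbitrary: a rule: finite_induct)
  case empty
  then have "hnorm H (\<pi> a x) \<le> 0 * hnorm H x"
    if "hilbert_representation D H \<pi>" "x \<in> carrier H" for H :: "((int \<Rightarrow> 'n sect) \<Rightarrow> complex) inner_space" and \<pi> x
    using homogeneous_bound[of a 0 0 H \<pi> x] that by (simp add: cf_not_supp)
  then show ?case by (intro exI[of _ 0]) blast
next
  case (insert m S)
  let ?b = "monomial m (a m)" and ?c = "a(m := \<lambda>Z zs. 0)"
  have b: "?b \<in> carrier D" by (intro monomial_closed sect_D insert.prems)
  have sc: "supp ?c \<subseteq> S" using insert.prems by (auto simp: supp_def)
  have c: "?c \<in> carrier D"
    using finite_subset[OF sc insert.hyps(1)] sect_D[OF insert.prems(1)] sections_zero by (simp add: carrier_D)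
  have ac: "a = ?c \<oplus>\<^bsub>D\<^esub> ?b" by (auto simp: fun_eq_iff add_D monomial_def)
  obtain M1 where M1: "M1 \<ge> 0" "\<And>(H :: ((int \<Rightarrow> 'n sect) \<Rightarrow> complex) inner_space) \<pi> x.
      hilbert_representation D H \<pi> \<Longrightarrow> x \<in> carrier H \<Longrightarrow> hnorm H (\<pi> ?c x) \<le> M1 * hnorm H x"
    using insert.IH[OF c sc] by blast
  obtain M2 where M2: "M2 \<ge> 0" "\<And>Z. cmod (cf ?b Z m) \<le> M2" using cf_bounded[OF b] by blast
  have sb: "supp ?b \<subseteq> {m}" by (auto simp: supp_def monomial_def)
  have "hnorm H (\<pi> a x) \<le> (M1 + M2) * hnorm H x"
    if H: "hilbert_representation D H \<pi>" and x: "x \<in> carrier H"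
    for H :: "((int \<Rightarrow> 'n sect) \<Rightarrow> complex) inner_space" and \<pi> x
  proof -
    interpret star_rep D H \<pi>
      by (intro star_rep.intro star_rep_axioms.intro hilbert.intro complex_star_algebra_D H)
        (use H in \<open>simp only: hilbert_representation_def\<close>)
    have "\<pi> a x = \<pi> ?c x \<oplus>\<^bsub>H\<^esub> \<pi> ?b x" using rep_add[OF c b x] ac by simp
    then show ?thesis using H.hnorm_triangle[OF rep_closed[OF c x] rep_closed[OF b x]]
        M1(2)[OF H x] homogeneous_bound[OF b sb M2(1) M2(2) H x] by (simp add: distrib_right)
  qed
  then show ?case using M1(1) M2(1) by (intro exI[of _ "M1 + M2"]) auto
qed

lemma universally_bounded_D: "universally_bounded D"
proof (intro universally_bounded.intro universally_bounded_axioms.intro complex_star_algebra_D)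
  show "\<exists>(H :: ((int \<Rightarrow> 'n sect) \<Rightarrow> complex) inner_space) \<pi>. hilbert_representation D H \<pi>"
    using hilbert_representation_reg by blast
  show "\<exists>M\<ge>0. \<forall>(H :: ((int \<Rightarrow> 'n sect) \<Rightarrow> complex) inner_space) \<pi>.
      hilbert_representation D H \<pi> \<longrightarrow> (\<forall>x\<in>carrier H. hnorm H (\<pi> a x) \<le> M * hnorm H x)" if "a \<in> carrier D" for a
    by (rule all_bounded[OF fin_D[OF that] that order_refl])
qed

text \<open>The coefficient is a matrix entry in the representation on square summable functions:
  the image of a unit delta function, evaluated at \<open>(Z, 0)\<close>.\<close>

lemma cf_le_universal_norm:
  assumes Z: "Z \<in> K" and a: "a \<in> carrier D"
  shows "cmod (cf a Z m) \<le> universal_norm D a"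
proof -
  interpret U: universally_bounded D by (rule universally_bounded_D)
  let ?y = "tr m (Z, 0)"
  define f where "f = (\<lambda>y. if y = point_index ?y then 1 else (0::complex))"
  have fp: "f (point_index x) = (if x = ?y then 1 else 0)" for x
    by (simp add: f_def inj_eq[OF inj_point_index])
  have s: "(\<Sum>x\<in>F. (cmod (f (point_index x)))\<^sup>2) \<le> 1" if "finite F" for F
    using that by (simp add: fp if_distrib[of cmod] if_distrib[of "\<lambda>x. x\<^sup>2"] cong: if_cong)
  have fl: "l2 (\<lambda>x. f (point_index x))" "sqnorm (\<lambda>x. f (point_index x)) \<le> 1"
    by (rule l2_finite_sums[OF s], assumption)+
  have f: "f \<in> carrier H0" using fl by (auto simp: l2_space_simps f_def)
  have nf: "hnorm H0 f \<le> 1" using fl by (simp add: hnorm_l2_space)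
  interpret star_rep D H0 reg by (rule U.star_repI[OF hilbert_representation_reg])
  have l: "l2 (\<lambda>x. reg a f (point_index x))" using rep_closed[OF a f] by (simp add: l2_space_simps)
  have "cf a Z m = reg a f (point_index (Z, 0))"
    using act_delta[OF Z a, of m] by (simp add: reg_point fp[abs_def])
  then have "(cmod (cf a Z m))\<^sup>2 \<le> (hnorm H0 (reg a f))\<^sup>2"
    using l2_eval[OF l, of "(Z, 0)"] l by (simp add: hnorm_l2_space sqnorm_nonneg)
  then have "cmod (cf a Z m) \<le> hnorm H0 (reg a f)"
    by (rule power2_le_imp_le) (rule H.hnorm_nonneg[OF rep_closed[OF a f]])
  also have "\<dots> \<le> universal_norm D a * hnorm H0 f" by (rule U.universal_bound[OF a hilbert_representation_reg f])
  also have "\<dots> \<le> universal_norm D a" using nf U.universal_norm_nonneg[OF a] by (simp add: mult_left_le)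
  finally show ?thesis .
qed

lemma homogeneous_universal_norm:
  assumes b: "b \<in> carrier D" and sb: "supp b \<subseteq> {m}" and M: "0 \<le> M"
    and le: "\<And>Z. Z \<in> K \<Longrightarrow> cmod (cf b Z m) \<le> M"
  shows "universal_norm D b \<le> M"
proof -
  interpret U: universally_bounded D by (rule universally_bounded_D)
  show ?thesis by (rule U.universal_norm_le[OF _ M]) (rule homogeneous_bound[OF b sb M le])
qed

lemma seminormed_D: "seminormed_star D (universal_norm D)"
proof -
  interpret U: universally_bounded D by (rule universally_bounded_D)
  show ?thesis
    by (intro seminormed_star.intro complex_star_algebra_D seminormed_star_axioms.intro
        U.universal_norm_nonneg U.universal_norm_add U.universal_norm_smult
        U.universal_norm_mult U.universal_norm_star)
qed

end

section \<open>The homomorphism \<open>\<theta>\<close>\<close>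

locale central_form = quadratic_star_locale R st j
  for R :: "(complex^'n^'n::finite) set" and st j +
  fixes E K :: "'n proj set" and \<sigma> :: "'n proj \<Rightarrow> 'n proj" and Q :: "complex^'n^'n"
  assumes char: "characteristic_data R E \<sigma>"
    and compact: "compact K" and K_E: "K \<subseteq> E" and \<sigma>_K: "\<sigma> ` K = K"
    and sym: "transpose Q = Q"
    and central: "central_on R E \<sigma> Q ((\<lambda>Z. (Z, proj_conj j Z)) ` K)"
    and positive: "strictly_positive_on j Q K"
begin

abbreviation h where "h \<equiv> metric_fun j Q"
abbreviation cj where "cj \<equiv> proj_conj j"

lemma char_iff: "(Z, Z') \<in> char_relation R \<longleftrightarrow> Z \<in> E \<and> Z' = \<sigma> Z"
proof -
  have "char_relation R = (\<lambda>Z. (Z, \<sigma> Z)) ` E" using char unfolding characteristic_data_def by (elim conjE)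
  then show ?thesis by auto
qed

lemma inj_E: "inj_on \<sigma> E" and image_E: "\<sigma> ` E = E"
  using char unfolding characteristic_data_def bij_betw_def by simp_all

lemma char_rep: "(Z, Z') \<in> char_relation R \<longleftrightarrow> (\<forall>w\<in>R. bform w (rep Z) (rep Z') = 0)"
proof
  assume "(Z, Z') \<in> char_relation R"
  then show "\<forall>w\<in>R. bform w (rep Z) (rep Z') = 0" using rep_in_line unfolding char_relation_def by blast
next
  assume r: "\<forall>w\<in>R. bform w (rep Z) (rep Z') = 0"
  have "bform w z z' = 0" if "w \<in> R" "z \<in> line Z" "z' \<in> line Z'" for w z z'
  proof -
    obtain c d where "z = c *s rep Z" "z' = d *s rep Z'"
      using \<open>z \<in> line Z\<close> \<open>z' \<in> line Z'\<close> unfolding line_rep[of Z] line_rep[of Z'] by blast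
    then show ?thesis using r \<open>w \<in> R\<close> by (simp add: bform_scale)
  qed
  then show "(Z, Z') \<in> char_relation R" unfolding char_relation_def by blast
qed

lemma inv_E: "Z \<in> K \<Longrightarrow> inv_into E \<sigma> Z = inv_into K \<sigma> Z"
proof -
  assume "Z \<in> K"
  then obtain Y where Y: "Y \<in> K" "Z = \<sigma> Y" using \<sigma>_K by blast
  then show ?thesis using K_E inj_E inj_on_subset[OF inj_E K_E] by (simp add: inv_into_f_f subset_iff)
qed

lemma symQ: "bform Q z z' = bform Q z' z"
  using bform_transpose[of Q z' z] sym by simp

lemma metric_scale: "h (c *s z) = of_real ((cmod c)\<^sup>2) * h z"
  by (simp add: metric_fun_def dual_conj_scale bform_scale complex_norm_square del: of_real_power)

lemma metric_pos: "Z \<in> K \<Longrightarrow> \<exists>r>0. h (rep Z) = complex_of_real r"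
  using positive rep_in_line[of Z] rep_nonzero[of Z] unfolding strictly_positive_on_def metric_fun_def by blast

lemma closed_pairs:
  "closed {p :: (complex^'n) \<times> (complex^'n). \<forall>w\<in>R'. bform w (fst p) (snd p) = 0}"
proof -
  have "closed {p :: (complex^'n) \<times> (complex^'n). bform w (fst p) (snd p) = 0}" for w
    by (intro closed_Collect_eq continuous_bform continuous_intros)
  then have "closed (\<Inter>w\<in>R'. {p :: (complex^'n) \<times> (complex^'n). bform w (fst p) (snd p) = 0})" by blast
  then show ?thesis by (simp add: Collect_ball_eq)
qed

lemma continuous_\<sigma>: "continuous_on K \<sigma>"
proof (subst continuous_on_closed_invariant, intro allI impI)
  fix B :: "'n proj set" assume B: "closed B"
  let ?S = "{p :: (complex^'n) \<times> (complex^'n). \<forall>w\<in>R. bform w (fst p) (snd p) = 0}"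
  have "closed {Z. \<exists>Z'\<in>B. (rep Z, rep Z') \<in> ?S}"
    by (rule closed_proj_projection[OF closed_pairs B]) (simp add: bform_scale)
  moreover have "{Z. \<exists>Z'\<in>B. (rep Z, rep Z') \<in> ?S} \<inter> K = \<sigma> -` B \<inter> K"
    using K_E char_iff char_rep by auto
  ultimately show "\<exists>A. closed A \<and> A \<inter> K = \<sigma> -` B \<inter> K" by blast
qed

text \<open>The inverse has the graph of \<sigma> with the factors exchanged; it is cut out by the
  transposed relations and therefore closed as well.\<close>

lemma continuous_inv_\<sigma>: "continuous_on K (inv_into K \<sigma>)"
proof (subst continuous_on_closed_invariant, intro allI impI)
  fix B :: "'n proj set" assume B: "closed B"
  let ?S = "{p :: (complex^'n) \<times> (complex^'n). \<forall>w\<in>transpose ` R. bform w (fst p) (snd p) = 0}"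
  have "closed {Z. \<exists>Z'\<in>B. (rep Z, rep Z') \<in> ?S}"
    by (rule closed_proj_projection[OF closed_pairs B]) (simp add: bform_scale)
  moreover have "{Z. \<exists>Z'\<in>B. (rep Z, rep Z') \<in> ?S} \<inter> K = inv_into K \<sigma> -` B \<inter> K"
  proof -
    have "(rep Z, rep Z') \<in> ?S \<longleftrightarrow> Z' = inv_into K \<sigma> Z" if Z: "Z \<in> K" for Z Z'
    proof -
      have "(rep Z, rep Z') \<in> ?S \<longleftrightarrow> Z' \<in> E \<and> Z = \<sigma> Z'"
        using char_iff[of Z' Z] char_rep[of Z' Z] by (simp add: bform_transpose)
      also have "\<dots> \<longleftrightarrow> Z' = inv_into K \<sigma> Z"
        using Z inv_E[OF Z] image_E K_E \<sigma>_K inj_E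
        by (metis f_inv_into_f inv_into_f_f inv_into_into subsetD)
      finally show ?thesis .
    qed
    then show ?thesis by auto
  qed
  ultimately show "\<exists>A. closed A \<and> A \<inter> K = inv_into K \<sigma> -` B \<inter> K" by blast
qed

text \<open>Numerator and denominator both scale by |c|^2. Divided by the squared norm of the
  vector, each becomes a continuous function on the projective space, and the auxiliary norms cancel
  in the quotient.\<close>

lemma continuous_metric:
  "continuous_on K (\<lambda>Z. pairing L (rep Z) * cnj (pairing L' (rep Z)) / h (rep Z))"
proof -
  have c: "continuous_on K (\<lambda>Z. g (rep Z) / of_real ((norm (rep Z))\<^sup>2))"
    if g: "continuous_on UNIV g" and hom: "\<And>c z. g (c *s z) = of_real ((cmod c)\<^sup>2) * g z" for g :: "complex^'n \<Rightarrow> complex"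
  proof (rule continuous_on_proj)
    have "g (rep (point z)) / of_real ((norm (rep (point z)))\<^sup>2) = g z / of_real ((norm z)\<^sup>2)" if z: "z \<noteq> 0" for z
    proof -
      obtain c where c: "rep (point z) = c *s z" using rep_in_line[of "point z"] line_point[OF z] by auto
      then have "c \<noteq> 0" using rep_nonzero[of "point z"] by auto
      then show ?thesis by (simp add: c hom norm_cscale power_mult_distrib)
    qed
    moreover have "continuous_on (- {0}) (\<lambda>z. g z / of_real ((norm z)\<^sup>2))"
      by (intro continuous_on_divide continuous_on_subset[OF g] continuous_intros) auto
    ultimately show "continuous_on (- {0}) (\<lambda>z. g (rep (point z)) / of_real ((norm (rep (point z)))\<^sup>2))"
      by (subst continuous_on_cong[OF refl]) auto
  qed
  have hc: "continuous_on UNIV h"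
    unfolding metric_fun_def[abs_def] by (intro continuous_bform continuous_dual_conj continuous_on_id)
  have pc: "continuous_on UNIV (\<lambda>z. pairing L z * cnj (pairing L' z))"
    by (intro continuous_intros continuous_pairing)
  have "continuous_on K (\<lambda>Z. (pairing L (rep Z) * cnj (pairing L' (rep Z)) / of_real ((norm (rep Z))\<^sup>2)) / (h (rep Z) / of_real ((norm (rep Z))\<^sup>2)))"
  proof (intro continuous_on_divide[OF c[OF pc] c[OF hc metric_scale]] ballI)
    fix Z assume "Z \<in> K"
    then have "h (rep Z) \<noteq> 0" using metric_pos by force
    then show "h (rep Z) / of_real ((norm (rep Z))\<^sup>2) \<noteq> 0" using rep_nonzero[of Z] by simp
  qed (simp add: pairing_scale_right complex_norm_square del: of_real_power)
  then show ?thesis by (rule continuous_on_eq) (simp add: rep_nonzero)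
qed

sublocale twisted K \<sigma> h
  using compact \<sigma>_K inj_on_subset[OF inj_E K_E] continuous_\<sigma> continuous_inv_\<sigma> metric_pos continuous_metric
  by unfold_locales

sublocale S: seminormed_star D "universal_norm D"
  by (rule seminormed_D)

text \<open>Conjugation reverses the pairs of the characteristic relation: (Y, \<sigma> Y) becomes
  (\<open>cj (\<sigma> Y)\<close>, \<open>cj Y\<close>). This places the first entry in
  \<open>E\<close> and identifies its image under \<sigma>.\<close>

lemma cj_E: "Z \<in> E \<Longrightarrow> cj Z \<in> E"
  and \<sigma>_cj: "Z \<in> K \<Longrightarrow> \<sigma> (cj Z) = cj (\<tau> Z)"
proof -
  show "cj Z \<in> E" if "Z \<in> E"
  proof -
    have "Z \<in> \<sigma> ` E" using that image_E by simp
    then obtain Y where Y: "Y \<in> E" "Z = \<sigma> Y" by (elim imageE)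
    then have "(cj Z, cj Y) \<in> char_relation R" by (intro char_relation_conj) (simp add: char_iff)
    then show ?thesis by (simp add: char_iff)
  qed
  show "\<sigma> (cj Z) = cj (\<tau> Z)" if "Z \<in> K"
  proof -
    have "(\<tau> Z, Z) \<in> char_relation R" using subsetD[OF K_E \<tau>_in[OF that]] \<sigma>\<tau>[OF that] by (simp add: char_iff)
    then have "(cj Z, cj (\<tau> Z)) \<in> char_relation R" by (rule char_relation_conj)
    then show ?thesis by (simp add: char_iff)
  qed
qed

text \<open>The representative with \<open>Q(z, j z) = 1\<close>.\<close>

definition ap :: "'n proj \<Rightarrow> complex^'n" where
  "ap Z = complex_of_real (inverse (\<kappa> Z)) *s rep Z"

lemma ap_in_line: "ap Z \<in> line Z"
  unfolding ap_def by (intro scale_in_line rep_in_line)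

lemma jd_ap_in_line: "jd (ap Z) \<in> line (cj Z)"
  using ap_in_line by (simp add: line_proj_conj)

lemma Q_ap: "Z \<in> K \<Longrightarrow> bform Q (ap Z) (jd (ap Z)) = 1"
  using \<kappa>_pos[of Z] h_rep[of Z] metric_scale[of "of_real (inverse (\<kappa> Z))" "rep Z"]
  by (simp add: metric_fun_def ap_def norm_inverse power_inverse)

lemma phi_single: "phi [Y] Z = pairing Y (ap Z)"
  by (simp add: ap_def pairing_scale_right divide_inverse mult.commute)

lemma co_lin_section: "Z \<in> K \<Longrightarrow> co 1 (lin_section K Y) Z = pairing Y (ap Z)"
  using phi_single[of Y Z] rep_in_line[of Z] by (simp add: co_def lin_section_def lift_Suc)

lemma lin_section_in: "lin_section K Y \<in> sections K \<sigma> 1"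
  unfolding sections_iff
proof (intro conjI)
  show "zero_off 1 (lin_section K Y)"
    by (auto simp: zero_off_def lin_section_def fibre_args_def split: list.splits)
  show "multilin 1 (lin_section K Y)"
    unfolding multilin_def
  proof (intro ballI allI impI)
    fix Z and cs :: "complex list" assume Z: "Z \<in> K" and "length cs = 1"
    then obtain c where "cs = [c]" by (auto simp: length_Suc_conv)
    then show "lin_section K Y Z (scaled_lift \<sigma> cs Z) = prod_list cs * lin_section K Y Z (lift \<sigma> 1 Z)"
      using Z scale_in_line[OF rep_in_line[of Z], of c] rep_in_line[of Z]
      by (simp add: lin_section_def lift_Suc pairing_scale_right)
  qed
  show "cosec 1 (co 1 (lin_section K Y))"
    unfolding cosec_def
  proof (intro allI impI)
    fix vs :: "(complex^'n) list" assume "length vs = 1"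
    then have "continuous_on K (\<lambda>Z. phi [Y] Z * cnj (phi vs Z))" by (intro continuous_phi) simp
    then show "continuous_on K (\<lambda>Z. co 1 (lin_section K Y) Z * cnj (phi vs Z))"
      by (rule continuous_on_eq) (simp add: co_lin_section phi_single del: phi.simps One_nat_def)
  qed
qed

text \<open>The element \<open>Y W + W* (j Y)*\<close>, that is, sqrt 2 times the image of
  \<open>Y\<close>. In degree -1 the section of \<open>j Y\<close> itself is stored, since negative
  components are conjugate linear coordinates.\<close>

definition gg :: "complex^'n \<Rightarrow> int \<Rightarrow> 'n sect" where
  "gg Y = monomial 1 (lin_section K Y) \<oplus>\<^bsub>D\<^esub> monomial (- 1) (lin_section K (j Y))"

lemma mono_closed: "monomial 1 (lin_section K Y) \<in> carrier D" "monomial (- 1) (lin_section K Y) \<in> carrier D"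
  by (intro monomial_closed, simp add: lin_section_in[unfolded One_nat_def])+

lemma supp_monomial: "supp (monomial m \<xi>) \<subseteq> {m}"
  by (auto simp: supp_def monomial_def)

lemma gg_closed: "gg Y \<in> carrier D"
  unfolding gg_def by (intro add_closed mono_closed)

text \<open>In degree -1 the coefficient is the conjugate of the value of \<open>j Y\<close> at the
  previous point, and the definition of the dual involution turns it into the value of
  \<open>Y\<close> at a conjugate vector.\<close>

lemma cf_mono: 
  assumes Z: "Z \<in> K"
  shows "cf (monomial 1 (lin_section K Y)) Z m = (if m = 1 then pairing Y (ap Z) else 0)"
    and "cf (monomial (- 1) (lin_section K (j Y))) Z m = (if m = - 1 then pairing Y (jd (ap (\<tau> Z))) else 0)"
proof -
  have z: "cf1 m (\<lambda>Z zs. 0) Z = 0" by (simp add: cf1_def co_def)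
  show "cf (monomial 1 (lin_section K Y)) Z m = (if m = 1 then pairing Y (ap Z) else 0)"
    using Z co_lin_section[OF Z, of Y] by (auto simp: cf_def z monomial_def) (simp add: cf1_def)
  show "cf (monomial (- 1) (lin_section K (j Y))) Z m = (if m = - 1 then pairing Y (jd (ap (\<tau> Z))) else 0)"
    using Z co_lin_section[OF \<tau>_in[OF Z], of "j Y"]
    by (auto simp: cf_def z monomial_def) (simp add: cf1_def pw_minus_1 pairing_j)
qed

text \<open>The vector on which \<open>Y\<close> is evaluated to give the coefficient of
  \<open>gg Y\<close> in degree \<open>p\<close>. With it the product of two generators becomes the
  evaluation of a bilinear form on two such vectors.\<close>

definition vec_at :: "int \<Rightarrow> 'n proj \<Rightarrow> complex^'n" where
  "vec_at p Z = (if p = 1 then ap Z else if p = - 1 then jd (ap (\<tau> Z)) else 0)"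

lemma cf_gg: "Z \<in> K \<Longrightarrow> cf (gg Y) Z m = pairing Y (vec_at m Z)"
  by (simp add: gg_def cf_add cf_mono vec_at_def)

definition gen :: "'n \<Rightarrow> int \<Rightarrow> 'n sect" where
  "gen i = complex_of_real (1 / sqrt 2) \<odot>\<^bsub>D\<^esub> gg (axis i 1)"

lemma gen_closed: "gen i \<in> carrier D"
  unfolding gen_def by (intro smult_closed gg_closed)

lemma cf_gen: "Z \<in> K \<Longrightarrow> cf (gen i) Z m = complex_of_real (1 / sqrt 2) * vec_at m Z $ i"
  by (simp add: gen_def cf_smult cf_gg pairing_axis)

lemma supp_gen: "supp (gen i) \<subseteq> {1, - 1}"
  by (auto simp: supp_def gen_def gg_def smult_D add_D monomial_def)

abbreviation \<Phi> where "\<Phi> \<equiv> S.tensor_lift gen"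

lemma cf_finsum: "finite I \<Longrightarrow> F \<in> I \<rightarrow> carrier D \<Longrightarrow> cf (finsum D F I) Z m = (\<Sum>i\<in>I. cf (F i) Z m)"
proof (induction I rule: finite_induct)
  case empty
  then show ?case by (simp add: cf_zero)
next
  case (insert i I)
  then have "F i \<in> carrier D" "F \<in> I \<rightarrow> carrier D" by auto
  then show ?case using insert by (simp add: S.finsum_insert cf_add)
qed

lemma cf_\<Phi>:
  assumes "finite W" "{w. f w \<noteq> 0} \<subseteq> W"
  shows "cf (\<Phi> f) Z m = (\<Sum>w\<in>W. f w * cf (S.word_prod gen w) Z m)"
  using assms S.tensor_lift_superset[of gen W f] gen_closed S.word_prod_closed[of gen]
  by (simp add: cf_finsum cf_smult smult_closed)

lemma \<Phi>_tensor1: "\<Phi> (tensor1 v) = complex_of_real (1 / sqrt 2) \<odot>\<^bsub>D\<^esub> gg v"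
proof (intro cf_eqI S.tensor_lift_closed gen_closed smult_closed gg_closed)
  fix Z m assume Z: "Z \<in> K"
  have "{w. tensor1 v w \<noteq> 0} \<subseteq> (\<lambda>i. [i]) ` UNIV"
  proof
    fix x assume "x \<in> {x. tensor1 v x \<noteq> 0}"
    then show "x \<in> (\<lambda>i. [i]) ` UNIV" by (cases x; cases "tl x") (auto simp: tensor1_def)
  qed
  then have "cf (\<Phi> (tensor1 v)) Z m = (\<Sum>w\<in>(\<lambda>i. [i]) ` UNIV. tensor1 v w * cf (S.word_prod gen w) Z m)"
    by (intro cf_\<Phi>) auto
  also have "\<dots> = (\<Sum>i\<in>UNIV. v $ i * cf (gen i) Z m)"
    by (subst sum.reindex) (auto simp: inj_on_def tensor1_def gen_closed)
  also have "\<dots> = complex_of_real (1 / sqrt 2) * pairing v (vec_at m Z)"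
    by (simp add: cf_gen[OF Z] pairing_def sum_distrib_left mult_ac)
  finally show "cf (\<Phi> (tensor1 v)) Z m = cf (complex_of_real (1 / sqrt 2) \<odot>\<^bsub>D\<^esub> gg v) Z m"
    by (simp add: cf_smult cf_gg[OF Z])
qed

lemma cf_gen_gen:
  assumes Z: "Z \<in> K"
  shows "cf (gen i \<otimes>\<^bsub>D\<^esub> gen k) Z m = (1 / 2) * (\<Sum>p\<in>{1, - 1}. vec_at p Z $ i * vec_at (m - p) (pw p Z) $ k)"
proof -
  have "1 / sqrt 2 * (1 / sqrt 2) = (1 / 2 :: real)" by simp
  then have "complex_of_real (1 / sqrt 2) * complex_of_real (1 / sqrt 2) = complex_of_real (1 / 2)"
    by (simp only: of_real_mult[symmetric])
  then have half: "complex_of_real (1 / sqrt 2) * complex_of_real (1 / sqrt 2) = 1 / 2" by (simp only: of_real_divide of_real_1 of_real_numeral)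
  have "cf (gen i \<otimes>\<^bsub>D\<^esub> gen k) Z m = (\<Sum>p\<in>{1, - 1}. cf (gen i) Z p * cf (gen k) (pw p Z) (m - p))"
    by (rule cf_mult_superset) (use supp_gen in auto)
  also have "\<dots> = (\<Sum>p\<in>{1, - 1}. (complex_of_real (1 / sqrt 2) * complex_of_real (1 / sqrt 2)) * (vec_at p Z $ i * vec_at (m - p) (pw p Z) $ k))"
    using Z by (intro sum.cong refl) (simp add: cf_gen mult_ac del: of_real_divide)
  finally show ?thesis by (simp only: half sum_distrib_left)
qed

lemma cf_tensor2:
  assumes Z: "Z \<in> K"
  shows "cf (\<Phi> (tensor2 w)) Z m = (1 / 2) * (\<Sum>p\<in>{1, - 1}. bform w (vec_at p Z) (vec_at (m - p) (pw p Z)))"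
proof -
  have "{x. tensor2 w x \<noteq> 0} \<subseteq> (\<lambda>(i, k). [i, k]) ` UNIV"
  proof
    fix x assume "x \<in> {x. tensor2 w x \<noteq> 0}"
    then obtain i k where "x = [i, k]" by (auto simp: tensor2_def split: list.splits)
    then show "x \<in> (\<lambda>(i, k). [i, k]) ` UNIV" by (auto intro: rev_image_eqI[of "(i, k)"])
  qed
  then have "cf (\<Phi> (tensor2 w)) Z m = (\<Sum>x\<in>(\<lambda>(i, k). [i, k]) ` UNIV. tensor2 w x * cf (S.word_prod gen x) Z m)"
    by (intro cf_\<Phi>) auto
  also have "\<dots> = (\<Sum>(i, k)\<in>UNIV. w $ i $ k * cf (gen i \<otimes>\<^bsub>D\<^esub> gen k) Z m)"
    by (subst sum.reindex) (auto simp: inj_on_def tensor2_def gen_closed case_prod_beta intro!: sum.cong)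
  also have "\<dots> = (\<Sum>i\<in>UNIV. \<Sum>k\<in>UNIV. w $ i $ k * cf (gen i \<otimes>\<^bsub>D\<^esub> gen k) Z m)"
    unfolding UNIV_Times_UNIV[symmetric] by (rule sum.cartesian_product[symmetric])
  also have "\<dots> = (1 / 2) * (bform w (vec_at 1 Z) (vec_at (m - 1) (pw 1 Z)) + bform w (vec_at (- 1) Z) (vec_at (m - (- 1)) (pw (- 1) Z)))"
    by (simp add: cf_gen_gen[OF Z] bform_def sum_distrib_left sum.distrib algebra_simps add_divide_distrib sum_divide_distrib)
  finally show ?thesis by simp
qed

lemma bform_zero_left [simp]: "bform w 0 z = 0" and bform_zero_right [simp]: "bform w z 0 = 0"
  by (simp_all add: bform_def)

lemma cf_tensor2_cases:
  assumes Z: "Z \<in> K"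
  shows "cf (\<Phi> (tensor2 w)) Z m = (if m = 2 then bform w (ap Z) (ap (\<sigma> Z))
     else if m = - 2 then bform w (jd (ap (\<tau> Z))) (jd (ap (\<tau> (\<tau> Z))))
     else if m = 0 then bform w (ap Z) (jd (ap Z)) + bform w (jd (ap (\<tau> Z))) (ap (\<tau> Z)) else 0) / 2"
  unfolding cf_tensor2[OF Z] using Z by (auto simp: vec_at_def pw_1 pw_minus_1)

lemma conj_pair: "Z \<in> K \<Longrightarrow> (cj (\<tau> Z), cj (\<tau> (\<tau> Z))) \<in> char_relation R"
  using cj_E[OF subsetD[OF K_E \<tau>_in]] \<sigma>_cj[of "\<tau> Z"] \<tau>_in[of Z] char_iff by auto

lemma \<Phi>_relation:
  assumes w: "w \<in> R" shows "\<Phi> (tensor2 w) = \<zero>\<^bsub>D\<^esub>"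
proof (intro cf_eqI S.tensor_lift_closed gen_closed zero_closed)
  fix Z m assume Z: "Z \<in> K"
  have rel: "bform w z z' = 0" if "(Y, Y') \<in> char_relation R" "z \<in> line Y" "z' \<in> line Y'" for z z' Y Y'
    using that w by (auto simp: char_relation_def)
  have ZE: "Z \<in> E" using Z K_E by blast
  have "bform w (ap Z) (ap (\<sigma> Z)) = 0" using rel[of Z "\<sigma> Z"] ZE char_iff ap_in_line by blast
  moreover have "bform w (jd (ap (\<tau> Z))) (jd (ap (\<tau> (\<tau> Z)))) = 0"
    using rel[OF conj_pair[OF Z]] jd_ap_in_line by blast
  moreover have "bform w (ap Z) (jd (ap Z)) + bform w (jd (ap (\<tau> Z))) (ap (\<tau> Z)) = 0"
  proof -
    have c: "bform w z z' * bform Q u u' + bform Q z z' * bform w u u' = 0"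
      if "z \<in> line Z" "z' \<in> line (cj Z)" "u \<in> line (\<sigma> (cj Z))" "u' \<in> line (inv_into E \<sigma> Z)" for z z' u u'
    proof -
      have "(Z, cj Z) \<in> (\<lambda>Z. (Z, cj Z)) ` K" using Z by blast
      with central w that show ?thesis unfolding central_on_def by blast
    qed
    \<comment> \<open>Centrality is applied at \<open>(Z, cj Z)\<close>. As \<sigma> maps
      \<open>cj Z\<close> to \<open>cj (\<tau> Z)\<close>, the vectors
      \<open>jd (ap (\<tau> Z))\<close> and \<open>ap (\<tau> Z)\<close> are admissible, and both
      values of \<open>Q\<close> are 1 by normalisation and symmetry.\<close>
    have "bform w (ap Z) (jd (ap Z)) * bform Q (jd (ap (\<tau> Z))) (ap (\<tau> Z))
        + bform Q (ap Z) (jd (ap Z)) * bform w (jd (ap (\<tau> Z))) (ap (\<tau> Z)) = 0"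
      using Z by (intro c) (auto simp: ap_in_line jd_ap_in_line \<sigma>_cj inv_E)
    then show ?thesis using Q_ap[OF Z] Q_ap[OF \<tau>_in[OF Z]] symQ[of "jd (ap (\<tau> Z))" "ap (\<tau> Z)"] by simp
  qed
  ultimately show "cf (\<Phi> (tensor2 w)) Z m = cf \<zero>\<^bsub>D\<^esub> Z m"
    unfolding cf_tensor2_cases[OF Z] cf_zero by simp
qed

lemma relation_ideal_kernel:
  assumes f: "f \<in> relation_ideal R" shows "\<Phi> f = \<zero>\<^bsub>D\<^esub>"
proof -
  have "ring_hom_ring tensor_algebra D \<Phi>"
    by (intro ring_hom_ringI2 ring_tensor_algebra ring_D ring_hom_memI)
      (simp_all add: S.tensor_lift_closed S.tensor_lift_mult S.tensor_lift_add S.tensor_lift_one gen_closed)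
  then interpret hom: ring_hom_ring tensor_algebra D \<Phi> .
  have "relation_ideal R \<subseteq> a_kernel tensor_algebra D \<Phi>"
    unfolding relation_ideal_def
  proof (intro T.genideal_minimal hom.kernel_is_ideal image_subsetI)
    fix w assume "w \<in> R"
    then show "tensor2 w \<in> a_kernel tensor_algebra D \<Phi>"
      unfolding a_kernel_def' by (intro CollectI conjI tensor2_closed \<Phi>_relation)
  qed
  then have "f \<in> a_kernel tensor_algebra D \<Phi>" using f by (rule subsetD)
  then show "\<Phi> f = \<zero>\<^bsub>D\<^esub>" unfolding a_kernel_def' by blast
qed

section \<open>The map on the quotient algebra, its homomorphism property and uniqueness\<close>

definition theta :: "('n list \<Rightarrow> complex) set \<Rightarrow> (nat \<Rightarrow> int \<Rightarrow> 'n sect) set" where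
  "theta X = S.emb (\<Phi> (SOME x. x \<in> X))"

text \<open>Two representatives of a class differ by an element of the relation ideal, which the
  lift annihilates; hence the choice in \<open>theta\<close> is immaterial.\<close>

lemma theta_cls:
  assumes f: "f \<in> carrier tensor_algebra" shows "theta (cls R f) = S.emb (\<Phi> f)"
proof -
  define y where "y = (SOME x. x \<in> cls R f)"
  have "y \<in> cls R f" unfolding y_def by (rule someI[of "\<lambda>x. x \<in> cls R f", OF cls_self[OF f]])
  then have y: "y \<in> carrier tensor_algebra" "cls R y = cls R f" using mem_cls[OF f] by blast+
  then have "y \<ominus>\<^sub>T f \<in> relation_ideal R" using cls_eq_iff[OF y(1) f] by blast
  then have z: "\<Phi> (y \<ominus>\<^sub>T f) = \<zero>\<^bsub>D\<^esub>" by (rule relation_ideal_kernel)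
  have "y = (y \<ominus>\<^sub>T f) \<oplus>\<^sub>T f"
    using y(1) f by (simp add: a_minus_def T.a_assoc T.l_neg)
  then have "\<Phi> y = \<Phi> ((y \<ominus>\<^sub>T f) \<oplus>\<^sub>T f)" by (rule arg_cong)
  also have "\<dots> = \<Phi> (y \<ominus>\<^sub>T f) \<oplus>\<^bsub>D\<^esub> \<Phi> f"
    by (rule S.tensor_lift_add[of gen, OF gen_closed T.minus_closed[OF y(1) f] f])
  finally show ?thesis using z S.tensor_lift_closed[of gen f, OF gen_closed] by (simp add: theta_def y_def)
qed

abbreviation AA where "AA \<equiv> quadratic_star_algebra R st"
abbreviation BB where "BB \<equiv> crossed_product K \<sigma> h"

lemma BB_eq: "BB = S.CB" and crossed_embed_eq: "crossed_embed K \<sigma> h = S.emb"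
  by (simp_all add: crossed_product_def crossed_embed_def)

lemma AA_simps: "carrier AA = carrier QA" "mult AA = mult QA" "one AA = one QA" "add AA = add QA"
    "smult AA = smult QA" "star AA = st"
  by (simp_all add: quadratic_star_algebra_def Let_def)

lemma \<Phi>_closed: "\<Phi> f \<in> carrier D"
  by (rule S.tensor_lift_closed[OF gen_closed])

lemma gg_star: "star D (gg Y) = gg (j Y)"
proof (intro cf_eqI star_closed gg_closed)
  fix Z m assume Z: "Z \<in> K"
  have zero: "jd 0 = 0" by (simp only: dual_conj_zero_iff)
  show "cf (star D (gg Y)) Z m = cf (gg (j Y)) Z m"
    using Z by (auto simp: zero cf_star cf_gg vec_at_def pairing_j pw_1 pw_minus_1)
qed

text \<open>The involution is known on V and through its algebraic laws only, hence the induction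
  over tensors. In each step representatives \<open>x'\<close>, \<open>y'\<close> of the adjoint
  classes are chosen, and the induction hypothesis identifies the images of their lifts in the
  completion.\<close>

lemma theta_star:
  assumes "f \<in> carrier tensor_algebra"
  shows "theta (st (cls R f)) = star S.CB (theta (cls R f))"
  using assms
proof (induction rule: tensor_algebra_induct)
  case one
  have "star D \<one>\<^bsub>D\<^esub> = \<one>\<^bsub>D\<^esub>"
    by (intro cf_eqI star_closed one_closed) (simp add: cf_star cf_one)
  then show ?case using theta_cls[OF T.one_closed] S.tensor_lift_one[of gen] gen_closed st_one S.emb_star[OF one_closed]
    by (simp add: cls_one)
next
  case (gen v)
  have "theta (st (cls R (tensor1 v))) = S.emb (complex_of_real (1 / sqrt 2) \<odot>\<^bsub>D\<^esub> gg (j v))"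
    by (simp only: st_tensor1 theta_cls[OF tensor1_closed] \<Phi>_tensor1)
  also have "complex_of_real (1 / sqrt 2) \<odot>\<^bsub>D\<^esub> gg (j v) = star D (complex_of_real (1 / sqrt 2) \<odot>\<^bsub>D\<^esub> gg v)"
    by (simp add: S.star_smult gg_closed gg_star)
  also have "S.emb \<dots> = star S.CB (theta (cls R (tensor1 v)))"
    by (simp only: S.emb_star[OF smult_closed[OF gg_closed]] theta_cls[OF tensor1_closed] \<Phi>_tensor1)
  finally show ?case .
next
  case (add x y)
  have c: "st (cls R x) \<in> carrier QA" "st (cls R y) \<in> carrier QA" using add st_closed cls_closed by blast+
  then obtain x' y' where xy: "x' \<in> carrier tensor_algebra" "st (cls R x) = cls R x'"
    "y' \<in> carrier tensor_algebra" "st (cls R y) = cls R y'" by (auto simp: carrier_quadratic)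
  have "theta (st (cls R (x \<oplus>\<^sub>T y))) = theta (cls R (x' \<oplus>\<^sub>T y'))"
    using add xy by (simp add: cls_add[symmetric] st_add cls_closed)
  also have "\<dots> = theta (cls R x') \<oplus>\<^bsub>S.CB\<^esub> theta (cls R y')"
    using xy gen_closed by (simp add: theta_cls S.tensor_lift_add S.emb_add \<Phi>_closed)
  also have "\<dots> = S.emb (star D (\<Phi> x)) \<oplus>\<^bsub>S.CB\<^esub> S.emb (star D (\<Phi> y))"
    using add xy by (simp add: theta_cls S.emb_star \<Phi>_closed)
  also have "\<dots> = star S.CB (theta (cls R (x \<oplus>\<^sub>T y)))"
    using add gen_closed by (simp add: theta_cls S.emb_star \<Phi>_closed S.tensor_lift_add S.star_add star_closed add_closed
        S.emb_add[of "star D (\<Phi> x)"])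
  finally show ?case .
next
  case (mult x y)
  have c: "st (cls R x) \<in> carrier QA" "st (cls R y) \<in> carrier QA" using mult st_closed cls_closed by blast+
  then obtain x' y' where xy: "x' \<in> carrier tensor_algebra" "st (cls R x) = cls R x'"
    "y' \<in> carrier tensor_algebra" "st (cls R y) = cls R y'" by (auto simp: carrier_quadratic)
  have "theta (st (cls R (x \<otimes>\<^sub>T y))) = theta (cls R (y' \<otimes>\<^sub>T x'))"
    using mult xy by (simp add: cls_mult[symmetric] st_mult cls_closed)
  also have "\<dots> = theta (cls R y') \<otimes>\<^bsub>S.CB\<^esub> theta (cls R x')"
    using xy gen_closed by (simp add: theta_cls S.tensor_lift_mult S.emb_mult \<Phi>_closed)
  also have "\<dots> = S.emb (star D (\<Phi> y)) \<otimes>\<^bsub>S.CB\<^esub> S.emb (star D (\<Phi> x))"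
    using mult xy by (simp add: theta_cls S.emb_star \<Phi>_closed)
  also have "\<dots> = star S.CB (theta (cls R (x \<otimes>\<^sub>T y)))"
    using mult gen_closed by (simp add: theta_cls S.emb_star \<Phi>_closed S.tensor_lift_mult S.star_mult star_closed mult_closed
        S.emb_mult[of "star D (\<Phi> y)"])
  finally show ?case .
next
  case (smult c x)
  obtain x' where x': "x' \<in> carrier tensor_algebra" "st (cls R x) = cls R x'"
    using smult st_closed[OF cls_closed] carrier_quadratic by blast
  have "theta (st (cls R (c \<odot>\<^sub>T x))) = theta (cls R (cnj c \<odot>\<^sub>T x'))"
    using smult x' by (simp add: cls_smult[symmetric] st_smult cls_closed)
  also have "\<dots> = cnj c \<odot>\<^bsub>S.CB\<^esub> theta (cls R x')"
    using x' gen_closed by (simp add: theta_cls tensor_smult_closed S.tensor_lift_smult S.emb_smult \<Phi>_closed)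
  also have "\<dots> = cnj c \<odot>\<^bsub>S.CB\<^esub> S.emb (star D (\<Phi> x))"
    using smult x' by (simp add: theta_cls S.emb_star \<Phi>_closed)
  also have "\<dots> = star S.CB (theta (cls R (c \<odot>\<^sub>T x)))"
    using smult gen_closed by (simp add: theta_cls tensor_smult_closed S.emb_star \<Phi>_closed S.tensor_lift_smult S.star_smult star_closed smult_closed
        S.emb_smult[of "star D (\<Phi> x)"])
  finally show ?case .
qed

lemma theta_hom: "theta \<in> star_hom AA S.CB"
  unfolding star_hom_def mem_Collect_eq AA_simps
proof (intro conjI ballI allI ring_hom_memI; (unfold AA_simps)?)
  show "theta x \<in> carrier S.CB" if "x \<in> carrier QA" for x
    using that by (auto simp: carrier_quadratic theta_cls S.emb_closed \<Phi>_closed)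
  show "theta (x \<otimes>\<^bsub>QA\<^esub> y) = theta x \<otimes>\<^bsub>S.CB\<^esub> theta y" if "x \<in> carrier QA" "y \<in> carrier QA" for x y
    using that gen_closed by (auto simp: carrier_quadratic cls_mult theta_cls S.emb_mult \<Phi>_closed S.tensor_lift_mult)
  show "theta (x \<oplus>\<^bsub>QA\<^esub> y) = theta x \<oplus>\<^bsub>S.CB\<^esub> theta y" if "x \<in> carrier QA" "y \<in> carrier QA" for x y
    using that gen_closed by (auto simp: carrier_quadratic cls_add theta_cls S.emb_add \<Phi>_closed S.tensor_lift_add)
  show "theta \<one>\<^bsub>QA\<^esub> = \<one>\<^bsub>S.CB\<^esub>"
    using gen_closed by (simp add: cls_one theta_cls S.tensor_lift_one S.emb_one)
  show "theta (c \<odot>\<^bsub>QA\<^esub> x) = c \<odot>\<^bsub>S.CB\<^esub> theta x" if "x \<in> carrier QA" for c x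
    using that gen_closed
    by (auto simp: carrier_quadratic cls_smult theta_cls tensor_smult_closed S.emb_smult \<Phi>_closed S.tensor_lift_smult)
  show "theta (st x) = star S.CB (theta x)" if "x \<in> carrier QA" for x
    using that theta_star by (auto simp: carrier_quadratic)
qed

lemma sqrt2_inverse: "complex_of_real (sqrt 2) * complex_of_real (1 / sqrt 2) = 1"
  by (simp flip: of_real_mult of_real_divide)

lemma theta_gen: "complex_of_real (sqrt 2) \<odot>\<^bsub>S.CB\<^esub> theta (cls R (tensor1 Y)) = S.emb (gg Y)"
proof -
  have "complex_of_real (sqrt 2) \<odot>\<^bsub>S.CB\<^esub> theta (cls R (tensor1 Y))
      = S.emb (complex_of_real (sqrt 2) \<odot>\<^bsub>D\<^esub> (complex_of_real (1 / sqrt 2) \<odot>\<^bsub>D\<^esub> gg Y))"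
    by (simp only: theta_cls[OF tensor1_closed] \<Phi>_tensor1 S.emb_smult[OF smult_closed[OF gg_closed]])
  also have "complex_of_real (sqrt 2) \<odot>\<^bsub>D\<^esub> (complex_of_real (1 / sqrt 2) \<odot>\<^bsub>D\<^esub> gg Y) = gg Y"
    by (simp only: S.smult_assoc[OF gg_closed, symmetric] sqrt2_inverse S.smult_one[OF gg_closed])
  finally show ?thesis .
qed

text \<open>After division by sqrt 2 both maps agree on the classes of V, and these generate the
  algebra.\<close>

lemma theta_unique:
  assumes \<theta>: "\<theta> \<in> star_hom AA S.CB"
    and gen: "\<And>Y. complex_of_real (sqrt 2) \<odot>\<^bsub>S.CB\<^esub> \<theta> (cls R (tensor1 Y)) = S.emb (gg Y)"
    and x: "x \<in> carrier QA"
  shows "\<theta> x = theta x"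
proof -
  have H: "t \<in> star_hom AA S.CB \<Longrightarrow> t \<in> ring_hom AA S.CB"
    "t \<in> star_hom AA S.CB \<Longrightarrow> y \<in> carrier QA \<Longrightarrow> t (c \<odot>\<^bsub>QA\<^esub> y) = c \<odot>\<^bsub>S.CB\<^esub> t y" for t c y
    by (auto simp: star_hom_def AA_simps)
  have hom: "t y \<in> carrier S.CB" "t (y \<otimes>\<^bsub>QA\<^esub> z) = t y \<otimes>\<^bsub>S.CB\<^esub> t z" "t (y \<oplus>\<^bsub>QA\<^esub> z) = t y \<oplus>\<^bsub>S.CB\<^esub> t z"
    "t \<one>\<^bsub>QA\<^esub> = \<one>\<^bsub>S.CB\<^esub>"
    if "t \<in> star_hom AA S.CB" "y \<in> carrier QA" "z \<in> carrier QA" for t y z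
    using H(1)[OF that(1)] that ring_hom_closed[of t AA S.CB] ring_hom_mult[of t AA S.CB]
      ring_hom_add[of t AA S.CB] ring_hom_one[of t AA S.CB] by (simp_all add: AA_simps)
  note hom_one = hom(4)[OF _ cls_closed[OF T.one_closed] cls_closed[OF T.one_closed]]
  have "\<theta> (cls R f) = theta (cls R f)" if "f \<in> carrier tensor_algebra" for f
    using that
  proof (induction rule: tensor_algebra_induct)
    case one
    show ?case using hom_one[OF \<theta>] hom_one[OF theta_hom] by (simp add: cls_one)
  next
    case (gen v)
    have "X = complex_of_real (1 / sqrt 2) \<odot>\<^bsub>S.CB\<^esub> (complex_of_real (sqrt 2) \<odot>\<^bsub>S.CB\<^esub> X)" if "X \<in> carrier S.CB" for X
      using S.completion_smult_assoc[OF that] S.completion_smult_one[OF that] sqrt2_inverse by (simp add: mult.commute)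
    from this[OF hom(1)[OF \<theta>]] this[OF hom(1)[OF theta_hom]] show ?case
      using assms(2) theta_gen cls_closed[OF tensor1_closed] by metis
  next
    case (add x y)
    then show ?case using hom(3)[OF \<theta>] hom(3)[OF theta_hom] by (simp add: cls_add[symmetric] cls_closed)
  next
    case (mult x y)
    then show ?case using hom(2)[OF \<theta>] hom(2)[OF theta_hom] by (simp add: cls_mult[symmetric] cls_closed)
  next
    case (smult c x)
    then show ?case using H(2)[OF \<theta>] H(2)[OF theta_hom] by (simp add: cls_smult[symmetric] cls_closed)
  qed
  then show ?thesis using x by (auto simp: carrier_quadratic)
qed

section \<open>The norm estimates\<close>

text \<open>The seminorm is known to satisfy only \<open>p (c \<odot> x) \<le> |c| p x\<close>;
  using this with sqrt 2 and with its inverse gives equality.\<close>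

lemma theta_norm: "sqrt 2 * alg_norm S.CB (theta (cls R (tensor1 Y))) = universal_norm D (gg Y)"
proof -
  let ?x = "complex_of_real (1 / sqrt 2) \<odot>\<^bsub>D\<^esub> gg Y"
  have x: "?x \<in> carrier D" by (intro smult_closed gg_closed)
  have g: "gg Y = complex_of_real (sqrt 2) \<odot>\<^bsub>D\<^esub> ?x"
    by (simp only: S.smult_assoc[OF gg_closed, symmetric] sqrt2_inverse S.smult_one[OF gg_closed])
  have "universal_norm D ?x \<le> 1 / sqrt 2 * universal_norm D (gg Y)"
    using S.p_smult[OF gg_closed, of "complex_of_real (1 / sqrt 2)" Y] by (simp add: norm_divide)
  then have "sqrt 2 * universal_norm D ?x \<le> universal_norm D (gg Y)" by (simp add: field_simps)
  moreover have "universal_norm D (gg Y) \<le> sqrt 2 * universal_norm D ?x"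
    using S.p_smult[OF x, of "complex_of_real (sqrt 2)"] g by simp
  ultimately have "sqrt 2 * universal_norm D ?x = universal_norm D (gg Y)" by simp
  then show ?thesis by (simp only: theta_cls[OF tensor1_closed] \<Phi>_tensor1 S.alg_norm_emb[OF x])
qed

lemma sup_norm_eq: "sup_norm K \<sigma> h Y = Sup (insert 0 ((\<lambda>Z. cmod (pairing Y (ap Z))) ` K))"
proof -
  have "sqrt (Re (herm \<sigma> h 1 (lin_section K Y) (lin_section K Y) Z)) = cmod (pairing Y (ap Z))" if Z: "Z \<in> K" for Z
    unfolding herm_eq[OF Z] co_lin_section[OF Z] complex_norm_square[symmetric] by simp
  then have "(\<lambda>Z. sqrt (Re (herm \<sigma> h 1 (lin_section K Y) (lin_section K Y) Z))) ` K = (\<lambda>Z. cmod (pairing Y (ap Z))) ` K"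
    by (intro image_cong refl)
  then show ?thesis by (simp add: sup_norm_def)
qed

lemma pairing_le_norm: "Z \<in> K \<Longrightarrow> cmod (pairing Y (ap Z)) \<le> universal_norm D (gg Y)"
  using cf_le_universal_norm[OF _ gg_closed, of Z Y 1] cf_gg[of Z Y 1] by (simp add: vec_at_def)

lemma lower_bound: "sup_norm K \<sigma> h Y \<le> universal_norm D (gg Y)"
  unfolding sup_norm_eq using pairing_le_norm S.p_nonneg[OF gg_closed] by (intro cSup_least) auto

text \<open>Each of the two homogeneous parts is bounded by its coefficient. The part of degree -1
  evaluates \<open>Y\<close> on conjugates of points of \<open>K\<close>; invariance of
  \<open>K\<close> under conjugation makes these points of \<open>K\<close> again, so the same
  supremum applies.\<close>

lemma upper_bound:
  assumes cjK: "cj ` K = K" shows "universal_norm D (gg Y) \<le> 2 * sup_norm K \<sigma> h Y"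
proof -
  let ?s = "sup_norm K \<sigma> h Y"
  let ?A = "insert 0 ((\<lambda>Z. cmod (pairing Y (ap Z))) ` K)"
  have bdd: "bdd_above ?A"
    using pairing_le_norm S.p_nonneg[OF gg_closed] by (intro bdd_aboveI[of _ "universal_norm D (gg Y)"]) auto
  have up: "cmod (pairing Y (ap Z)) \<le> ?s" if "Z \<in> K" for Z
    unfolding sup_norm_eq using that by (intro cSup_upper bdd) auto
  have s0: "0 \<le> ?s" unfolding sup_norm_eq by (intro cSup_upper bdd) auto
  have up': "cmod (pairing Y (jd (ap Z))) \<le> ?s" if Z: "Z \<in> K" for Z
  proof -
    let ?W = "cj Z"
    have W: "?W \<in> K" using Z cjK by blast
    have nz: "ap ?W \<noteq> 0" using \<kappa>_pos[OF W] rep_nonzero[of ?W] by (simp add: ap_def)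
    obtain c where c: "jd (ap Z) = c *s ap ?W"
      using jd_ap_in_line[of Z] line_eq_range[OF ap_in_line nz] by auto
    \<comment> \<open>As \<open>Q\<close> is symmetric and \<open>jd\<close> an involution,
      \<open>jd (ap Z)\<close> is normalised too and differs from \<open>ap ?W\<close> by a phase
      only.\<close>
    have "1 = bform Q (jd (ap Z)) (jd (jd (ap Z)))" using Q_ap[OF Z] symQ[of "jd (ap Z)" "ap Z"] by simp
    also have "\<dots> = of_real ((cmod c)\<^sup>2)"
      using Q_ap[OF W] metric_scale[of c "ap ?W"] by (simp add: c metric_fun_def del: dual_conj_dual_conj)
    finally have "(cmod c)\<^sup>2 = 1" by (metis of_real_eq_1_iff)
    then have "cmod c = 1" by (simp add: power2_eq_1_iff) (metis abs_norm_cancel abs_neg_one norm_ge_zero)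
    then show ?thesis using up[OF W] by (simp add: c pairing_scale_right norm_mult)
  qed
  have "universal_norm D (monomial 1 (lin_section K Y)) \<le> ?s"
    by (rule homogeneous_universal_norm[OF mono_closed(1) supp_monomial s0]) (simp add: cf_mono up)
  moreover have "universal_norm D (monomial (- 1) (lin_section K (j Y))) \<le> ?s"
    by (rule homogeneous_universal_norm[OF mono_closed(2) supp_monomial s0]) (simp add: cf_mono up')
  ultimately show ?thesis using S.p_add[OF mono_closed(1)[of Y] mono_closed(2)[of "j Y"]] unfolding gg_def by simp
qed

section \<open>The image of \<open>Q\<close>\<close>

text \<open>Where the fourth power of \<sigma> moves the point, centrality forces the vanishing. As
  the vanishing locus is closed, density of such points in \<open>F\<close> extends it to all of
  \<open>F\<close>.\<close>

lemma Q_vanishes: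
  assumes F: "F \<subseteq> E" and cF: "central_on R E \<sigma> Q ((\<lambda>Z. (Z, \<sigma> Z)) ` F)"
    and dense: "F \<subseteq> closure {Z \<in> F. (\<sigma> ^^ 4) Z \<noteq> Z}" and Z: "Z \<in> F"
    and z: "z \<in> line Z" and z': "z' \<in> line (\<sigma> Z)"
  shows "bform Q z z' = 0"
proof -
  \<comment> \<open>The relations are kept together with \<open>Q\<close>, so that the line
    \<open>Z'\<close> found over a limit point has to be \<open>\<sigma> Z\<close>. This replaces an
    appeal to continuity of \<sigma> on \<open>F\<close>.\<close>
  let ?S = "{p :: (complex^'n) \<times> (complex^'n). \<forall>w\<in>insert Q R. bform w (fst p) (snd p) = 0}"
  let ?C = "{Z. \<exists>Z'\<in>UNIV. (rep Z, rep Z') \<in> ?S}"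
  have cl: "closed ?C"
    by (rule closed_proj_projection[OF closed_pairs closed_UNIV]) (simp add: bform_scale)
  have "{Z \<in> F. (\<sigma> ^^ 4) Z \<noteq> Z} \<subseteq> ?C"
  proof
    fix Y assume "Y \<in> {Z \<in> F. (\<sigma> ^^ 4) Z \<noteq> Z}"
    then have Y: "Y \<in> F" "(\<sigma> ^^ 4) Y \<noteq> Y" by auto
    then have YE: "Y \<in> E" "(Y, \<sigma> Y) \<in> char_relation R" using F char_iff by auto
    have "bform Q (rep Y) (rep (\<sigma> Y)) = 0"
    proof (rule ccontr)
      assume nz: "bform Q (rep Y) (rep (\<sigma> Y)) \<noteq> 0"
      let ?T = "inv_into E \<sigma> Y"
      have "bform w (rep (\<sigma> (\<sigma> Y))) (rep ?T) = 0" if w: "w \<in> R" for w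
      proof -
        have "(Y, \<sigma> Y) \<in> (\<lambda>Z. (Z, \<sigma> Z)) ` F" using Y by blast
        then have "bform w (rep Y) (rep (\<sigma> Y)) * bform Q (rep (\<sigma> (\<sigma> Y))) (rep ?T)
            + bform Q (rep Y) (rep (\<sigma> Y)) * bform w (rep (\<sigma> (\<sigma> Y))) (rep ?T) = 0"
          using cF w rep_in_line unfolding central_on_def by blast
        then show ?thesis using nz YE(2) w by (simp add: char_rep)
      qed
      then have "(\<sigma> (\<sigma> Y), ?T) \<in> char_relation R" by (simp add: char_rep)
      then have "?T = \<sigma> (\<sigma> (\<sigma> Y))" using char_iff by blast
      then have "\<sigma> (\<sigma> (\<sigma> (\<sigma> Y))) = Y" using YE(1) image_E by (metis f_inv_into_f)
      then show False using Y(2) by (simp add: eval_nat_numeral)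
    qed
    then show "Y \<in> ?C" using YE(2) by (auto simp: char_rep)
  qed
  then have "F \<subseteq> ?C" using dense closure_minimal[OF _ cl] by blast
  then obtain Z' where Z': "(rep Z, rep Z') \<in> ?S" using Z by blast
  then have "(Z, Z') \<in> char_relation R" by (simp add: char_rep)
  then have "Z' = \<sigma> Z" using char_iff by blast
  then have "bform Q (rep Z) (rep (\<sigma> Z)) = 0" using Z' by simp
  then show ?thesis using z z' unfolding line_rep[of Z] line_rep[of "\<sigma> Z"] by (auto simp: bform_scale)
qed

text \<open>The component of degree 2 evaluates \<open>Q\<close> on the graph over \<open>K\<close>,
  that of degree -2 on the graph over the conjugate of \<open>K\<close>. For this reason
  \<open>F\<close> has to contain both.\<close>

lemma theta_Q:
  assumes F: "F \<subseteq> E" and KF: "K \<union> cj ` K \<subseteq> F" and cF: "central_on R E \<sigma> Q ((\<lambda>Z. (Z, \<sigma> Z)) ` F)"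
    and dense: "F \<subseteq> closure {Z \<in> F. (\<sigma> ^^ 4) Z \<noteq> Z}"
  shows "theta (cls R (tensor2 Q)) = \<one>\<^bsub>S.CB\<^esub>"
proof -
  note v = Q_vanishes[OF F cF dense]
  have "\<Phi> (tensor2 Q) = \<one>\<^bsub>D\<^esub>"
  proof (intro cf_eqI \<Phi>_closed one_closed)
    fix Z m assume Z: "Z \<in> K"
    have "bform Q (ap Z) (ap (\<sigma> Z)) = 0" using v[of Z] Z KF ap_in_line by blast
    moreover have "bform Q (jd (ap (\<tau> Z))) (jd (ap (\<tau> (\<tau> Z)))) = 0"
    proof -
      have "cj (\<tau> Z) \<in> F" using KF \<tau>_in[OF Z] by blast
      moreover have "\<sigma> (cj (\<tau> Z)) = cj (\<tau> (\<tau> Z))" using \<sigma>_cj[OF \<tau>_in[OF Z]] .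
      ultimately show ?thesis using v[of "cj (\<tau> Z)"] jd_ap_in_line by metis
    qed
    moreover have "bform Q (ap Z) (jd (ap Z)) + bform Q (jd (ap (\<tau> Z))) (ap (\<tau> Z)) = 2"
      using Q_ap[OF Z] Q_ap[OF \<tau>_in[OF Z]] symQ[of "jd (ap (\<tau> Z))" "ap (\<tau> Z)"] by simp
    ultimately show "cf (\<Phi> (tensor2 Q)) Z m = cf \<one>\<^bsub>D\<^esub> Z m"
      unfolding cf_tensor2_cases[OF Z] cf_one[OF Z] by simp
  qed
  then show ?thesis by (simp add: theta_cls[OF tensor2_closed] S.emb_one)
qed

end

text \<open>The condition on the fourth power of \<sigma> enters as density, in a part
  \<open>F\<close> of \<open>E\<close> on whose graph \<open>Q\<close> is central, of the points
  that it moves. Invariance of \<open>K\<close> under conjugation is a premise of the upper bound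
  alone, because the adjoint term carries values of \<open>Y\<close> at conjugate points.\<close>

theorem theorem11p8:
  fixes R :: "(complex^'n^'n) set"
    and st :: "('n::finite list \<Rightarrow> complex) set \<Rightarrow> ('n list \<Rightarrow> complex) set"
    and j :: "complex^'n \<Rightarrow> complex^'n"
    and E K :: "'n proj set" and \<sigma> :: "'n proj \<Rightarrow> 'n proj"
    and Q :: "complex^'n^'n"
  assumes "quadratic_star R st j"
    and "characteristic_data R E \<sigma>"
    and "compact K" and "K \<subseteq> E" and "\<sigma> ` K = K"
    and "transpose Q = Q"
    and "central_on R E \<sigma> Q ((\<lambda>Z. (Z, proj_conj j Z)) ` K)"
    and "strictly_positive_on j Q K"
  shows "let A = quadratic_star_algebra R st;
             h = metric_fun j Q;
             D = monomial_algebra K \<sigma> h;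
             B = crossed_product K \<sigma> h;
             gen = (\<lambda>\<theta>. \<forall>Y. complex_of_real (sqrt 2) \<odot>\<^bsub>B\<^esub> \<theta> (cls R (tensor1 Y)) =
               crossed_embed K \<sigma> h (monomial 1 (lin_section K Y)
                 \<oplus>\<^bsub>D\<^esub> monomial (- 1) (lin_section K (j Y))))
         in \<exists>\<theta>.
           \<theta> \<in> star_hom A B \<and> gen \<theta> \<and>
           (\<forall>\<theta>'. \<theta>' \<in> star_hom A B \<and> gen \<theta>' \<longrightarrow> (\<forall>x\<in>carrier A. \<theta>' x = \<theta> x)) \<and>
           (\<forall>Y. sup_norm K \<sigma> h Y \<le> sqrt 2 * alg_norm B (\<theta> (cls R (tensor1 Y)))) \<and>
           (proj_conj j ` K = K \<longrightarrow>
             (\<forall>Y. sqrt 2 * alg_norm B (\<theta> (cls R (tensor1 Y))) \<le> 2 * sup_norm K \<sigma> h Y)) \<and>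
           (\<forall>F. F \<subseteq> E \<and> K \<union> proj_conj j ` K \<subseteq> F \<and>
               central_on R E \<sigma> Q ((\<lambda>Z. (Z, \<sigma> Z)) ` F) \<and>
               F \<subseteq> closure {Z \<in> F. (\<sigma> ^^ 4) Z \<noteq> Z} \<longrightarrow>
             \<theta> (cls R (tensor2 Q)) = \<one>\<^bsub>B\<^esub>)"
proof -
  interpret central_form R st j E K \<sigma> Q
    by (intro central_form.intro quadratic_star_locale.intro central_form_axioms.intro assms)
  show ?thesis
    unfolding Let_def BB_eq crossed_embed_eq gg_def[symmetric] AA_simps
  proof (intro exI[of _ theta] conjI allI impI ballI)
    show "theta \<in> star_hom AA S.CB" by (rule theta_hom)
    show "complex_of_real (sqrt 2) \<odot>\<^bsub>S.CB\<^esub> theta (cls R (tensor1 Y)) = S.emb (gg Y)" for Y by (rule theta_gen)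
    show "\<theta>' x = theta x"
      if "\<theta>' \<in> star_hom AA S.CB \<and> (\<forall>Y. complex_of_real (sqrt 2) \<odot>\<^bsub>S.CB\<^esub> \<theta>' (cls R (tensor1 Y)) = S.emb (gg Y))"
        "x \<in> carrier QA" for \<theta>' x
      using that by (intro theta_unique) blast+
    show "sup_norm K \<sigma> h Y \<le> sqrt 2 * alg_norm S.CB (theta (cls R (tensor1 Y)))" for Y
      unfolding theta_norm by (rule lower_bound)
    show "sqrt 2 * alg_norm S.CB (theta (cls R (tensor1 Y))) \<le> 2 * sup_norm K \<sigma> h Y" if "cj ` K = K" for Y
      unfolding theta_norm by (rule upper_bound[OF that])
    show "theta (cls R (tensor2 Q)) = \<one>\<^bsub>S.CB\<^esub>"
      if "F \<subseteq> E \<and> K \<union> cj ` K \<subseteq> F \<and> central_on R E \<sigma> Q ((\<lambda>Z. (Z, \<sigma> Z)) ` F) \<and>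
          F \<subseteq> closure {Z \<in> F. (\<sigma> ^^ 4) Z \<noteq> Z}" for F
      using that by (intro theta_Q[of F]) blast+
  qed
qed

end
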